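(* Let $(v_{\text{snap}},p_{\text{snap}})\in V_{\text{snap}}\times Q$ be the snapshot solution and $(v_{\text{ms}},p_{\text{ms}})\in V_{\text{ms}}\times Q$ the multiscale solution of the mixed flow problem, where $V_{\text{ms}}$ is built from the first $l_i$ eigenfunctions on each coarse neighborhood $\omega_i$, using either spectral problem 1 (on all neighborhoods) or spectral problem 2 (on all neighborhoods). Then $$\|v_{\text{snap}} - v_{\text{ms}}\|_{\mathcal{L}^2(D; \kappa^{-1})}^2 \leq C_{\text{err}} \sum_{i=1}^{N_e} \|R_{i}\|_{(V_{\text{snap}}^{(i)})^*}^2 \,(\lambda_{l_i + 1}^{(i)})^{-1},$$ where: (1) if spectral problem 1 is used, then $C_{\text{err}} = \frac{C_{V}H}{h}$ and the dual norm $\|R_i\|_{(V_{\text{snap}}^{(i)})^*}=\sup_{0\ne v\in V_{\text{snap}}^{(i)}}|R_i(v)|/\|v\|_{V_{\text{snap}}^{(i)}}$ is taken with $\|\cdot\|_{V_{\text{snap}}^{(i)}}=\|\cdot\|_{H(\text{div}; \omega_i; \kappa^{-1})}$; here $C_V$ is a constant whose value depends on the polynomial order of the fine grid basis functions in $V_{\text{snap}}$; (2) if spectral problem 2 is used, then $C_{\text{err}} = N_{\mathcal{T}}$ and the dual norm is taken with $\|\cdot\|_{V_{\text{snap}}^{(i)}}=\|\cdot\|_{\mathcal{L}^2(\omega_i; \kappa^{-1})}$.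
   Context: Problem and meshes. $D$ is a computational domain in $\mathbb{R}^d$ with outward unit normal $n$; $\kappa>0$ is a (high-contrast) permeability field; the flow problem is $\kappa^{-1}v+\nabla p=0$, $\mathrm{div}(v)=f$ in $D$, $v\cdot n=g$ on $\partial D$. $\mathcal{T}^H$ is a partition of $D$ into finite elements (coarse blocks) of mesh size $H$; each coarse block is further partitioned so that the resulting fine partition $\mathcal{T}^h$ of size $h$ is conforming across coarse faces. $\mathcal{E}^H=\{E_1,\dots,E_{N_e}\}$ is the set of all coarse faces, $\omega_i=\bigcup\{K\in\mathcal{T}^H: E_i\subset\partial K\}$ is the coarse neighborhood of $E_i$ (a union of two coarse blocks for a face interior to $D$), $n_i$ is a fixed unit normal on $E_i$, and $N_{\mathcal{T}}$ is the maximum number of faces of a coarse block. $Q$ is the space of functions constant on each coarse block. Norms. $\|v\|_{\mathcal{L}^2(\Omega;\kappa^{-1})}^2=\int_\Omega\kappa^{-1}|v|^2$ and $\|v\|_{H(\text{div};\Omega;\kappa^{-1})}^2=\int_\Omega\kappa^{-1}|v|^2+\int_\Omega \mathrm{div}(v)^2$. Snapshot space. Write $E_i=\bigcup_{j=1}^{J_i}e_j$ with $e_j$ the fine faces contained in $E_i$. For each $j$, $v_j^{(i)}$ is the (fine-grid mixed finite element) solution, computed separately on each coarse block $K\subseteq\omega_i$, of $\kappa^{-1}v_j^{(i)}+\nabla p_j^{(i)}=0$, $\mathrm{div}(v_j^{(i)})=\alpha_j^{(i)}$, with zero normal component on $\partial\omega_i$ (apart from $E_i$ itself) and $v_j^{(i)}\cdot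 n_i=\delta_j^{(i)}$ on $E_i$, where $\delta_j^{(i)}=1$ on $e_j$ and $0$ on $E_i\setminus e_j$; $\alpha_j^{(i)}$ is constant on each coarse block and satisfies the compatibility condition $\int_K\alpha_j^{(i)}=\int_{\partial K}v_j^{(i)}\cdot n_{\partial K}$, with $n_{\partial K}$ the outward unit normal of $K$. These functions are extended by zero outside $\omega_i$. $V_{\text{snap}}^{(i)}=\mathrm{span}\{v_j^{(i)}\}_{j=1}^{J_i}$ and $V_{\text{snap}}=\bigoplus_{E_i\in\mathcal{E}^H}V_{\text{snap}}^{(i)}$. In particular every $v\in V_{\text{snap}}$ has divergence constant on each coarse block. Spectral problems. On each $\omega_i$ find $\lambda\in\mathbb{R}$ and $v\in V_{\text{snap}}^{(i)}$ with $a_i(v,w)=\lambda s_i(v,w)$ for all $w\in V_{\text{snap}}^{(i)}$. Spectral problem 1: $a_i(v,w)=\int_{E_i}\kappa^{-1}(v\cdot n_i)(w\cdot n_i)$, $s_i(v,w)=\frac1H\left(\int_{\omega_i}\kappa^{-1}v\cdot w+\int_{\omega_i}\mathrm{div}(v)\,\mathrm{div}(w)\right)$. Spectral problem 2: $a_i(v,w)=\int_{\omega_i}\kappa^{-1}\tilde v\cdot\tilde w$, $s_i(v,w)=\int_{\omega_i}\kappa^{-1}v\cdot w$, where for $v\in V_{\text{snap}}^{(i)}$, $\tilde v\in\bigoplus_{\omega_j\cap\omega_i\neq\emptyset}V_{\text{snap}}^{(j)}$ satisfies $\tilde v\cdot n_i=v\cdot n_i$ on $E_i$ and has minimal $\mathcal{L}^2(\omega_i;\kappa^{-1})$-norm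 among all functions of $\bigoplus_{\omega_j\cap\omega_i\neq\emptyset}V_{\text{snap}}^{(j)}$ with that normal component on $E_i$. The eigenvalues are ordered $\lambda_1^{(i)}\le\dots\le\lambda_{J_i}^{(i)}$ with eigenfunctions $\phi_1^{(i)},\dots,\phi_{J_i}^{(i)}$ (a basis of $V_{\text{snap}}^{(i)}$ orthogonal for $a_i$ and $s_i$). $V_{\text{ms}}^{(i)}=\mathrm{span}\{\phi_1^{(i)},\dots,\phi_{l_i}^{(i)}\}$ and $V_{\text{ms}}=\bigoplus_{E_i\in\mathcal{E}^H}V_{\text{ms}}^{(i)}$. Convention: if $l_i=J_i$ then $(\lambda_{l_i+1}^{(i)})^{-1}=0$. Discrete solutions. $g_H$, constant on each fine face of $\partial D$, is the projection of $g$: $\int_{E_i}(g_H-g)\,\phi\cdot n=0$ for all $\phi$ in the snapshot basis $\{v_j^{(i)}\}_j$ and all $E_i\subseteq\partial D$. For $V=V_{\text{ms}}$ or $V_{\text{snap}}$, let $V^0=\{v\in V: v\cdot n=0\text{ on }\partial D\}$. The multiscale solution (resp. snapshot solution) is a pair $(v_V,p_V)\in V\times Q$ with $V=V_{\text{ms}}$ (resp. $V=V_{\text{snap}}$), $v_V\cdot n=g_H$ on $\partial D$, and $\int_D\kappa^{-1}v_V\cdot w-\int_D\mathrm{div}(w)p_V=0$ for all $w\in V^0$, $\int_D\mathrm{div}(v_V)q=\int_D fq$ for all $q\in Q$; these solutions are assumed to exist. Residual. $R_i(v)=\int_{\omega_i}\kappa^{-1}v_{\text{ms}}\cdot v-\int_{\omega_i}\mathrm{div}(v)p_{\text{ms}}$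 for $v\in V_{\text{snap}}^{(i)}$.
   Formalization: In (1), C_V depends on polynomial order, dimension, fine-mesh regularity (each fine cell contains a ball of radius sigma*h) and a factor theta bounding kappa in an adjacent fine cell by theta times its coarse-face value; a constant depending on the order alone is false. *)

theory Defs
  imports "HOL-Analysis.Analysis"
begin

section \<open>Polynomials, divergence, integrals over flat faces\<close>

text \<open>Real polynomials of total degree at most \<open>k\<close> on a Euclidean space.\<close>

definition polys :: "nat \<Rightarrow> ('a::euclidean_space \<Rightarrow> real) set" where
  "polys k = {p. \<exists>c. p = (\<lambda>x. \<Sum>m\<in>{m \<in> Basis \<rightarrow>\<^sub>E {..k}. sum m Basis \<le> k}.
                              c m * (\<Prod>b\<in>Basis. (x \<bullet> b) ^ m b))}"

definition lin_subspace :: "('a \<Rightarrow> 'b::real_vector) set \<Rightarrow> bool" where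
  "lin_subspace S \<longleftrightarrow> (\<lambda>x. 0) \<in> S \<and> (\<forall>u\<in>S. \<forall>v\<in>S. \<forall>c. (\<lambda>x. u x + c *\<^sub>R v x) \<in> S)"

definition divg :: "('a::euclidean_space \<Rightarrow> 'a) \<Rightarrow> 'a \<Rightarrow> real" where
  "divg u x = (\<Sum>b\<in>Basis. frechet_derivative u (at x) b \<bullet> b)"

text \<open>For a unit vector \<open>n\<close>, the \<open>(d-1)\<close>-dimensional Lebesgue measure on the hyperplane through
  \<open>a\<close> orthogonal to \<open>n\<close>: the measure of \<open>A\<close> is the volume of the right prism of height 1 over \<open>A\<close>.
  It depends neither on the choice of \<open>a\<close> in the hyperplane nor on the sign of \<open>n\<close>.\<close>

definition hyperplane_measure :: "'a::euclidean_space \<Rightarrow> 'a \<Rightarrow> 'a measure" where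
  "hyperplane_measure a n =
     distr (restrict_space lborel {x. 0 \<le> n \<bullet> (x - a) \<and> n \<bullet> (x - a) \<le> 1}) borel
       (\<lambda>x. x - (n \<bullet> (x - a)) *\<^sub>R n)"

text \<open>Surface integral over a flat face \<open>f\<close> with unit normal \<open>n\<close>.\<close>

definition face_int :: "'a::euclidean_space set \<Rightarrow> 'a \<Rightarrow> ('a \<Rightarrow> real) \<Rightarrow> real" where
  "face_int f n \<phi> = (LINT x:f|hyperplane_measure (SOME a. a \<in> f) n. \<phi> x)"

text \<open>Outward unit normal of a full-dimensional polytope on one of its facets.\<close>

definition outn :: "'a::euclidean_space set \<Rightarrow> 'a set \<Rightarrow> 'a" where
  "outn K F = (SOME n. norm n = 1 \<and> (\<forall>x\<in>K. \<forall>y\<in>F. n \<bullet> (x - y) \<le> 0))"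

section \<open>Meshes\<close>

definition is_mesh :: "'a::euclidean_space set set \<Rightarrow> bool" where
  "is_mesh M \<longleftrightarrow> finite M \<and> M \<noteq> {} \<and> (\<forall>K\<in>M. polytope K \<and> interior K \<noteq> {}) \<and>
     (\<forall>K\<in>M. \<forall>K'\<in>M. K \<inter> K' face_of K \<and> K \<inter> K' face_of K')"

definition mesh_faces :: "'a::euclidean_space set set \<Rightarrow> 'a set set" where
  "mesh_faces M = {F. \<exists>K\<in>M. F facet_of K}"

definition mesh_size :: "'a::euclidean_space set set \<Rightarrow> real" where
  "mesh_size M = Max (diameter ` M)"

text \<open>Vector fields are represented cellwise: \<open>v \<tau>\<close> is the (polynomial) field on the fine cell \<open>\<tau>\<close>,
  so that one-sided traces on faces make sense; \<open>v \<tau>\<close> vanishes if \<open>\<tau>\<close> is not a cell of the support.\<close>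

type_synonym 'a vfield = "'a set \<Rightarrow> 'a \<Rightarrow> 'a"

definition lincomb :: "('i \<Rightarrow> real) \<Rightarrow> ('i \<Rightarrow> 'a::real_vector vfield) \<Rightarrow> 'i set \<Rightarrow> 'a vfield" where
  "lincomb c v I = (\<lambda>\<tau> x. \<Sum>i\<in>I. c i *\<^sub>R v i \<tau> x)"

definition fspan :: "('i \<Rightarrow> 'a::real_vector vfield) \<Rightarrow> 'i set \<Rightarrow> 'a vfield set" where
  "fspan v I = {lincomb c v I | c. True}"

definition space_sum :: "('i \<Rightarrow> 'a::real_vector vfield set) \<Rightarrow> 'i set \<Rightarrow> 'a vfield set" where
  "space_sum W I = {(\<lambda>\<tau> x. \<Sum>i\<in>I. u i \<tau> x) | u. \<forall>i\<in>I. u i \<in> W i}"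

section \<open>Discretisation data\<close>

text \<open>\<open>nrm E\<close> is the fixed unit normal of the coarse face \<open>E\<close>; \<open>Vloc \<tau>\<close> and \<open>Qloc \<tau>\<close> are the local
  velocity and pressure spaces, of polynomial degree at most \<open>degr\<close>, of the fine-grid mixed finite
  element; \<open>src\<close> is the source, \<open>bflux\<close> the boundary flux and \<open>bfluxH\<close> its projection (one value per
  fine boundary face); \<open>snap E f\<close> is the snapshot function of the fine face \<open>f\<close> in the coarse face
  \<open>E\<close>.  The domain is the interior of
  the union \<open>cdom\<close> of the (closed) coarse blocks.\<close>

record 'a gmsfem =
  coarse_mesh :: "'a set set"
  fine_mesh :: "'a set set"
  nrm :: "'a set \<Rightarrow> 'a"
  kappa :: "'a \<Rightarrow> real"
  degr :: nat
  Vloc :: "'a set \<Rightarrow> ('a \<Rightarrow> 'a) set"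
  Qloc :: "'a set \<Rightarrow> ('a \<Rightarrow> real) set"
  src :: "'a \<Rightarrow> real"
  bflux :: "'a \<Rightarrow> real"
  bfluxH :: "'a set \<Rightarrow> real"
  snap :: "'a set \<Rightarrow> 'a set \<Rightarrow> 'a set \<Rightarrow> 'a \<Rightarrow> 'a"

definition cdom :: "'a::euclidean_space gmsfem \<Rightarrow> 'a set" where
  "cdom G = \<Union>(coarse_mesh G)"

definition coarse_faces :: "'a::euclidean_space gmsfem \<Rightarrow> 'a set set" where
  "coarse_faces G = mesh_faces (coarse_mesh G)"

definition fine_in :: "'a::euclidean_space gmsfem \<Rightarrow> 'a set \<Rightarrow> 'a set set" where
  "fine_in G E = {f \<in> mesh_faces (fine_mesh G). f \<subseteq> E}"

definition nbr :: "'a::euclidean_space gmsfem \<Rightarrow> 'a set \<Rightarrow> 'a set set" where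
  "nbr G E = {K \<in> coarse_mesh G. E \<subseteq> frontier K}"

definition omega :: "'a::euclidean_space gmsfem \<Rightarrow> 'a set \<Rightarrow> 'a set" where
  "omega G E = \<Union>(nbr G E)"

text \<open>Maximal number of faces of a coarse block.\<close>

definition NT :: "'a::euclidean_space gmsfem \<Rightarrow> nat" where
  "NT G = Max ((\<lambda>K. card {E. E facet_of K}) ` coarse_mesh G)"

text \<open>Integral over a union \<open>\<Omega>\<close> of fine cells of a cellwise given integrand.\<close>

definition cell_int ::
  "'a::euclidean_space gmsfem \<Rightarrow> 'a set \<Rightarrow> ('a set \<Rightarrow> 'a \<Rightarrow> real) \<Rightarrow> real" where
  "cell_int G \<Omega> \<phi> = (\<Sum>\<tau>\<in>{\<tau> \<in> fine_mesh G. \<tau> \<subseteq> \<Omega>}. LINT x:\<tau>|lborel. \<phi> \<tau> x)"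

definition kip :: "'a::euclidean_space gmsfem \<Rightarrow> 'a set \<Rightarrow> 'a vfield \<Rightarrow> 'a vfield \<Rightarrow> real" where
  "kip G \<Omega> v w = cell_int G \<Omega> (\<lambda>\<tau> x. inverse (kappa G x) * (v \<tau> x \<bullet> w \<tau> x))"

definition divip :: "'a::euclidean_space gmsfem \<Rightarrow> 'a set \<Rightarrow> 'a vfield \<Rightarrow> 'a vfield \<Rightarrow> real" where
  "divip G \<Omega> v w = cell_int G \<Omega> (\<lambda>\<tau> x. divg (v \<tau>) x * divg (w \<tau>) x)"

definition L2_knorm :: "'a::euclidean_space gmsfem \<Rightarrow> 'a set \<Rightarrow> 'a vfield \<Rightarrow> real" where
  "L2_knorm G \<Omega> v = sqrt (kip G \<Omega> v v)"

definition Hdiv_knorm :: "'a::euclidean_space gmsfem \<Rightarrow> 'a set \<Rightarrow> 'a vfield \<Rightarrow> real" where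
  "Hdiv_knorm G \<Omega> v = sqrt (kip G \<Omega> v v + divip G \<Omega> v v)"

text \<open>A function in \<open>Q\<close> is given by its value \<open>q K\<close> on each coarse block \<open>K\<close>; this is the integral
  of \<open>div(v) q\<close> over a union \<open>\<Omega>\<close> of coarse blocks.\<close>

definition divQ ::
  "'a::euclidean_space gmsfem \<Rightarrow> 'a set \<Rightarrow> 'a vfield \<Rightarrow> ('a set \<Rightarrow> real) \<Rightarrow> real" where
  "divQ G \<Omega> v q =
     (\<Sum>K\<in>{K \<in> coarse_mesh G. K \<subseteq> \<Omega>}. cell_int G K (\<lambda>\<tau> x. divg (v \<tau>) x * q K))"

text \<open>Component along \<open>n\<close> of the trace of \<open>v\<close> on the fine face \<open>f\<close>, taken from some adjacent cell.
  It is used only for \<open>n\<close> normal to \<open>f\<close> and fields with continuous normal component.\<close>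

definition face_cell :: "'a::euclidean_space gmsfem \<Rightarrow> 'a set \<Rightarrow> 'a set" where
  "face_cell G f = (SOME \<tau>. \<tau> \<in> fine_mesh G \<and> f facet_of \<tau>)"

definition ntrace :: "'a::euclidean_space gmsfem \<Rightarrow> 'a \<Rightarrow> 'a vfield \<Rightarrow> 'a set \<Rightarrow> 'a \<Rightarrow> real" where
  "ntrace G n v f x = v (face_cell G f) x \<bullet> n"

definition bdry_normal :: "'a::euclidean_space gmsfem \<Rightarrow> 'a set \<Rightarrow> 'a" where
  "bdry_normal G f = outn (face_cell G f) f"

section \<open>Snapshot functions\<close>

definition fineV :: "'a::euclidean_space gmsfem \<Rightarrow> 'a set \<Rightarrow> 'a vfield set" where
  "fineV G K = {v. (\<forall>\<tau>\<in>fine_mesh G. \<tau> \<subseteq> K \<longrightarrow> v \<tau> \<in> Vloc G \<tau>) \<and>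
     (\<forall>\<tau>\<in>fine_mesh G. \<forall>\<tau>'\<in>fine_mesh G. \<forall>f. \<tau> \<subseteq> K \<longrightarrow> \<tau>' \<subseteq> K \<longrightarrow> f facet_of \<tau> \<longrightarrow> f facet_of \<tau>' \<longrightarrow>
        (\<forall>x\<in>f. v \<tau> x \<bullet> outn \<tau> f = v \<tau>' x \<bullet> outn \<tau> f))}"

definition fineV0 :: "'a::euclidean_space gmsfem \<Rightarrow> 'a set \<Rightarrow> 'a vfield set" where
  "fineV0 G K = {v \<in> fineV G K. \<forall>\<tau>\<in>fine_mesh G. \<forall>f. \<tau> \<subseteq> K \<longrightarrow> f facet_of \<tau> \<longrightarrow> f \<subseteq> frontier K \<longrightarrow>
     (\<forall>x\<in>f. v \<tau> x \<bullet> outn \<tau> f = 0)}"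

definition fineQ ::
  "'a::euclidean_space gmsfem \<Rightarrow> 'a set \<Rightarrow> ('a set \<Rightarrow> 'a \<Rightarrow> real) set" where
  "fineQ G K = {q. \<forall>\<tau>\<in>fine_mesh G. \<tau> \<subseteq> K \<longrightarrow> q \<tau> \<in> Qloc G \<tau>}"

text \<open>\<open>v\<close> restricted to the coarse block \<open>K\<close> is the mixed finite element solution with normal
  component 1 on the fine face \<open>e\<close> and 0 on the rest of the boundary of \<open>K\<close>; the boundary of \<open>K\<close>
  outside \<open>E\<close> is the part of the boundary of the neighbourhood \<open>omega G E\<close> belonging to \<open>K\<close>.\<close>

definition snapshot_on ::
  "'a::euclidean_space gmsfem \<Rightarrow> 'a set \<Rightarrow> 'a set \<Rightarrow> 'a set \<Rightarrow> 'a vfield \<Rightarrow> bool" where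
  "snapshot_on G E e K v \<longleftrightarrow> v \<in> fineV G K \<and>
     (\<forall>\<tau>\<in>fine_mesh G. \<forall>f. \<tau> \<subseteq> K \<longrightarrow> f facet_of \<tau> \<longrightarrow>
        (f \<subseteq> E \<longrightarrow> (\<forall>x\<in>f. v \<tau> x \<bullet> nrm G E = (if f = e then 1 else 0))) \<and>
        (f \<subseteq> frontier K \<longrightarrow> \<not> f \<subseteq> E \<longrightarrow> (\<forall>x\<in>f. v \<tau> x \<bullet> outn \<tau> f = 0))) \<and>
     (\<exists>p\<in>fineQ G K. \<exists>\<alpha>::real.
        (\<forall>w\<in>fineV0 G K. kip G K v w - cell_int G K (\<lambda>\<tau> x. divg (w \<tau>) x * p \<tau> x) = 0) \<and>
        (\<forall>q\<in>fineQ G K. cell_int G K (\<lambda>\<tau> x. divg (v \<tau>) x * q \<tau> x)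
                        = cell_int G K (\<lambda>\<tau> x. \<alpha> * q \<tau> x)) \<and>
        (LINT x:K|lborel. \<alpha>) =
          (\<Sum>\<tau>\<in>{\<tau> \<in> fine_mesh G. \<tau> \<subseteq> K}. \<Sum>f\<in>{f. f facet_of \<tau> \<and> f \<subseteq> frontier K}.
             face_int f (outn \<tau> f) (\<lambda>x. v \<tau> x \<bullet> outn \<tau> f)))"

definition is_snapshot ::
  "'a::euclidean_space gmsfem \<Rightarrow> 'a set \<Rightarrow> 'a set \<Rightarrow> 'a vfield \<Rightarrow> bool" where
  "is_snapshot G E e v \<longleftrightarrow> (\<forall>K\<in>nbr G E. snapshot_on G E e K v) \<and>
     (\<forall>\<tau>. \<not> (\<tau> \<in> fine_mesh G \<and> \<tau> \<subseteq> omega G E) \<longrightarrow> v \<tau> = (\<lambda>x. 0))"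

definition Vsnap_loc :: "'a::euclidean_space gmsfem \<Rightarrow> 'a set \<Rightarrow> 'a vfield set" where
  "Vsnap_loc G E = fspan (snap G E) (fine_in G E)"

definition Vsnap :: "'a::euclidean_space gmsfem \<Rightarrow> 'a vfield set" where
  "Vsnap G = space_sum (Vsnap_loc G) (coarse_faces G)"

section \<open>Standing assumptions\<close>

definition mesh_ok :: "'a::euclidean_space gmsfem \<Rightarrow> bool" where
  "mesh_ok G \<longleftrightarrow> is_mesh (coarse_mesh G) \<and> is_mesh (fine_mesh G) \<and>
     (\<forall>\<tau>\<in>fine_mesh G. \<exists>K\<in>coarse_mesh G. \<tau> \<subseteq> K) \<and>
     (\<forall>K\<in>coarse_mesh G. K = \<Union>{\<tau> \<in> fine_mesh G. \<tau> \<subseteq> K}) \<and>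
     (\<forall>E\<in>coarse_faces G. norm (nrm G E) = 1 \<and> (\<forall>x\<in>E. \<forall>y\<in>E. nrm G E \<bullet> (x - y) = 0))"

definition fe_ok :: "'a::euclidean_space gmsfem \<Rightarrow> bool" where
  "fe_ok G \<longleftrightarrow> (\<forall>\<tau>\<in>fine_mesh G.
     lin_subspace (Vloc G \<tau>) \<and> (\<forall>u\<in>Vloc G \<tau>. \<forall>b\<in>Basis. (\<lambda>x. u x \<bullet> b) \<in> polys (degr G)) \<and>
     lin_subspace (Qloc G \<tau>) \<and> Qloc G \<tau> \<subseteq> polys (degr G) \<and>
     (\<lambda>x. 1) \<in> Qloc G \<tau> \<and> divg ` Vloc G \<tau> = Qloc G \<tau>)"

definition data_ok :: "'a::euclidean_space gmsfem \<Rightarrow> bool" where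
  "data_ok G \<longleftrightarrow>
     kappa G \<in> borel_measurable borel \<and>
     (\<exists>lo hi. 0 < lo \<and> (\<forall>x\<in>cdom G. lo \<le> kappa G x \<and> kappa G x \<le> hi)) \<and>
     set_integrable lborel (cdom G) (src G) \<and>
     (\<forall>f\<in>fine_in G (frontier (cdom G)).
        set_integrable (hyperplane_measure (SOME a. a \<in> f) (bdry_normal G f)) f (bflux G))"

definition flux_projection :: "'a::euclidean_space gmsfem \<Rightarrow> bool" where
  "flux_projection G \<longleftrightarrow> (\<forall>E\<in>coarse_faces G. E \<subseteq> frontier (cdom G) \<longrightarrow> (\<forall>e\<in>fine_in G E.
     (\<Sum>f\<in>fine_in G E. face_int f (bdry_normal G f)
        (\<lambda>x. (bfluxH G f - bflux G x) * ntrace G (bdry_normal G f) (snap G E e) f x)) = 0))"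

definition gmsfem_ok :: "'a::euclidean_space gmsfem \<Rightarrow> bool" where
  "gmsfem_ok G \<longleftrightarrow> mesh_ok G \<and> fe_ok G \<and> data_ok G \<and>
     (\<forall>E\<in>coarse_faces G. \<forall>e\<in>fine_in G E. is_snapshot G E e (snap G E e)) \<and> flux_projection G"

text \<open>Each fine cell contains a ball of radius \<open>\<sigma>\<close> times the global fine mesh size.\<close>

definition quasi_uniform :: "'a::euclidean_space gmsfem \<Rightarrow> real \<Rightarrow> bool" where
  "quasi_uniform G \<sigma> \<longleftrightarrow> \<sigma> > 0 \<and> (\<forall>\<tau>\<in>fine_mesh G. \<exists>x. cball x (\<sigma> * mesh_size (fine_mesh G)) \<subseteq> \<tau>)"

text \<open>At every point of a coarse face, the value of the permeability is, up to the factor \<open>\<theta>\<close>, not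
  smaller than its values in one of the adjacent fine cells.  If the permeability is constant inside
  each fine cell and its face value is any mean of the two one-sided values, this holds with
  \<open>\<theta> = 1\<close>; for bounds \<open>lo\<close>, \<open>hi\<close> of the permeability, it always holds with \<open>\<theta> = hi / lo\<close>.\<close>

definition kappa_resolved :: "'a::euclidean_space gmsfem \<Rightarrow> real \<Rightarrow> bool" where
  "kappa_resolved G \<theta> \<longleftrightarrow> (\<forall>E\<in>coarse_faces G. \<forall>f\<in>fine_in G E. \<forall>x\<in>rel_interior f.
     \<exists>\<tau>\<in>fine_mesh G. f facet_of \<tau> \<and> (\<forall>y\<in>interior \<tau>. kappa G y \<le> \<theta> * kappa G x))"

section \<open>Spectral problems and multiscale space\<close>

type_synonym 'a form = "'a vfield \<Rightarrow> 'a vfield \<Rightarrow> real"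

definition a1 :: "'a::euclidean_space gmsfem \<Rightarrow> 'a set \<Rightarrow> 'a form" where
  "a1 G E v w = (\<Sum>f\<in>fine_in G E. face_int f (nrm G E)
     (\<lambda>x. inverse (kappa G x) * (ntrace G (nrm G E) v f x * ntrace G (nrm G E) w f x)))"

definition s1 :: "'a::euclidean_space gmsfem \<Rightarrow> 'a set \<Rightarrow> 'a form" where
  "s1 G E v w = (kip G (omega G E) v w + divip G (omega G E) v w) / mesh_size (coarse_mesh G)"

definition ext_candidates ::
  "'a::euclidean_space gmsfem \<Rightarrow> 'a set \<Rightarrow> 'a vfield \<Rightarrow> 'a vfield set" where
  "ext_candidates G E v =
     {u \<in> space_sum (Vsnap_loc G) {E' \<in> coarse_faces G. omega G E' \<inter> omega G E \<noteq> {}}.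
        \<forall>f\<in>fine_in G E. \<forall>x\<in>f. ntrace G (nrm G E) u f x = ntrace G (nrm G E) v f x}"

text \<open>The minimiser is unique as a function on \<open>omega G E\<close>, the only place where it is used.\<close>

definition min_ext :: "'a::euclidean_space gmsfem \<Rightarrow> 'a set \<Rightarrow> 'a vfield \<Rightarrow> 'a vfield" where
  "min_ext G E v = (SOME u. u \<in> ext_candidates G E v \<and>
     (\<forall>u'\<in>ext_candidates G E v. L2_knorm G (omega G E) u \<le> L2_knorm G (omega G E) u'))"

definition a2 :: "'a::euclidean_space gmsfem \<Rightarrow> 'a set \<Rightarrow> 'a form" where
  "a2 G E v w = kip G (omega G E) (min_ext G E v) (min_ext G E w)"

definition s2 :: "'a::euclidean_space gmsfem \<Rightarrow> 'a set \<Rightarrow> 'a form" where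
  "s2 G E v w = kip G (omega G E) v w"

text \<open>Eigenpairs on the neighbourhood of \<open>E\<close> are numbered by \<open>1, \<dots>, J\<close>, with \<open>J\<close> the number of
  fine faces in \<open>E\<close>.\<close>

definition eigensystem ::
  "'a::euclidean_space gmsfem \<Rightarrow> 'a set \<Rightarrow> 'a form \<Rightarrow> 'a form \<Rightarrow>
     (nat \<Rightarrow> real) \<Rightarrow> (nat \<Rightarrow> 'a vfield) \<Rightarrow> bool" where
  "eigensystem G E a s lam \<phi> \<longleftrightarrow> (let J = card (fine_in G E) in
     (\<forall>k\<in>{1..J}. \<phi> k \<in> Vsnap_loc G E \<and> (\<forall>w\<in>Vsnap_loc G E. a (\<phi> k) w = lam k * s (\<phi> k) w)) \<and>
     mono_on {1..J} lam \<and>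
     (\<forall>k\<in>{1..J}. \<forall>m\<in>{1..J}. k \<noteq> m \<longrightarrow> a (\<phi> k) (\<phi> m) = 0 \<and> s (\<phi> k) (\<phi> m) = 0) \<and>
     fspan \<phi> {1..J} = Vsnap_loc G E \<and>
     (\<forall>c. lincomb c \<phi> {1..J} = (\<lambda>\<tau> x. 0) \<longrightarrow> (\<forall>k\<in>{1..J}. c k = 0)))"

definition Vms ::
  "'a::euclidean_space gmsfem \<Rightarrow> ('a set \<Rightarrow> nat \<Rightarrow> 'a vfield) \<Rightarrow> ('a set \<Rightarrow> nat) \<Rightarrow> 'a vfield set"
  where "Vms G \<phi> l = space_sum (\<lambda>E. fspan (\<phi> E) {1..l E}) (coarse_faces G)"

definition inv_next_eigenvalue ::
  "'a::euclidean_space gmsfem \<Rightarrow> ('a set \<Rightarrow> nat \<Rightarrow> real) \<Rightarrow> ('a set \<Rightarrow> nat) \<Rightarrow> 'a set \<Rightarrow> real" where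
  "inv_next_eigenvalue G lam l E =
     (if l E = card (fine_in G E) then 0 else inverse (lam E (l E + 1)))"

section \<open>Discrete solutions and residuals\<close>

definition is_solution ::
  "'a::euclidean_space gmsfem \<Rightarrow> 'a vfield set \<Rightarrow> 'a vfield \<Rightarrow> ('a set \<Rightarrow> real) \<Rightarrow> bool" where
  "is_solution G V v p \<longleftrightarrow> v \<in> V \<and>
     (\<forall>f\<in>fine_in G (frontier (cdom G)). \<forall>x\<in>f. ntrace G (bdry_normal G f) v f x = bfluxH G f) \<and>
     (\<forall>w\<in>V. (\<forall>f\<in>fine_in G (frontier (cdom G)). \<forall>x\<in>f. ntrace G (bdry_normal G f) w f x = 0) \<longrightarrow>
        kip G (cdom G) v w - divQ G (cdom G) w p = 0) \<and>
     (\<forall>q. divQ G (cdom G) v q = (\<Sum>K\<in>coarse_mesh G. LINT x:K|lborel. src G x * q K))"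

definition residual ::
  "'a::euclidean_space gmsfem \<Rightarrow> 'a vfield \<Rightarrow> ('a set \<Rightarrow> real) \<Rightarrow> 'a set \<Rightarrow> 'a vfield \<Rightarrow> real" where
  "residual G vms pms E v = kip G (omega G E) vms v - divQ G (omega G E) v pms"

definition dual_norm ::
  "'a::euclidean_space vfield set \<Rightarrow> ('a vfield \<Rightarrow> real) \<Rightarrow> ('a vfield \<Rightarrow> real) \<Rightarrow> real" where
  "dual_norm V nv R = (SUP v\<in>V - {\<lambda>\<tau> x. 0}. \<bar>R v\<bar> / nv v)"

end

theory Submission
  imports Defs
begin

text \<open>Let \<open>e\<close> be the difference of the two velocities.  Subtracting the discrete equations shows that
  \<open>e\<close> has no flux through the boundary and that \<open>div e\<close> is orthogonal to \<open>Q\<close>; testing the snapshot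
  equation with \<open>e\<close> then gives \<open>\<parallel>e\<parallel>\<^sup>2 = - \<Sum> R\<^sub>E(e\<^sub>E)\<close>, where \<open>e\<^sub>E\<close> is the component of \<open>e\<close> in the local
  snapshot space of the coarse face \<open>E\<close>.  Expand \<open>e\<^sub>E\<close> in the eigenfunctions.  The part kept in the
  multiscale space is annihilated by the residual: if \<open>E\<close> is an interior face it is an admissible test
  field of the multiscale problem, and if \<open>E\<close> lies on the boundary then \<open>e\<^sub>E = 0\<close>.  The discarded part
  \<open>r\<^sub>E\<close> satisfies \<open>s(r\<^sub>E, r\<^sub>E) \<le> a(e\<^sub>E, e\<^sub>E) / \<lambda>\<close> with \<open>\<lambda>\<close> the first discarded eigenvalue.  By the
  Cauchy-Schwarz inequality the claim follows from a bound of \<open>\<Sum> a(e\<^sub>E, e\<^sub>E)\<close> by the square of the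
  weighted norm of \<open>e\<close> on the whole domain.  This is \<open>error_estimate\<close>.

  When \<open>a\<close> is defined by minimal extensions, \<open>e\<close> itself competes in the minimisation defining
  \<open>a(e\<^sub>E, e\<^sub>E)\<close>, so that \<open>a(e\<^sub>E, e\<^sub>E)\<close> is at most the energy of \<open>e\<close> on the neighbourhood of \<open>E\<close>; a cell
  belongs to at most as many neighbourhoods as its coarse block has faces.  The extension map need not
  be linear: the eigenvalue estimate only uses Bessel's inequality for the extended eigenfunctions
  (\<open>spectral_tail\<close>).

  When \<open>a\<close> is an integral over \<open>E\<close>, the required bound is an inverse trace inequality.  The normal
  trace of \<open>e\<close> on a fine face \<open>f\<close> is the coefficient of the corresponding snapshot function, hence
  constant.  Let \<open>x\<^sub>0\<close> be the centre of the ball of radius \<open>\<sigma> h\<close> inside a fine cell having \<open>f\<close> as facet.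
  On each ray from \<open>x\<^sub>0\<close> to \<open>f\<close> the normal component of \<open>e\<close> is a polynomial, whose value at \<open>f\<close> is
  controlled by its values further inside; integration over the cone with apex \<open>x\<^sub>0\<close> and base \<open>f\<close>
  gives \<open>face_cone_trace\<close>, with a constant depending only on the degree and the dimension.  The cones
  over different facets of a cell overlap in null sets only, so no bound on the number of facets
  of a cell enters.\<close>

section \<open>Shears and the volume of prisms\<close>

text \<open>If \<open>n \<bullet> x\<close> is rounded down to a multiple of \<open>1 / m\<close>, the shear in a direction \<open>w\<close> orthogonal to \<open>n\<close>
  becomes a piecewise translation that maps each slice between parallel hyperplanes to itself, so it
  preserves Lebesgue measure.\<close>

lemma emeasure_shear_step:
  fixes n w :: "'a::euclidean_space"
  assumes U: "U \<in> sets borel" and w: "n \<bullet> w = 0"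
  shows "emeasure lborel ((\<lambda>x. x + (of_int \<lfloor>m * (n \<bullet> x)\<rfloor> / m) *\<^sub>R w) -` U) = emeasure lborel U"
proof -
  define S where "S = (\<lambda>j::int. {x::'a. \<lfloor>m * (n \<bullet> x)\<rfloor> = j})"
  have S[measurable]: "S j \<in> sets borel" for j
    unfolding S_def by measurable
  have eq: "(\<lambda>x. x + (of_int \<lfloor>m * (n \<bullet> x)\<rfloor> / m) *\<^sub>R w) -` U
     = (\<Union>j. (\<lambda>x. (of_int j / m) *\<^sub>R w + x) -` (U \<inter> S j))"
    by (auto simp: S_def inner_add_right w add.commute)
  have tr: "emeasure lborel ((\<lambda>x. (of_int j / m) *\<^sub>R w + x) -` (U \<inter> S j)) = emeasure lborel (U \<inter> S j)" for j
  proof -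
    have "emeasure (distr lborel borel ((+) ((of_int j / m) *\<^sub>R w))) (U \<inter> S j) = emeasure lborel (U \<inter> S j)"
      by (simp add: lborel_distr_plus)
    then show ?thesis
      using U by (subst (asm) emeasure_distr) auto
  qed
  have m: "(\<lambda>x. (of_int j / m) *\<^sub>R w + x) -` (U \<inter> S j) \<in> sets lborel" for j
    using measurable_sets[of "\<lambda>x. (of_int j / m) *\<^sub>R w + x" borel borel "U \<inter> S j"] U by simp
  have "emeasure lborel ((\<lambda>x. x + (of_int \<lfloor>m * (n \<bullet> x)\<rfloor> / m) *\<^sub>R w) -` U) =
      (\<integral>\<^sup>+j. emeasure lborel ((\<lambda>x. (of_int j / m) *\<^sub>R w + x) -` (U \<inter> S j)) \<partial>count_space UNIV)"
    unfolding eq using m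
    by (intro emeasure_UN_countable) (auto simp: disjoint_family_on_def S_def inner_add_right w)
  also have "\<dots> = (\<integral>\<^sup>+j. emeasure lborel (U \<inter> S j) \<partial>count_space UNIV)"
    by (simp only: tr)
  also have "\<dots> = emeasure lborel (\<Union>j. U \<inter> S j)"
    using U by (intro emeasure_UN_countable[symmetric]) (auto simp: disjoint_family_on_def S_def)
  also have "(\<Union>j. U \<inter> S j) = U"
    by (auto simp: S_def)
  finally show ?thesis .
qed

text \<open>Shears preserve Lebesgue measure.  The following half of this fact suffices below; it is obtained from
  the rounded shears as \<open>m\<close> tends to infinity, because a point whose images under infinitely many rounded
  shears lie in the closed set \<open>U\<close> is mapped into \<open>U\<close> by the shear itself.\<close>

lemma emeasure_shear_ge:
  fixes n w :: "'a::euclidean_space"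
  assumes U: "compact U" and w: "n \<bullet> w = 0"
  shows "emeasure lborel U \<le> emeasure lborel ((\<lambda>x. x + (n \<bullet> x) *\<^sub>R w) -` U)"
proof -
  define s where "s = (\<lambda>j x. x + (of_int \<lfloor>real (Suc j) * (n \<bullet> x)\<rfloor> / real (Suc j)) *\<^sub>R w)"
  define B where "B = (\<lambda>m. \<Union>j\<in>{m..}. s j -` U)"
  have Ub: "U \<in> sets borel" using U by (auto intro: borel_compact)
  have sU: "s j -` U \<in> sets lborel" for j
  proof -
    have "s j \<in> borel_measurable borel" unfolding s_def by measurable
    from measurable_sets[OF this Ub] show ?thesis by simp
  qed
  have lim: "(\<lambda>j. s j x) \<longlonglongrightarrow> x + (n \<bullet> x) *\<^sub>R w" for x
  proof -
    have "(\<lambda>j. of_int \<lfloor>real (Suc j) * (n \<bullet> x)\<rfloor> / real (Suc j)) \<longlonglongrightarrow> n \<bullet> x"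
    proof (rule tendsto_sandwich)
      show "\<forall>\<^sub>F j in sequentially. (n \<bullet> x) - 1 / real (Suc j) \<le> of_int \<lfloor>real (Suc j) * (n \<bullet> x)\<rfloor> / real (Suc j)"
      proof (intro always_eventually allI)
        fix j
        have "real (Suc j) * (n \<bullet> x) - 1 \<le> of_int \<lfloor>real (Suc j) * (n \<bullet> x)\<rfloor>" by linarith
        then have "(real (Suc j) * (n \<bullet> x) - 1) / real (Suc j) \<le> of_int \<lfloor>real (Suc j) * (n \<bullet> x)\<rfloor> / real (Suc j)"
          by (rule divide_right_mono) simp
        then show "(n \<bullet> x) - 1 / real (Suc j) \<le> of_int \<lfloor>real (Suc j) * (n \<bullet> x)\<rfloor> / real (Suc j)"
          by (simp add: diff_divide_distrib)
      qed
      show "\<forall>\<^sub>F j in sequentially. of_int \<lfloor>real (Suc j) * (n \<bullet> x)\<rfloor> / real (Suc j) \<le> n \<bullet> x"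
      proof (intro always_eventually allI)
        fix j
        have "of_int \<lfloor>real (Suc j) * (n \<bullet> x)\<rfloor> / real (Suc j) \<le> real (Suc j) * (n \<bullet> x) / real (Suc j)"
          by (rule divide_right_mono) auto
        then show "of_int \<lfloor>real (Suc j) * (n \<bullet> x)\<rfloor> / real (Suc j) \<le> n \<bullet> x" by simp
      qed
      show "(\<lambda>j. (n \<bullet> x) - 1 / real (Suc j)) \<longlonglongrightarrow> n \<bullet> x"
        using tendsto_diff[OF tendsto_const[of "n \<bullet> x"] LIMSEQ_inverse_real_of_nat]
        by (simp add: inverse_eq_divide)
    qed auto
    then show ?thesis unfolding s_def by (intro tendsto_intros)
  qed
  obtain R where R: "\<And>x. x \<in> U \<Longrightarrow> norm x \<le> R"
    using compact_imp_bounded[OF U] bounded_iff by blast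
  obtain R' where R': "\<And>x j. s j x \<in> U \<Longrightarrow> norm x \<le> R'"
  proof
    fix x j assume x: "s j x \<in> U"
    define t where "t = of_int \<lfloor>real (Suc j) * (n \<bullet> x)\<rfloor> / real (Suc j)"
    have sx: "s j x = x + t *\<^sub>R w" by (simp add: s_def t_def)
    have "n \<bullet> s j x = n \<bullet> x" by (simp add: sx inner_add_right w)
    then have nx: "\<bar>n \<bullet> x\<bar> \<le> norm n * R"
      using Cauchy_Schwarz_ineq2[of n "s j x"] R[OF x] by (smt (verit) mult_left_mono norm_ge_zero)
    have "\<bar>of_int \<lfloor>real (Suc j) * (n \<bullet> x)\<rfloor>\<bar> \<le> \<bar>real (Suc j) * (n \<bullet> x)\<bar> + 1" by linarith
    then have "\<bar>t\<bar> \<le> (\<bar>real (Suc j) * (n \<bullet> x)\<bar> + 1) / real (Suc j)"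
      unfolding t_def abs_divide by (simp add: divide_right_mono)
    also have "\<dots> = \<bar>n \<bullet> x\<bar> + 1 / real (Suc j)"
      by (simp add: add_divide_distrib abs_mult)
    also have "\<dots> \<le> norm n * R + 1"
      using nx by (intro add_mono) auto
    finally have t: "\<bar>t\<bar> \<le> norm n * R + 1" .
    have "norm x \<le> norm (s j x) + norm (t *\<^sub>R w)"
      unfolding sx by (metis add_diff_cancel_right' norm_triangle_ineq4)
    also have "\<dots> \<le> R + (norm n * R + 1) * norm w"
      using R[OF x] t by (auto intro!: add_mono mult_right_mono)
    finally show "norm x \<le> R + (norm n * R + 1) * norm w" .
  qed
  have Bs: "B m \<in> sets lborel" for m unfolding B_def using sU by auto
  have "emeasure lborel U \<le> (INF m. emeasure lborel (B m))"
  proof (rule INF_greatest)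
    fix m
    have "emeasure lborel U = emeasure lborel (s m -` U)"
      unfolding s_def using emeasure_shear_step[OF Ub w, of "real (Suc m)"] by simp
    also have "\<dots> \<le> emeasure lborel (B m)"
      by (intro emeasure_mono Bs) (auto simp: B_def)
    finally show "emeasure lborel U \<le> emeasure lborel (B m)" .
  qed
  also have "\<dots> = emeasure lborel (\<Inter>m. B m)"
  proof (rule INF_emeasure_decseq)
    show "range B \<subseteq> sets lborel" using Bs by auto
    show "decseq B" unfolding decseq_def B_def by (intro allI impI UN_mono) auto
    fix m
    have "emeasure lborel (B m) \<le> emeasure lborel (cball 0 R' :: 'a set)"
      by (intro emeasure_mono) (auto simp: B_def dest: R')
    then show "emeasure lborel (B m) \<noteq> \<infinity>"
      using emeasure_lborel_cball_finite[of "0::'a" R'] by (auto simp: top_unique)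
  qed
  also have "\<dots> \<le> emeasure lborel ((\<lambda>x. x + (n \<bullet> x) *\<^sub>R w) -` U)"
  proof (rule emeasure_mono)
    show "(\<Inter>m. B m) \<subseteq> (\<lambda>x. x + (n \<bullet> x) *\<^sub>R w) -` U"
    proof
      fix x assume "x \<in> (\<Inter>m. B m)"
      then have "\<exists>\<^sub>F j in sequentially. s j x \<in> U"
        by (auto simp: B_def frequently_sequentially)
      moreover have "\<forall>\<^sub>F j in sequentially. s j x \<in> - U" if "x + (n \<bullet> x) *\<^sub>R w \<notin> U"
        using topological_tendstoD[OF lim[of x], of "- U"] compact_imp_closed[OF U] that
        by (auto simp: open_Compl)
      ultimately show "x \<in> (\<lambda>x. x + (n \<bullet> x) *\<^sub>R w) -` U"
        unfolding frequently_def by fastforce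
    qed
    have "(\<lambda>x. x + (n \<bullet> x) *\<^sub>R w) \<in> borel_measurable borel" by measurable
    from measurable_sets[OF this Ub] show "(\<lambda>x. x + (n \<bullet> x) *\<^sub>R w) -` U \<in> sets lborel" by simp
  qed
  finally show ?thesis .
qed

text \<open>The prism over \<open>f\<close> with generators in direction \<open>n\<close> and parameters in \<open>S\<close>.\<close>

definition slab :: "'a::euclidean_space set \<Rightarrow> 'a \<Rightarrow> real set \<Rightarrow> 'a set" where
  "slab f n S = {y + u *\<^sub>R n | y u. y \<in> f \<and> u \<in> S}"

text \<open>For a flat set \<open>f\<close> with unit normal \<open>n\<close> this is its \<open>(d-1)\<close>-dimensional measure, see
  \<open>emeasure_hyperplane_measure\<close>.\<close>

abbreviation area :: "'a::euclidean_space set \<Rightarrow> 'a \<Rightarrow> real" where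
  "area f n \<equiv> measure lborel (slab f n {0..1})"

lemma slab_mono: "S \<subseteq> S' \<Longrightarrow> slab f n S \<subseteq> slab f n S'"
  by (auto simp: slab_def)

lemma slab_alt:
  fixes n :: "'a::euclidean_space"
  assumes "norm n = 1" "f \<subseteq> {x. n \<bullet> x = b}"
  shows "slab f n S = {x. n \<bullet> x - b \<in> S \<and> x - (n \<bullet> x - b) *\<^sub>R n \<in> f}"
proof -
  have nn: "n \<bullet> n = 1" using assms(1) by (simp add: dot_square_norm)
  show ?thesis
  proof (intro set_eqI iffI)
    fix x assume "x \<in> slab f n S"
    then obtain y u where x: "x = y + u *\<^sub>R n" "y \<in> f" "u \<in> S" by (auto simp: slab_def)
    have "n \<bullet> x - b = u" using x assms(2) nn by (auto simp: inner_add_right)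
    then show "x \<in> {x. n \<bullet> x - b \<in> S \<and> x - (n \<bullet> x - b) *\<^sub>R n \<in> f}" using x by auto
  next
    fix x assume "x \<in> {x. n \<bullet> x - b \<in> S \<and> x - (n \<bullet> x - b) *\<^sub>R n \<in> f}"
    then show "x \<in> slab f n S"
      unfolding slab_def by (auto intro!: exI[of _ "x - (n \<bullet> x - b) *\<^sub>R n"] exI[of _ "n \<bullet> x - b"])
  qed
qed

lemma slab_measurable:
  fixes n :: "'a::euclidean_space"
  assumes "norm n = 1" "f \<subseteq> {x. n \<bullet> x = b}" and f: "f \<in> sets borel" and S: "S \<in> sets borel"
  shows "slab f n S \<in> sets borel"
proof -
  have "(\<lambda>x. n \<bullet> x - b) -` S \<inter> space borel \<in> sets borel"
    by (rule measurable_sets[OF _ S]) measurable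
  moreover have "(\<lambda>x. x - (n \<bullet> x - b) *\<^sub>R n) -` f \<inter> space borel \<in> sets borel"
    by (rule measurable_sets[OF _ f]) measurable
  ultimately have "((\<lambda>x. n \<bullet> x - b) -` S) \<inter> ((\<lambda>x. x - (n \<bullet> x - b) *\<^sub>R n) -` f) \<in> sets borel"
    by auto
  then show ?thesis
    unfolding slab_alt[OF assms(1,2)] by (simp add: vimage_def Collect_conj_eq)
qed

lemma slab_bounded:
  assumes "bounded f" "bounded S"
  shows "bounded (slab f n S)"
proof -
  obtain R where R: "\<And>y. y \<in> f \<Longrightarrow> norm y \<le> R" using assms(1) bounded_iff by blast
  obtain r where r: "\<And>u. u \<in> S \<Longrightarrow> \<bar>u\<bar> \<le> r" using assms(2) bounded_real by metis
  show ?thesis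
  proof (rule boundedI)
    fix x assume "x \<in> slab f n S"
    then obtain y u where x: "x = y + u *\<^sub>R n" "y \<in> f" "u \<in> S" by (auto simp: slab_def)
    have "norm x \<le> norm y + \<bar>u\<bar> * norm n" unfolding x(1) by (metis norm_scaleR norm_triangle_ineq)
    also have "\<dots> \<le> R + r * norm n" using R[OF x(2)] r[OF x(3)] by (intro add_mono mult_right_mono) auto
    finally show "norm x \<le> R + r * norm n" .
  qed
qed

lemma slab_fmeasurable:
  fixes n :: "'a::euclidean_space"
  assumes "norm n = 1" "f \<subseteq> {x. n \<bullet> x = b}" "f \<in> sets borel" "S \<in> sets borel" "bounded f" "bounded S"
  shows "slab f n S \<in> fmeasurable lborel"
  using slab_measurable[OF assms(1-4)] emeasure_bounded_finite[OF slab_bounded[OF assms(5,6)]]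
  by (intro fmeasurableI) auto

lemma measure_lborel_translation:
  fixes c :: "'a::euclidean_space"
  assumes "A \<in> sets borel"
  shows "measure lborel ((+) c ` A) = measure lborel A"
proof -
  have "(+) (-c) -` A = (+) c ` A"
    by (force simp: image_iff)
  moreover have "measure (distr lborel borel ((+) (-c))) A = measure lborel ((+) (-c) -` A)"
    using assms by (subst measure_distr) auto
  ultimately show ?thesis by (simp add: lborel_distr_plus)
qed

lemma slab_translation:
  "slab f n ((+) s ` S) = (+) (s *\<^sub>R n) ` slab f n S"
proof -
  have eq: "y + (s + u) *\<^sub>R n = s *\<^sub>R n + (y + u *\<^sub>R n)" for y u by (simp add: scaleR_add_left)
  show ?thesis
  proof (intro set_eqI iffI)
    fix x assume "x \<in> slab f n ((+) s ` S)"
    then obtain y u where "x = y + (s + u) *\<^sub>R n" "y \<in> f" "u \<in> S" by (auto simp: slab_def)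
    then show "x \<in> (+) (s *\<^sub>R n) ` slab f n S" unfolding eq slab_def by blast
  next
    fix x assume "x \<in> (+) (s *\<^sub>R n) ` slab f n S"
    then obtain y u where "x = s *\<^sub>R n + (y + u *\<^sub>R n)" "y \<in> f" "u \<in> S" by (auto simp: slab_def)
    then show "x \<in> slab f n ((+) s ` S)" unfolding eq[symmetric] slab_def by blast
  qed
qed

text \<open>The volume of a prism is proportional to its height.  The inequality with a lost factor 2 is enough
  and follows from the additivity of the volume by counting translates.\<close>

lemma measure_slab_ge:
  fixes n :: "'a::euclidean_space"
  assumes n: "norm n = 1" "f \<subseteq> {x. n \<bullet> x = b}" and f: "compact f" and h: "h > 0"
  shows "h / 2 * area f n \<le> measure lborel (slab f n {0..h})"
proof -
  note fb = borel_compact[OF f] compact_imp_bounded[OF f]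
  define V where "V = (\<lambda>t. measure lborel (slab f n {0..<t}))"
  have fm: "slab f n {s..<t} \<in> fmeasurable lborel" "slab f n {s..t} \<in> fmeasurable lborel" for s t
    using slab_fmeasurable[OF n fb(1) _ fb(2)] by auto
  have tr: "measure lborel (slab f n {s..<s + t}) = V t" for s t
  proof -
    have "{s..<s + t} = (+) s ` {0..<t}" by (simp add: add.commute)
    then show ?thesis
      unfolding V_def using measure_lborel_translation[of "slab f n {0..<t}" "s *\<^sub>R n"] fm(1)[of 0 t]
      by (simp only: slab_translation) (auto simp: fmeasurable_def)
  qed
  have add: "V (s + t) = V s + V t" if "s \<ge> 0" "t \<ge> 0" for s t
  proof -
    have "slab f n {0..<s + t} = slab f n {0..<s} \<union> slab f n {s..<s + t}"
      using that unfolding slab_alt[OF n] by auto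
    moreover have "slab f n {0..<s} \<inter> slab f n {s..<s + t} = {}"
      unfolding slab_alt[OF n] by auto
    ultimately have "V (s + t) = V s + measure lborel (slab f n {s..<s + t})"
      unfolding V_def using measure_Un2[OF fm(1)[of 0 s] fm(1)[of s "s+t"]]
      by (simp add: Diff_triv Int_commute)
    then show ?thesis by (simp only: tr)
  qed
  have V0: "V t \<ge> 0" for t by (simp add: V_def)
  have mono: "V s \<le> V t" if "s \<le> t" for s t
    unfolding V_def using that fm by (intro measure_mono_fmeasurable slab_mono) (auto simp: fmeasurable_def)
  have mult: "V (real m * t) = real m * V t" if "t \<ge> 0" for m t
  proof (induction m)
    case 0
    have "slab f n {} = {}" by (simp add: slab_def)
    then show ?case by (simp add: V_def)
  next
    case (Suc m)
    have "V (real (Suc m) * t) = V (real m * t + t)" by (simp add: algebra_simps)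
    with Suc show ?case using add[of "real m * t" t] that by (simp add: algebra_simps)
  qed
  obtain M :: nat where M: "real M \<ge> h" "M \<ge> 1"
    by (metis (mono_tags) real_arch_simple One_nat_def Suc_leI h le0 less_le_trans not_less of_nat_0 of_nat_0_less_iff)
  define m where "m = nat \<lceil>real M / h\<rceil>"
  have m1: "real m \<ge> real M / h" unfolding m_def by linarith
  have "real m \<le> real M / h + 1"
    unfolding m_def using h M by (smt (verit) of_nat_ceiling of_nat_nat ceiling_correct divide_nonneg_pos of_nat_0_le_iff zero_le_ceiling of_nat_less_0_iff)
  also have "\<dots> \<le> 2 * real M / h" using M h by (simp add: field_simps)
  finally have m2: "real m \<le> 2 * real M / h" .
  have "real M * V 1 = V (real M)" using mult[of 1 M] by simp
  also have "\<dots> \<le> V (real m * h)" using m1 h by (intro mono) (simp add: field_simps)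
  also have "\<dots> = real m * V h" using h by (intro mult) auto
  also have "\<dots> \<le> 2 * real M / h * V h" by (intro mult_right_mono m2 V0)
  finally have "h / 2 * V 1 \<le> V h" using M h by (simp add: field_simps)
  moreover have "area f n \<le> V 1"
  proof -
    have "slab f n {0..1} \<subseteq> slab f n {0..<1} \<union> {x. n \<bullet> x = b + 1}"
      unfolding slab_alt[OF n] by auto
    moreover have "{x. n \<bullet> x = b + 1} \<in> null_sets lborel"
    proof -
      have "negligible {x. n \<bullet> x = b + 1}" using n by (intro negligible_hyperplane) auto
      moreover have "closed {x. n \<bullet> x = b + 1}" by (rule closed_hyperplane)
      ultimately show ?thesis by (simp add: negligible_iff_null_sets null_sets_completion_iff borel_closed)
    qed
    ultimately show ?thesis unfolding V_def
      using fm(1)[of 0 1] fm(2)[of 0 1]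
      by (metis (no_types, lifting) measure_Un_null_set measure_mono_fmeasurable fmeasurableD fmeasurable.Un fmeasurableI_null_sets)
  qed
  moreover have "V h \<le> measure lborel (slab f n {0..h})"
    unfolding V_def using fm by (intro measure_mono_fmeasurable slab_mono) (auto simp: fmeasurable_def)
  ultimately show ?thesis using h by (smt (verit, best) mult_left_mono divide_nonneg_nonneg)
qed

text \<open>By shear monotonicity the same holds for prisms with oblique generators.\<close>

lemma measure_oblique_prism_ge:
  fixes n w :: "'a::euclidean_space"
  assumes n: "norm n = 1" "f \<subseteq> {x. n \<bullet> x = b}" and f: "compact f" and h: "n \<bullet> w \<noteq> 0"
  shows "\<bar>n \<bullet> w\<bar> / 2 * area f n
      \<le> measure lborel {y + u *\<^sub>R w | y u. y \<in> f \<and> u \<in> {0..1}}"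
proof -
  define h where "h = n \<bullet> w"
  define w' where "w' = w - h *\<^sub>R n"
  have h0: "h \<noteq> 0" using assms by (simp add: h_def)
  have nn: "n \<bullet> n = 1" using n(1) by (simp add: dot_square_norm)
  have nw: "n \<bullet> w' = 0" by (simp add: w'_def inner_diff_right nn h_def)
  define P where "P = {y + u *\<^sub>R (h *\<^sub>R n) | y u. y \<in> f \<and> u \<in> {0..1::real}}"
  define Q where "Q = {y + u *\<^sub>R w | y u. y \<in> f \<and> u \<in> {0..1::real}}"
  define P' where "P' = (+) (- (b / h) *\<^sub>R w') ` P"
  have cP: "compact {y + u *\<^sub>R z | y u. y \<in> f \<and> u \<in> {0..1::real}}" for z
  proof -
    have "{y + u *\<^sub>R z | y u. y \<in> f \<and> u \<in> {0..1::real}} = (\<lambda>p. fst p + snd p *\<^sub>R z) ` (f \<times> {0..1})"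
      by force
    also have "compact \<dots>"
      using f by (intro compact_continuous_image compact_Times continuous_intros) auto
    finally show ?thesis .
  qed
  have cP': "compact P'" unfolding P'_def P_def by (rule compact_translation[OF cP])
  have "(\<lambda>x. x + (n \<bullet> x) *\<^sub>R (- (1 / h) *\<^sub>R w')) -` P' = Q"
  proof (intro set_eqI iffI)
    fix x assume "x \<in> Q"
    then obtain y u where x: "x = y + u *\<^sub>R w" "y \<in> f" "u \<in> {0..1}" by (auto simp: Q_def)
    have nx: "n \<bullet> x = b + u * h" using x n(2) by (auto simp: inner_add_right h_def)
    have "x + (n \<bullet> x) *\<^sub>R (- (1 / h) *\<^sub>R w') = - (b / h) *\<^sub>R w' + (y + u *\<^sub>R (h *\<^sub>R n))"
      unfolding nx using h0 by (simp add: x(1) w'_def algebra_simps add_divide_distrib)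
    then show "x \<in> (\<lambda>x. x + (n \<bullet> x) *\<^sub>R (- (1 / h) *\<^sub>R w')) -` P'"
      using x(2,3) by (auto simp: P'_def P_def)
  next
    fix x assume "x \<in> (\<lambda>x. x + (n \<bullet> x) *\<^sub>R (- (1 / h) *\<^sub>R w')) -` P'"
    then obtain y u where x: "x + (n \<bullet> x) *\<^sub>R (- (1 / h) *\<^sub>R w') = - (b / h) *\<^sub>R w' + (y + u *\<^sub>R (h *\<^sub>R n))"
       "y \<in> f" "u \<in> {0..1}" by (auto simp: P'_def P_def)
    have "n \<bullet> (x + (n \<bullet> x) *\<^sub>R (- (1 / h) *\<^sub>R w')) = n \<bullet> (- (b / h) *\<^sub>R w' + (y + u *\<^sub>R (h *\<^sub>R n)))"
      using x by simp
    then have nx: "n \<bullet> x = b + u * h"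
      using x(2) n(2) by (auto simp: inner_add_right inner_diff_right nw nn)
    have "x = - (b / h) *\<^sub>R w' + (y + u *\<^sub>R (h *\<^sub>R n)) - (n \<bullet> x) *\<^sub>R (- (1 / h) *\<^sub>R w')"
      using x(1) by (simp add: algebra_simps)
    then have "x = - (b / h) *\<^sub>R w' + (y + u *\<^sub>R (h *\<^sub>R n)) - (b + u * h) *\<^sub>R (- (1 / h) *\<^sub>R w')"
      using nx by metis
    also have "\<dots> = y + u *\<^sub>R w"
      using h0 by (simp add: w'_def algebra_simps add_divide_distrib)
    finally show "x \<in> Q" using x(2,3) by (auto simp: Q_def)
  qed
  then have "emeasure lborel P' \<le> emeasure lborel Q"
    using emeasure_shear_ge[OF cP', of n "- (1 / h) *\<^sub>R w'"] nw by simp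
  moreover have "emeasure lborel Q < \<infinity>" unfolding Q_def
    by (intro emeasure_bounded_finite compact_imp_bounded cP)
  ultimately have "measure lborel P' \<le> measure lborel Q"
    unfolding measure_def by (intro enn2real_mono) auto
  moreover have "measure lborel P' = measure lborel P"
    unfolding P'_def by (rule measure_lborel_translation) (unfold P_def, rule borel_compact[OF cP])
  moreover have "measure lborel P = measure lborel (slab f n {0..\<bar>h\<bar>})"
  proof (cases "h > 0")
    case True
    have "P = slab f n {0..\<bar>h\<bar>}"
    proof (intro set_eqI iffI)
      fix x assume "x \<in> P"
      then obtain y u where "x = y + (u * h) *\<^sub>R n" "y \<in> f" "u \<in> {0..1}" by (auto simp: P_def)
      moreover from this have "u * h \<in> {0..\<bar>h\<bar>}" using True by (auto intro: mult_left_le_one_le)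
      ultimately show "x \<in> slab f n {0..\<bar>h\<bar>}" unfolding slab_def by blast
    next
      fix x assume "x \<in> slab f n {0..\<bar>h\<bar>}"
      then obtain y u where "x = y + u *\<^sub>R n" "y \<in> f" "u \<in> {0..\<bar>h\<bar>}" by (auto simp: slab_def)
      then show "x \<in> P" using True unfolding P_def
        by (auto intro!: exI[of _ y] exI[of _ "u / h"])
    qed
    then show ?thesis by simp
  next
    case False
    then have hn: "h < 0" using h0 by simp
    have "P = (+) (h *\<^sub>R n) ` slab f n {0..\<bar>h\<bar>}"
    proof (intro set_eqI iffI)
      fix x assume "x \<in> P"
      then obtain y u where x: "x = y + u *\<^sub>R (h *\<^sub>R n)" "y \<in> f" "u \<in> {0..1}" by (auto simp: P_def)
      then have "x = h *\<^sub>R n + (y + ((1 - u) * \<bar>h\<bar>) *\<^sub>R n)" using hn by (simp add: algebra_simps)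
      moreover have "(1 - u) * \<bar>h\<bar> \<in> {0..\<bar>h\<bar>}" using x(3) by (auto intro: mult_left_le_one_le)
      ultimately show "x \<in> (+) (h *\<^sub>R n) ` slab f n {0..\<bar>h\<bar>}" using x(2) unfolding slab_def by blast
    next
      fix x assume "x \<in> (+) (h *\<^sub>R n) ` slab f n {0..\<bar>h\<bar>}"
      then obtain y u where x: "x = h *\<^sub>R n + (y + u *\<^sub>R n)" "y \<in> f" "u \<in> {0..\<bar>h\<bar>}" by (auto simp: slab_def)
      have "x = y + (1 + u / h) *\<^sub>R (h *\<^sub>R n)" using h0 x(1) by (simp add: algebra_simps)
      moreover have "1 + u / h \<in> {0..1}" using x(3) hn by (auto simp: field_simps)
      ultimately show "x \<in> P" using x(2) unfolding P_def by blast
    qed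
    then show ?thesis
      using measure_lborel_translation[of "slab f n {0..\<bar>h\<bar>}" "h *\<^sub>R n"]
        slab_measurable[OF n borel_compact[OF f], of "{0..\<bar>h\<bar>}"] by simp
  qed
  moreover have "\<bar>h\<bar> / 2 * area f n \<le> measure lborel (slab f n {0..\<bar>h\<bar>})"
    using h0 by (intro measure_slab_ge[OF n f]) auto
  ultimately show ?thesis unfolding Q_def h_def by simp
qed

lemma emeasure_hyperplane_measure:
  fixes n :: "'a::euclidean_space"
  assumes n: "norm n = 1" "f \<subseteq> {x. n \<bullet> x = n \<bullet> a}" and f: "f \<in> sets borel"
  shows "emeasure (hyperplane_measure a n) f = emeasure lborel (slab f n {0..1})"
proof -
  let ?S = "{x. 0 \<le> n \<bullet> (x - a) \<and> n \<bullet> (x - a) \<le> 1}"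
  let ?p = "\<lambda>x. x - (n \<bullet> (x - a)) *\<^sub>R n"
  have S: "?S \<in> sets borel" by measurable
  have "?p \<in> borel_measurable borel" by measurable
  then have p: "?p \<in> measurable (restrict_space lborel ?S) borel"
    by (intro measurable_restrict_space1) simp
  have "emeasure (hyperplane_measure a n) f
     = emeasure (restrict_space lborel ?S) (?p -` f \<inter> space (restrict_space lborel ?S))"
    unfolding hyperplane_measure_def by (rule emeasure_distr[OF p f])
  also have "\<dots> = emeasure lborel (?p -` f \<inter> ?S)"
    using S by (subst emeasure_restrict_space) (auto simp: space_restrict_space)
  also have "?p -` f \<inter> ?S = slab f n {0..1}"
    unfolding slab_alt[OF n] by (auto simp: inner_diff_right)
  finally show ?thesis .
qed

section \<open>Polynomial extrapolation and a trace inequality on cones\<close>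

text \<open>The values of a polynomial of degree at most \<open>k\<close> at \<open>k + 1\<close> nodes bound it on an interval, uniformly in
  the polynomial.  The induction step divides by the linear factor of one node.\<close>

lemma poly_extrapolation:
  fixes T :: "real set"
  assumes "finite T" "card T = Suc k" "T \<subseteq> {0..2}"
  shows "\<exists>M\<ge>0. \<forall>p r. degree p \<le> k \<longrightarrow> r \<in> {0..2} \<longrightarrow> \<bar>poly p r\<bar> \<le> M * (\<Sum>t\<in>T. \<bar>poly p t\<bar>)"
  using assms
proof (induction k arbitrary: T)
  case 0
  then obtain t where T: "T = {t}" by (auto simp: card_1_singleton_iff)
  show ?case
  proof (intro exI[of _ 1] conjI allI impI)
    fix p :: "real poly" and r assume "degree p \<le> 0"
    then obtain c where "p = [:c:]" by (metis degree_eq_zeroE le_zero_eq)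
    then show "\<bar>poly p r\<bar> \<le> 1 * (\<Sum>t\<in>T. \<bar>poly p t\<bar>)" by (simp add: T)
  qed simp
next
  case (Suc k)
  then obtain t0 where t0: "t0 \<in> T" by fastforce
  define T' where "T' = T - {t0}"
  have T': "finite T'" "card T' = Suc k" "T' \<subseteq> {0..2}" using Suc.prems t0 by (auto simp: T'_def)
  from Suc.IH[OF this] obtain M where M: "M \<ge> 0"
    "\<And>p r. degree p \<le> k \<Longrightarrow> r \<in> {0..2} \<Longrightarrow> \<bar>poly p r\<bar> \<le> M * (\<Sum>t\<in>T'. \<bar>poly p t\<bar>)" by blast
  define D where "D = (\<Sum>t\<in>T'. inverse \<bar>t - t0\<bar>)"
  have D0: "D \<ge> 0" unfolding D_def by (intro sum_nonneg) auto
  have D: "inverse \<bar>t - t0\<bar> \<le> D" if "t \<in> T'" for t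
    unfolding D_def using that T'(1) by (intro member_le_sum) auto
  define M' where "M' = 2 * M * (D * (2 + real k)) + 1"
  show ?case
  proof (intro exI[of _ M'] conjI allI impI)
    show "M' \<ge> 0" using M(1) D0 by (simp add: M'_def)
    fix p :: "real poly" and r :: real assume p: "degree p \<le> Suc k" and r: "r \<in> {0..2}"
    define q where "q = synthetic_div p t0"
    define s where "s = (\<Sum>t\<in>T. \<bar>poly p t\<bar>)"
    have dq: "degree q \<le> k" using p by (simp add: q_def degree_synthetic_div)
    have pq: "poly p x = (x - t0) * poly q x + poly p t0" for x
      using arg_cong[OF synthetic_div_correct'[of t0 p], of "\<lambda>p. poly p x"]
      by (simp add: q_def algebra_simps)
    have s: "s = \<bar>poly p t0\<bar> + (\<Sum>t\<in>T'. \<bar>poly p t\<bar>)"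
      unfolding s_def T'_def using Suc.prems(1) t0 by (simp add: sum.remove)
    have s': "(\<Sum>t\<in>T'. \<bar>poly p t\<bar>) \<ge> 0" by (intro sum_nonneg) auto
    have "\<bar>poly q t\<bar> \<le> D * (\<bar>poly p t\<bar> + \<bar>poly p t0\<bar>)" if t: "t \<in> T'" for t
    proof -
      have "t \<noteq> t0" using t by (auto simp: T'_def)
      then have "\<bar>poly q t\<bar> = inverse \<bar>t - t0\<bar> * \<bar>poly p t - poly p t0\<bar>"
        using pq[of t] by (simp add: abs_mult)
      also have "\<dots> \<le> D * (\<bar>poly p t\<bar> + \<bar>poly p t0\<bar>)"
        using D[OF t] D0 by (intro mult_mono) auto
      finally show ?thesis .
    qed
    then have "(\<Sum>t\<in>T'. \<bar>poly q t\<bar>) \<le> (\<Sum>t\<in>T'. D * (\<bar>poly p t\<bar> + \<bar>poly p t0\<bar>))" by (rule sum_mono)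
    also have "\<dots> = D * ((\<Sum>t\<in>T'. \<bar>poly p t\<bar>) + real (Suc k) * \<bar>poly p t0\<bar>)"
      by (simp add: sum_distrib_left[symmetric] sum.distrib T'(2))
    also have "\<dots> \<le> D * (s + real (Suc k) * s)"
      using s s' D0 by (intro mult_left_mono add_mono) auto
    finally have Q: "(\<Sum>t\<in>T'. \<bar>poly q t\<bar>) \<le> D * (2 + real k) * s" by (simp add: algebra_simps)
    have t0r: "\<bar>r - t0\<bar> \<le> 2" using r t0 Suc.prems(3) by fastforce
    have "\<bar>poly p r\<bar> \<le> \<bar>r - t0\<bar> * \<bar>poly q r\<bar> + \<bar>poly p t0\<bar>"
      using pq[of r] by (metis abs_mult abs_triangle_ineq)
    also have "\<dots> \<le> 2 * (M * (D * (2 + real k) * s)) + s"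
    proof (rule add_mono)
      have "\<bar>poly q r\<bar> \<le> M * (D * (2 + real k) * s)"
        using M(2)[OF dq r] mult_left_mono[OF Q M(1)] by linarith
      then show "\<bar>r - t0\<bar> * \<bar>poly q r\<bar> \<le> 2 * (M * (D * (2 + real k) * s))"
        using t0r by (intro mult_mono) auto
      show "\<bar>poly p t0\<bar> \<le> s" using s s' by simp
    qed
    also have "\<dots> = M' * s" by (simp add: M'_def algebra_simps)
    finally show "\<bar>poly p r\<bar> \<le> M' * (\<Sum>t\<in>T. \<bar>poly p t\<bar>)" by (simp add: s_def)
  qed
qed

text \<open>Functions that restrict to polynomials of degree at most \<open>k\<close> on every line.\<close>

definition line_poly :: "nat \<Rightarrow> ('a::real_vector \<Rightarrow> real) \<Rightarrow> bool" where
  "line_poly k q \<longleftrightarrow> (\<forall>x v. \<exists>p. degree p \<le> k \<and> (\<forall>t. poly p t = q (x + t *\<^sub>R v)))"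

lemma line_poly_sum:
  assumes "finite I" "\<And>i. i \<in> I \<Longrightarrow> line_poly k (q i)"
  shows "line_poly k (\<lambda>x. \<Sum>i\<in>I. c i * q i x)"
  unfolding line_poly_def
proof (intro allI)
  fix x v
  have "\<forall>i\<in>I. \<exists>p. degree p \<le> k \<and> (\<forall>t. poly p t = q i (x + t *\<^sub>R v))"
    using assms(2) by (auto simp: line_poly_def)
  then obtain p where p: "\<And>i. i \<in> I \<Longrightarrow> degree (p i) \<le> k"
     "\<And>i t. i \<in> I \<Longrightarrow> poly (p i) t = q i (x + t *\<^sub>R v)" by metis
  show "\<exists>p. degree p \<le> k \<and> (\<forall>t. poly p t = (\<Sum>i\<in>I. c i * q i (x + t *\<^sub>R v)))"
  proof (intro exI conjI allI)
    show "degree (\<Sum>i\<in>I. smult (c i) (p i)) \<le> k"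
      using assms(1) p(1) by (intro degree_sum_le) (auto intro: order_trans[OF degree_smult_le])
    show "poly (\<Sum>i\<in>I. smult (c i) (p i)) t = (\<Sum>i\<in>I. c i * q i (x + t *\<^sub>R v))" for t
      using p(2) by (simp add: poly_sum)
  qed
qed

lemma line_poly_polys:
  fixes q :: "'a::euclidean_space \<Rightarrow> real"
  assumes "q \<in> polys k"
  shows "line_poly k q"
proof -
  obtain c where q: "q = (\<lambda>x. \<Sum>m\<in>{m \<in> Basis \<rightarrow>\<^sub>E {..k}. sum m Basis \<le> k}. c m * (\<Prod>b\<in>Basis. (x \<bullet> b) ^ m b))"
    using assms by (auto simp: polys_def)
  have "line_poly k (\<lambda>x. \<Prod>b\<in>Basis. (x \<bullet> b) ^ m b)" if m: "sum m Basis \<le> k" for m :: "'a \<Rightarrow> nat"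
    unfolding line_poly_def
  proof (intro allI exI conjI)
    fix x v :: 'a and t
    let ?p = "\<Prod>b\<in>Basis. [:x \<bullet> b, v \<bullet> b:] ^ m b"
    have "degree ?p \<le> sum (degree \<circ> (\<lambda>b. [:x \<bullet> b, v \<bullet> b:] ^ m b)) Basis"
      by (intro degree_prod_sum_le) auto
    also have "\<dots> \<le> sum m Basis"
      by (intro sum_mono) (auto intro!: order_trans[OF degree_power_le])
    finally show "degree ?p \<le> k" using m by simp
    show "poly ?p t = (\<Prod>b\<in>Basis. ((x + t *\<^sub>R v) \<bullet> b) ^ m b)"
      by (simp add: poly_prod inner_add_left)
  qed
  then show ?thesis
    unfolding q
    by (intro line_poly_sum) (auto intro: finite_subset[OF _ finite_PiE[of Basis "\<lambda>_. {..k}"]])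
qed

lemma nn_integral_affine:
  fixes g :: "'a::euclidean_space \<Rightarrow> ennreal"
  assumes "c > 0" "g \<in> borel_measurable borel"
  shows "(\<integral>\<^sup>+x. g (t + c *\<^sub>R x) \<partial>lborel) = ennreal (1 / c ^ DIM('a)) * (\<integral>\<^sup>+x. g x \<partial>lborel)"
proof -
  have m: "(\<lambda>x. t + c *\<^sub>R x) \<in> measurable lborel borel" by measurable
  have "(\<integral>\<^sup>+x. g x \<partial>lborel) = (\<integral>\<^sup>+x. g x \<partial>density (distr lborel borel (\<lambda>x. t + c *\<^sub>R x)) (\<lambda>_. \<bar>c\<bar>^DIM('a)))"
    using lborel_affine[of c t] assms(1) by simp
  also have "\<dots> = ennreal (c ^ DIM('a)) * (\<integral>\<^sup>+x. g (t + c *\<^sub>R x) \<partial>lborel)"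
    using assms m by (simp add: nn_integral_density nn_integral_distr nn_integral_cmult)
  finally have "ennreal (1 / c ^ DIM('a)) * (\<integral>\<^sup>+x. g x \<partial>lborel)
     = (ennreal (1 / c ^ DIM('a)) * ennreal (c ^ DIM('a))) * (\<integral>\<^sup>+x. g (t + c *\<^sub>R x) \<partial>lborel)"
    by (simp add: mult.assoc)
  also have "ennreal (1 / c ^ DIM('a)) * ennreal (c ^ DIM('a)) = 1"
    using assms(1) by (simp add: ennreal_mult[symmetric])
  finally show ?thesis by simp
qed

lemma sum_squared_le_card: "(\<Sum>i\<in>I. f i :: real)\<^sup>2 \<le> real (card I) * (\<Sum>i\<in>I. (f i)\<^sup>2)"
  using Cauchy_Schwarz_ineq_sum[of "\<lambda>_. 1" f I] by simp

text \<open>\<open>C\<close> is an admissible constant in the trace inequality for functions of degree at most \<open>k\<close> along lines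
  that are constant on the base \<open>f\<close> of a cone with apex \<open>x0\<close>; the factor on the left is the height of the
  cone.  The type argument carries the dimension.\<close>

definition cone_trace_bound :: "'a::euclidean_space itself \<Rightarrow> nat \<Rightarrow> real \<Rightarrow> bool" where
  "cone_trace_bound _ k C \<longleftrightarrow> C \<ge> 0 \<and> (\<forall>(f::'a set) n b x0 q c.
     norm n = 1 \<longrightarrow> f \<subseteq> {x. n \<bullet> x = b} \<longrightarrow> compact f \<longrightarrow> convex f \<longrightarrow> f \<noteq> {} \<longrightarrow> n \<bullet> x0 \<noteq> b \<longrightarrow>
     line_poly k q \<longrightarrow> continuous_on UNIV q \<longrightarrow> (\<forall>x\<in>f. q x = c) \<longrightarrow>
     \<bar>n \<bullet> x0 - b\<bar> * (c\<^sup>2 * area f n)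
       \<le> C * (LINT x:convex hull (insert x0 f)|lborel. (q x)\<^sup>2))"

text \<open>A point \<open>x\<close> in the half of the cone next to the base has the form \<open>x0 + s (z - x0)\<close> with \<open>z\<close> in the base
  and \<open>1/2 \<le> s \<le> 1\<close>.  Extrapolation along the ray from the values at \<open>x0 + t (x - x0)\<close>, for finitely many
  fixed ratios \<open>0 < t \<le> 1\<close>, bounds the value at the base.  As the ratios do not depend on \<open>x\<close>, integrating
  over \<open>x\<close> only requires the scaling property of Lebesgue measure.  The domain of integration is an
  oblique prism contained in this half of the cone.\<close>

theorem face_cone_trace: "\<exists>C. cone_trace_bound TYPE('a::euclidean_space) k C"
proof -
  let ?d = "DIM('a)"
  \<comment> \<open>the ratios at which the polynomial is sampled\<close>
  define T where "T = (\<lambda>i. 1 / real (Suc i)) ` {..k}"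
  have inj: "inj_on (\<lambda>i. 1 / real (Suc i)) {..k}" by (auto simp: inj_on_def)
  have T: "finite T" "card T = Suc k" "T \<subseteq> {0..2}" "\<And>t. t \<in> T \<Longrightarrow> t > 0" "\<And>t. t \<in> T \<Longrightarrow> t \<le> 1"
    using inj by (auto simp: T_def card_image field_simps)
  obtain M where M: "M \<ge> 0"
    "\<And>p r. degree p \<le> k \<Longrightarrow> r \<in> {0..2} \<Longrightarrow> \<bar>poly p r\<bar> \<le> M * (\<Sum>t\<in>T. \<bar>poly p t\<bar>)"
    using poly_extrapolation[OF T(1-3)] by blast
  define K where "K = M\<^sup>2 * real (Suc k)"
  have K0: "K \<ge> 0" by (simp add: K_def)
  define L where "L = (\<Sum>t\<in>T. 1 / t ^ ?d)"
  have L0: "L \<ge> 0" unfolding L_def using T(4) by (intro sum_nonneg) (auto intro: less_imp_le)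
  show ?thesis
    unfolding cone_trace_bound_def
  proof (intro exI[of _ "2 * 2 ^ ?d * (K * L)"] conjI allI impI)
    show "0 \<le> 2 * 2 ^ ?d * (K * L)" using K0 L0 by simp
    fix f :: "'a set" and n b x0 q c
    assume n: "norm n = 1" "f \<subseteq> {x. n \<bullet> x = b}" and f: "compact f" "convex f" "f \<noteq> {}"
      and x0: "n \<bullet> x0 \<noteq> b" and q: "line_poly k q" and cq: "continuous_on UNIV q" and qc: "\<forall>x\<in>f. q x = c"
    obtain y0 where y0: "y0 \<in> f" using f by blast
    define w where "w = y0 - x0"
    have nw: "n \<bullet> w = b - n \<bullet> x0" using y0 n(2) by (auto simp: w_def inner_diff_right)
    \<comment> \<open>the image of \<open>Q\<close> under the homothety with centre \<open>x0\<close> and ratio \<open>1/2\<close> lies in the cone\<close>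
    define Q where "Q = {y + u *\<^sub>R w | y u. y \<in> f \<and> u \<in> {0..1::real}}"
    have cQ: "compact Q"
    proof -
      have "Q = (\<lambda>p. fst p + snd p *\<^sub>R w) ` (f \<times> {0..1})" unfolding Q_def by force
      also have "compact \<dots>"
        using f by (intro compact_continuous_image compact_Times continuous_intros) auto
      finally show ?thesis .
    qed
    have volQ: "\<bar>n \<bullet> w\<bar> / 2 * area f n \<le> measure lborel Q"
      unfolding Q_def by (rule measure_oblique_prism_ge[OF n f(1)]) (use nw x0 in simp)
    define H where "H = convex hull (insert x0 f)"
    have cH: "compact H" unfolding H_def using f by (intro compact_convex_hull) auto
    have Hin: "x0 + s *\<^sub>R (z - x0) \<in> H" if "z \<in> f" "0 \<le> s" "s \<le> 1" for z s
    proof -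
      have "x0 \<in> H" "z \<in> H" unfolding H_def using that by (auto intro: hull_inc)
      moreover have "convex H" by (simp add: H_def)
      ultimately have "(1 - s) *\<^sub>R x0 + s *\<^sub>R z \<in> H" using that by (auto simp: convex_alt)
      moreover have "(1 - s) *\<^sub>R x0 + s *\<^sub>R z = x0 + s *\<^sub>R (z - x0)" by (simp add: algebra_simps)
      ultimately show ?thesis by simp
    qed
    have key: "c\<^sup>2 \<le> K * (\<Sum>t\<in>T. (q (x0 + t *\<^sub>R (x - x0)))\<^sup>2) \<and> (\<forall>t\<in>T. x0 + t *\<^sub>R (x - x0) \<in> H)"
      if x: "- x0 + 2 *\<^sub>R x \<in> Q" for x
    proof -
      obtain y u where yu: "- x0 + 2 *\<^sub>R x = y + u *\<^sub>R w" "y \<in> f" "u \<in> {0..1}"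
        using x unfolding Q_def by auto
      define s where "s = (1 + u) / 2"
      define z where "z = (1 / (1 + u)) *\<^sub>R y + (u / (1 + u)) *\<^sub>R y0"
      have s: "1/2 \<le> s" "s \<le> 1" using yu(3) by (auto simp: s_def)
      have "1 / (1 + u) + u / (1 + u) = 1" using yu(3) by (simp add: add_divide_distrib[symmetric])
      then have z: "z \<in> f" unfolding z_def using yu(2,3) y0 f(2)
        by (intro convexD) auto
      have "(1 + u) *\<^sub>R z = y + u *\<^sub>R y0" using yu(3) by (simp add: z_def scaleR_add_right)
      moreover have "2 *\<^sub>R x = x0 + y + u *\<^sub>R (y0 - x0)"
        using yu(1) by (simp add: w_def algebra_simps)
      moreover have "2 *\<^sub>R (x0 + s *\<^sub>R (z - x0)) = 2 *\<^sub>R x0 + (2 * s) *\<^sub>R z - (2 * s) *\<^sub>R x0"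
        by (simp add: scaleR_add_right scaleR_diff_right)
      moreover have "2 * s = 1 + u" by (simp add: s_def)
      ultimately have "2 *\<^sub>R x = 2 *\<^sub>R (x0 + s *\<^sub>R (z - x0))"
        by (simp add: algebra_simps scaleR_2)
      then have xz: "x = x0 + s *\<^sub>R (z - x0)" by (metis scaleR_cancel_left zero_neq_numeral)
      obtain p where p: "degree p \<le> k" "\<And>t. poly p t = q (x0 + t *\<^sub>R (x - x0))"
        using q unfolding line_poly_def by metis
      have "poly p (1 / s) = q z" unfolding p(2) using s by (simp add: xz)
      then have "\<bar>c\<bar> \<le> M * (\<Sum>t\<in>T. \<bar>poly p t\<bar>)"
        using M(2)[OF p(1), of "1 / s"] z qc s by (simp add: field_simps)
      then have "c\<^sup>2 \<le> (M * (\<Sum>t\<in>T. \<bar>poly p t\<bar>))\<^sup>2" by (metis abs_ge_zero power2_abs power_mono)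
      also have "\<dots> \<le> M\<^sup>2 * (real (card T) * (\<Sum>t\<in>T. \<bar>poly p t\<bar>\<^sup>2))"
        unfolding power_mult_distrib by (intro mult_left_mono sum_squared_le_card) auto
      also have "\<dots> = K * (\<Sum>t\<in>T. (q (x0 + t *\<^sub>R (x - x0)))\<^sup>2)"
        by (simp add: K_def T(2) p(2))
      finally have 1: "c\<^sup>2 \<le> K * (\<Sum>t\<in>T. (q (x0 + t *\<^sub>R (x - x0)))\<^sup>2)" .
      have 2: "x0 + t *\<^sub>R (x - x0) \<in> H" if t: "t \<in> T" for t
      proof -
        have "x0 + t *\<^sub>R (x - x0) = x0 + (t * s) *\<^sub>R (z - x0)" by (simp add: xz)
        moreover have "t * s \<le> 1" using T(4,5)[OF t] s by (simp add: mult_le_one)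
        ultimately show ?thesis using Hin[OF z, of "t * s"] T(4)[OF t] s by simp
      qed
      show ?thesis using 1 2 by blast
    qed
    have mq: "q \<in> borel_measurable borel" using cq by (rule borel_measurable_continuous_onI)
    have mQ: "Q \<in> sets borel" and mH: "H \<in> sets borel" using cQ cH by (auto intro: borel_compact)
    define g where "g = (\<lambda>x. ennreal (indicator H x * (q x)\<^sup>2))"
    have mg: "g \<in> borel_measurable borel" unfolding g_def using mq mH by measurable
    define I where "I = (LINT x:H|lborel. (q x)\<^sup>2)"
    have intH: "set_integrable lborel H (\<lambda>x. (q x)\<^sup>2)"
      unfolding set_integrable_def
      using cH cq by (intro borel_integrable_compact continuous_intros) (auto intro: continuous_on_subset)
    have gI: "(\<integral>\<^sup>+x. g x \<partial>lborel) = ennreal I"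
      unfolding g_def I_def set_lebesgue_integral_def
      using intH by (subst nn_integral_eq_integral) (auto simp: set_integrable_def)
    have I0: "I \<ge> 0" unfolding I_def set_lebesgue_integral_def by (intro integral_nonneg_AE) auto
    have "ennreal (c\<^sup>2) * (ennreal (1 / 2 ^ ?d) * emeasure lborel Q)
       = ennreal (c\<^sup>2) * (\<integral>\<^sup>+x. indicator Q (- x0 + 2 *\<^sub>R x) \<partial>lborel)"
      using mQ by (subst nn_integral_affine) auto
    also have "\<dots> = (\<integral>\<^sup>+x. ennreal (c\<^sup>2) * indicator Q (- x0 + 2 *\<^sub>R x) \<partial>lborel)"
    proof (rule nn_integral_cmult[symmetric])
      have "(\<lambda>x. - x0 + 2 *\<^sub>R x) \<in> measurable lborel borel" by measurable
      from measurable_compose[OF this, of "indicator Q"] mQ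
      show "(\<lambda>x. indicator Q (- x0 + 2 *\<^sub>R x) :: ennreal) \<in> borel_measurable lborel" by simp
    qed
    also have "\<dots> \<le> (\<integral>\<^sup>+x. (\<Sum>t\<in>T. ennreal K * g ((x0 - t *\<^sub>R x0) + t *\<^sub>R x)) \<partial>lborel)"
    proof (rule nn_integral_mono)
      fix x
      show "ennreal (c\<^sup>2) * indicator Q (- x0 + 2 *\<^sub>R x) \<le> (\<Sum>t\<in>T. ennreal K * g ((x0 - t *\<^sub>R x0) + t *\<^sub>R x))"
      proof (cases "- x0 + 2 *\<^sub>R x \<in> Q")
        case True
        have "(\<Sum>t\<in>T. ennreal K * g ((x0 - t *\<^sub>R x0) + t *\<^sub>R x)) = (\<Sum>t\<in>T. ennreal (K * (q (x0 + t *\<^sub>R (x - x0)))\<^sup>2))"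
        proof (rule sum.cong[OF refl])
          fix t assume t: "t \<in> T"
          have eq: "(x0 - t *\<^sub>R x0) + t *\<^sub>R x = x0 + t *\<^sub>R (x - x0)" by (simp add: algebra_simps)
          show "ennreal K * g ((x0 - t *\<^sub>R x0) + t *\<^sub>R x) = ennreal (K * (q (x0 + t *\<^sub>R (x - x0)))\<^sup>2)"
            unfolding eq using key[OF True] K0 t by (simp add: g_def ennreal_mult)
        qed
        also have "\<dots> = ennreal (K * (\<Sum>t\<in>T. (q (x0 + t *\<^sub>R (x - x0)))\<^sup>2))"
          using K0 by (simp add: sum_distrib_left)
        finally show ?thesis using key[OF True] True by (simp add: ennreal_leI)
      qed simp
    qed
    also have "\<dots> = (\<Sum>t\<in>T. ennreal K * (\<integral>\<^sup>+x. g ((x0 - t *\<^sub>R x0) + t *\<^sub>R x) \<partial>lborel))"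
    proof -
      have "(\<lambda>x. g ((x0 - t *\<^sub>R x0) + t *\<^sub>R x)) \<in> borel_measurable lborel" for t
      proof -
        have "(\<lambda>x. (x0 - t *\<^sub>R x0) + t *\<^sub>R x) \<in> measurable lborel borel" by measurable
        from measurable_compose[OF this mg] show ?thesis .
      qed
      then show ?thesis by (subst nn_integral_sum) (auto simp: nn_integral_cmult)
    qed
    also have "\<dots> = (\<Sum>t\<in>T. ennreal K * (ennreal (1 / t ^ ?d) * ennreal I))"
      using T(4) by (intro sum.cong refl) (simp only: nn_integral_affine[OF _ mg] gI)
    also have "\<dots> = (\<Sum>t\<in>T. ennreal (K * (1 / t ^ ?d * I)))"
      using T(4) K0 I0 by (intro sum.cong refl) (simp add: ennreal_mult[symmetric] less_imp_le)
    also have "\<dots> = ennreal (K * (L * I))"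
    proof -
      have "K * (1 / t ^ ?d * I) \<ge> 0" if "t \<in> T" for t using K0 I0 T(4)[OF that] by simp
      then show ?thesis by (simp add: L_def sum_distrib_left sum_distrib_right)
    qed
    finally have "ennreal (c\<^sup>2) * (ennreal (1 / 2 ^ ?d) * emeasure lborel Q) \<le> ennreal (K * (L * I))" .
    moreover have "emeasure lborel Q = ennreal (measure lborel Q)"
      using emeasure_bounded_finite[OF compact_imp_bounded[OF cQ]]
      by (intro emeasure_eq_ennreal_measure) auto
    moreover have "ennreal (c\<^sup>2 * (1 / 2 ^ ?d * measure lborel Q))
        = ennreal (c\<^sup>2) * (ennreal (1 / 2 ^ ?d) * ennreal (measure lborel Q))"
      by (simp add: ennreal_mult[symmetric])
    ultimately have "ennreal (c\<^sup>2 * (1 / 2 ^ ?d * measure lborel Q)) \<le> ennreal (K * (L * I))"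
      by metis
    then have "c\<^sup>2 * (1 / 2 ^ ?d * measure lborel Q) \<le> K * (L * I)"
      using K0 L0 I0 by (simp add: ennreal_le_iff)
    then have "c\<^sup>2 * measure lborel Q \<le> 2 ^ ?d * (K * (L * I))" by (simp add: field_simps)
    moreover have "c\<^sup>2 * (\<bar>n \<bullet> w\<bar> / 2 * area f n) \<le> c\<^sup>2 * measure lborel Q"
      by (intro mult_left_mono volQ) auto
    ultimately have "\<bar>n \<bullet> w\<bar> * (c\<^sup>2 * area f n) \<le> 2 * 2 ^ ?d * (K * L) * I"
      by (simp add: field_simps)
    moreover have "\<bar>n \<bullet> x0 - b\<bar> = \<bar>n \<bullet> w\<bar>" by (simp add: nw abs_minus_commute)
    ultimately show "\<bar>n \<bullet> x0 - b\<bar> * (c\<^sup>2 * area f n)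
       \<le> 2 * 2 ^ ?d * (K * L) * (LINT x:convex hull (insert x0 f)|lborel. (q x)\<^sup>2)"
      unfolding I_def H_def by simp
  qed
qed

section \<open>Facets of polytopes\<close>

text \<open>A face containing a subset of full relative dimension of \<open>E\<close> contains \<open>E\<close>.\<close>

lemma face_superset_of_full_subset:
  fixes S :: "'a::euclidean_space set"
  assumes "F face_of S" "E \<subseteq> S" "convex f" "f \<noteq> {}" "f \<subseteq> E" "f \<subseteq> F" "aff_dim f = aff_dim E"
  shows "E \<subseteq> F"
proof -
  have "affine hull f = affine hull E"
    using assms(4,5,7) by (intro affine_dim_equal) (auto simp: hull_mono)
  then have "rel_interior f \<subseteq> rel_interior E" using assms(5) by (intro rel_interior_mono)
  moreover have "rel_interior f \<noteq> {}" using assms(3,4) by (simp add: rel_interior_eq_empty)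
  moreover have "rel_interior f \<subseteq> F" using rel_interior_subset assms(6) by blast
  ultimately show ?thesis using subset_of_face_of[OF assms(1,2)] by blast
qed

lemma facet_maximal:
  fixes S :: "'a::euclidean_space set"
  assumes "convex S" "E facet_of S" "F face_of S" "F \<noteq> S" "E \<subseteq> F"
  shows "E = F"
proof (rule ccontr)
  assume "E \<noteq> F"
  have "E face_of F"
    using assms by (intro face_of_subset[of E S F]) (auto simp: facet_of_def dest: face_of_imp_subset)
  then have "aff_dim E < aff_dim F"
    using \<open>E \<noteq> F\<close> assms face_of_imp_convex by (intro face_of_aff_dim_lt) auto
  moreover have "aff_dim F < aff_dim S" using assms by (intro face_of_aff_dim_lt) auto
  ultimately show False using assms(2) by (simp add: facet_of_def)
qed

lemma facet_affine_hull:
  fixes f :: "'a::euclidean_space set"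
  assumes "aff_dim f = int DIM('a) - 1" "f \<noteq> {}" "n \<noteq> 0" "f \<subseteq> {x. n \<bullet> x = b}"
  shows "affine hull f = {x. n \<bullet> x = b}"
proof (rule affine_dim_equal)
  show "affine hull f \<subseteq> {x. n \<bullet> x = b}"
    using assms(4) affine_hyperplane by (intro hull_minimal) auto
  show "aff_dim (affine hull f) = aff_dim {x. n \<bullet> x = b}"
    using assms(1,3) by simp
qed (use assms in \<open>auto intro: affine_hyperplane\<close>)

lemma unit_normal_unique:
  fixes f :: "'a::euclidean_space set"
  assumes f: "aff_dim f = int DIM('a) - 1" "f \<noteq> {}"
    and n: "norm n = 1" "\<And>x y. x \<in> f \<Longrightarrow> y \<in> f \<Longrightarrow> n \<bullet> (x - y) = 0"
    and m: "norm m = 1" "\<And>x y. x \<in> f \<Longrightarrow> y \<in> f \<Longrightarrow> m \<bullet> (x - y) = 0"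
  shows "m = n \<or> m = - n"
proof -
  obtain y where y: "y \<in> f" using f by blast
  have hn: "affine hull f = {x. n \<bullet> x = n \<bullet> y}"
  proof (rule facet_affine_hull[OF f])
    show "f \<subseteq> {x. n \<bullet> x = n \<bullet> y}" using n(2)[OF _ y] by (auto simp: inner_diff_right)
  qed (use n(1) in auto)
  have hm: "affine hull f = {x. m \<bullet> x = m \<bullet> y}"
  proof (rule facet_affine_hull[OF f])
    show "f \<subseteq> {x. m \<bullet> x = m \<bullet> y}" using m(2)[OF _ y] by (auto simp: inner_diff_right)
  qed (use m(1) in auto)
  have nn: "n \<bullet> n = 1" "m \<bullet> m = 1" using n m by (auto simp: dot_square_norm)
  define v where "v = m - (m \<bullet> n) *\<^sub>R n"
  have "n \<bullet> v = 0" by (simp add: v_def inner_diff_right nn inner_commute)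
  then have "n \<bullet> (y + v) = n \<bullet> y" by (simp add: inner_add_right)
  then have "m \<bullet> (y + v) = m \<bullet> y" using hn hm by blast
  then have "m \<bullet> v = 0" by (simp add: inner_add_right)
  then have "v \<bullet> v = 0" using \<open>n \<bullet> v = 0\<close> by (simp add: v_def inner_diff_left)
  then have mn: "m = (m \<bullet> n) *\<^sub>R n" by (simp add: v_def)
  then have "1 = \<bar>m \<bullet> n\<bar>" using n m by (metis norm_scaleR mult.right_neutral)
  then have "m \<bullet> n = 1 \<or> m \<bullet> n = -1" by linarith
  then show ?thesis using mn by (metis scaleR_one scaleR_minus1_left)
qed

lemma outn_props:
  fixes K :: "'a::euclidean_space set"
  assumes "polytope K" "F facet_of K"
  shows "norm (outn K F) = 1" "\<And>x y. x \<in> K \<Longrightarrow> y \<in> F \<Longrightarrow> outn K F \<bullet> (x - y) \<le> 0"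
    "\<And>x y. x \<in> F \<Longrightarrow> y \<in> F \<Longrightarrow> outn K F \<bullet> (x - y) = 0"
proof -
  obtain a b where ab: "a \<noteq> 0" "K \<subseteq> {x. a \<bullet> x \<le> b}" "F = K \<inter> {x. a \<bullet> x = b}"
    using facet_of_polyhedron[OF polytope_imp_polyhedron[OF assms(1)] assms(2)] by blast
  have "norm (inverse (norm a) *\<^sub>R a) = 1 \<and> (\<forall>x\<in>K. \<forall>y\<in>F. (inverse (norm a) *\<^sub>R a) \<bullet> (x - y) \<le> 0)"
    using ab by (auto simp: inner_diff_right mult_le_0_iff)
  then have *: "norm (outn K F) = 1 \<and> (\<forall>x\<in>K. \<forall>y\<in>F. outn K F \<bullet> (x - y) \<le> 0)"
    unfolding outn_def by (rule someI)
  then show "norm (outn K F) = 1" "\<And>x y. x \<in> K \<Longrightarrow> y \<in> F \<Longrightarrow> outn K F \<bullet> (x - y) \<le> 0" by auto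
  show "outn K F \<bullet> (x - y) = 0" if "x \<in> F" "y \<in> F" for x y
  proof -
    have "x \<in> K" "y \<in> K" using that ab(3) by auto
    then have "outn K F \<bullet> (x - y) \<le> 0" "outn K F \<bullet> (y - x) \<le> 0" using * that by auto
    then show ?thesis by (simp add: inner_diff_right)
  qed
qed

lemma interior_inner_less:
  fixes K :: "'a::real_inner set"
  assumes "k \<in> interior K" "\<And>x. x \<in> K \<Longrightarrow> n \<bullet> x \<le> b" "n \<noteq> 0"
  shows "n \<bullet> k < b"
proof -
  obtain e where e: "e > 0" "cball k e \<subseteq> K" using assms(1) mem_interior_cball by blast
  have "k + (e / norm n) *\<^sub>R n \<in> K" using e assms(3) by (intro subsetD[OF e(2)]) (auto simp: dist_norm)
  then have "n \<bullet> k + (e / norm n) * (n \<bullet> n) \<le> b" using assms(2) by (fastforce simp: inner_add_right)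
  moreover have "(e / norm n) * (n \<bullet> n) > 0" using e assms(3) by simp
  ultimately show ?thesis by linarith
qed

text \<open>A ball inside a polytope has its centre at least its radius away from the hyperplane of every facet.\<close>

lemma facet_distance_ge:
  fixes K :: "'a::euclidean_space set"
  assumes K: "polytope K" "interior K \<noteq> {}" "f facet_of K" and m: "norm m = 1"
    "\<And>x y. x \<in> f \<Longrightarrow> y \<in> f \<Longrightarrow> m \<bullet> (x - y) = 0" and r: "cball x0 r \<subseteq> K" "r \<ge> 0" and y: "y \<in> f"
  shows "r \<le> \<bar>m \<bullet> x0 - m \<bullet> y\<bar>"
proof -
  define n where "n = outn K f"
  note o = outn_props[OF K(1,3), folded n_def]
  have nn: "n \<bullet> n = 1" using o(1) by (simp add: dot_square_norm)
  have "f \<noteq> {}" "aff_dim f = int DIM('a) - 1"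
    using K(2,3) by (auto simp: facet_of_def aff_dim_nonempty_interior)
  from unit_normal_unique[OF this(2,1) o(1) o(3) m] have mn: "m = n \<or> m = - n" by blast
  have "x0 + r *\<^sub>R n \<in> K" using r o(1) by (intro subsetD[OF r(1)]) (auto simp: dist_norm)
  from o(2)[OF this y] have "r \<le> n \<bullet> y - n \<bullet> x0"
    by (simp add: inner_diff_right inner_add_right nn)
  with mn show ?thesis by auto
qed

section \<open>Meshes\<close>

lemma mesh_cell:
  fixes K :: "'a::euclidean_space set"
  assumes "is_mesh M" "K \<in> M"
  shows "polytope K" "interior K \<noteq> {}" "convex K" "compact K" "closed K" "aff_dim K = int DIM('a)" "K \<noteq> {}"
proof -
  show 1: "polytope K" "interior K \<noteq> {}" using assms by (auto simp: is_mesh_def)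
  then show "convex K" "compact K" "closed K" "K \<noteq> {}"
    by (auto simp: polytope_imp_convex polytope_imp_compact polytope_imp_closed)
  show "aff_dim K = int DIM('a)" using 1 by (simp add: aff_dim_nonempty_interior)
qed

lemma mesh_cell_unique:
  fixes M :: "'a::euclidean_space set set"
  assumes M: "is_mesh M" "K \<in> M" "K' \<in> M" and "interior K \<inter> K' \<noteq> {}"
  shows "K = K'"
proof -
  have F: "K \<inter> K' face_of K" "K \<inter> K' face_of K'" using M by (auto simp: is_mesh_def)
  have "K \<inter> K' = K"
    using face_of_disjoint_interior[OF F(1)] assms(4) interior_subset by blast
  then have "K face_of K'" "interior K \<subseteq> interior K'"
    using F(2) interior_mono[of K K'] by auto
  then show ?thesis
    using face_of_disjoint_interior[of K K'] mesh_cell(2)[OF M(1,2)] interior_subset by blast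
qed

lemma facet_dim:
  fixes M :: "'a::euclidean_space set set"
  assumes "is_mesh M" "K \<in> M" "E facet_of K"
  shows "aff_dim E = int DIM('a) - 1" "E \<noteq> {}" "polytope E" "convex E" "compact E" "E \<subseteq> K" "E \<subseteq> frontier K"
proof -
  note K = mesh_cell[OF assms(1,2)]
  show 1: "aff_dim E = int DIM('a) - 1" "E \<noteq> {}" "E \<subseteq> K" using assms(3) K(6) by (auto simp: facet_of_def dest: face_of_imp_subset)
  show "polytope E" using face_of_polytope_polytope[OF K(1)] assms(3) by (auto simp: facet_of_def)
  then show "convex E" "compact E" by (auto simp: polytope_imp_convex polytope_imp_compact)
  have "E \<noteq> K" using 1(1) K(6) by auto
  then have "E \<inter> interior K = {}" using assms(3) by (intro face_of_disjoint_interior) (auto simp: facet_of_def)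
  then show "E \<subseteq> frontier K" using 1(3) K(5) by (auto simp: frontier_def)
qed

text \<open>A facet of one cell that meets another cell in a set of full relative dimension is also a facet of the
  latter.\<close>

lemma mesh_facet_shared:
  fixes M :: "'a::euclidean_space set set"
  assumes M: "is_mesh M" "K \<in> M" "K' \<in> M" and E: "E facet_of K"
    and f: "f \<subseteq> E" "f \<subseteq> K'" "convex f" "f \<noteq> {}" "aff_dim f = int DIM('a) - 1"
  shows "E facet_of K'"
proof (cases "K = K'")
  case False
  have F: "K \<inter> K' face_of K" "K \<inter> K' face_of K'" using M by (auto simp: is_mesh_def)
  have FK: "K \<inter> K' \<noteq> K" using mesh_cell_unique[OF M] False mesh_cell(2)[OF M(1,2)] interior_subset by blast
  note Ed = facet_dim[OF M(1,2) E]
  have "E \<subseteq> K \<inter> K'"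
    using F(1) Ed f by (intro face_superset_of_full_subset[of "K \<inter> K'" K E f]) auto
  then have "E = K \<inter> K'" by (intro facet_maximal[OF mesh_cell(3)[OF M(1,2)] E F(1) FK])
  then show ?thesis using F(2) Ed mesh_cell(6)[OF M(1,3)] by (simp add: facet_of_def)
qed (use E in simp)

lemma mesh_faces_nbr:
  fixes M :: "'a::euclidean_space set set"
  assumes M: "is_mesh M" "E \<in> mesh_faces M" "K \<in> M"
  shows "E \<subseteq> frontier K \<longleftrightarrow> E facet_of K"
proof
  assume "E \<subseteq> frontier K"
  then have "E \<subseteq> K" using mesh_cell(5)[OF M(1,3)] frontier_subset_closed by blast
  obtain K1 where K1: "K1 \<in> M" "E facet_of K1" using M(2) by (auto simp: mesh_faces_def)
  show "E facet_of K"
    using mesh_facet_shared[OF M(1) K1(1) M(3) K1(2), of E] facet_dim[OF M(1) K1] \<open>E \<subseteq> K\<close> by auto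
qed (use facet_dim[OF M(1,3)] in auto)

lemma mesh_faces_unique:
  fixes M :: "'a::euclidean_space set set"
  assumes M: "is_mesh M" and E: "E \<in> mesh_faces M" "E' \<in> mesh_faces M"
    and f: "f \<subseteq> E" "f \<subseteq> E'" "convex f" "f \<noteq> {}" "aff_dim f = int DIM('a) - 1"
  shows "E = E'"
proof -
  have *: "A \<subseteq> B" if AB: "A \<in> mesh_faces M" "B \<in> mesh_faces M" "f \<subseteq> A" "f \<subseteq> B" for A B
  proof -
    obtain K where K: "K \<in> M" "B facet_of K" using AB by (auto simp: mesh_faces_def)
    obtain K1 where K1: "K1 \<in> M" "A facet_of K1" using AB by (auto simp: mesh_faces_def)
    have "A facet_of K"
      using mesh_facet_shared[OF M K1(1) K(1) K1(2) AB(3) _ f(3-5)] AB(4) facet_dim(6)[OF M K] by blast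
    from facet_dim[OF M K(1) this] K(2) show ?thesis
      using f AB by (intro face_superset_of_full_subset[of B K A f]) (auto simp: facet_of_def)
  qed
  show ?thesis using *[OF E f(1,2)] *[OF E(2,1) f(2,1)] by blast
qed

text \<open>Near a relative interior point of a facet, a convex set fills its side of the hyperplane of the facet.\<close>

lemma half_neighbourhood:
  fixes K :: "'a::euclidean_space set"
  assumes K: "convex K" "k \<in> K" "n \<bullet> k < b" and E: "E \<subseteq> K" "affine hull E = {x. n \<bullet> x = b}"
    and z: "z \<in> rel_interior E"
  shows "\<forall>\<^sub>F x in nhds z. n \<bullet> x \<le> b \<longrightarrow> x \<in> K"
proof -
  define t where "t = (\<lambda>x. (b - n \<bullet> x) / (b - n \<bullet> k))"
  define y where "y = (\<lambda>x. inverse (1 - t x) *\<^sub>R (x - t x *\<^sub>R k))"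
  obtain e where e: "e > 0" "ball z e \<inter> affine hull E \<subseteq> E" using z by (auto simp: mem_rel_interior_ball)
  have "z \<in> E" using z rel_interior_subset by blast
  then have nz: "n \<bullet> z = b" using E(2) hull_inc[of z E] by auto
  have tz: "t z = 0" by (simp add: t_def nz)
  have tl: "(t \<longlongrightarrow> 0) (nhds z)"
  proof -
    have "(t \<longlongrightarrow> (b - n \<bullet> z) / (b - n \<bullet> k)) (nhds z)"
      unfolding t_def using K(3) by (intro tendsto_intros) (auto simp: filterlim_ident)
    then show ?thesis by (simp add: nz)
  qed
  have "(y \<longlongrightarrow> inverse (1 - 0) *\<^sub>R (z - 0 *\<^sub>R k)) (nhds z)"
    unfolding y_def by (intro tendsto_intros tl) (auto simp: filterlim_ident)
  then have yl: "(y \<longlongrightarrow> z) (nhds z)" by simp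
  have "\<forall>\<^sub>F x in nhds z. dist (y x) z < e" using tendstoD[OF yl e(1)] .
  moreover have "\<forall>\<^sub>F x in nhds z. t x < 1" using order_tendstoD(2)[OF tl, of 1] by simp
  ultimately show ?thesis
  proof eventually_elim
    case (elim x)
    show ?case
    proof
      assume nx: "n \<bullet> x \<le> b"
      have t0: "t x \<ge> 0" unfolding t_def using nx K(3) by simp
      have bn: "t x * (b - n \<bullet> k) = b - n \<bullet> x" unfolding t_def using K(3) by simp
      have "n \<bullet> y x = inverse (1 - t x) * (n \<bullet> x - t x * (n \<bullet> k))" by (simp add: y_def inner_diff_right)
      also have "n \<bullet> x - t x * (n \<bullet> k) = (1 - t x) * b" using bn by (simp add: algebra_simps)
      finally have "n \<bullet> y x = b" using elim by simp
      then have "y x \<in> E" using elim e(2) E(2) by (auto simp: dist_commute)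
      then have "(1 - t x) *\<^sub>R y x + t x *\<^sub>R k \<in> K"
        using K(1,2) E(1) t0 elim by (intro convexD) auto
      moreover have "(1 - t x) *\<^sub>R y x = x - t x *\<^sub>R k" using elim by (simp add: y_def)
      ultimately show "x \<in> K" by simp
    qed
  qed
qed

text \<open>A mesh face either lies on the boundary of the meshed region or is shared by two cells on opposite
  sides; in the latter case no piece of it of full relative dimension is on the boundary.\<close>

lemma mesh_face_boundary:
  fixes M :: "'a::euclidean_space set set"
  assumes M: "is_mesh M" and E: "E \<in> mesh_faces M"
    and f: "f \<subseteq> E" "f \<subseteq> frontier (\<Union>M)" "convex f" "f \<noteq> {}" "aff_dim f = int DIM('a) - 1"
  shows "E \<subseteq> frontier (\<Union>M)"
proof (rule ccontr)
  let ?U = "\<Union>M"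
  have fin: "finite M" using M by (simp add: is_mesh_def)
  have clU: "closed ?U" using fin mesh_cell(5)[OF M] by (intro closed_Union) auto
  assume "\<not> E \<subseteq> frontier ?U"
  then obtain x where x: "x \<in> E" "x \<notin> frontier ?U" by blast
  obtain K where K: "K \<in> M" "E facet_of K" using E by (auto simp: mesh_faces_def)
  note Ed = facet_dim[OF M K] and Kd = mesh_cell[OF M K(1)]
  have xU: "x \<in> interior ?U" using x Ed(6) K(1) clU by (auto simp: frontier_def)
  have "x \<in> closure (rel_interior E)"
    using x(1) convex_closure_rel_interior[OF Ed(4)] closure_subset by blast
  then obtain x' where x': "x' \<in> rel_interior E" "x' \<in> interior ?U"
    using xU open_Int_closure_eq_empty[of "interior ?U" "rel_interior E"] by auto
  define n where "n = outn K E"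
  note o = outn_props[OF Kd(1) K(2), folded n_def]
  define b where "b = n \<bullet> x"
  have nE: "n \<bullet> y = b" if "y \<in> E" for y using o(3)[OF that x(1)] by (simp add: b_def inner_diff_right)
  have nK: "n \<bullet> y \<le> b" if "y \<in> K" for y using o(2)[OF that x(1)] by (simp add: b_def inner_diff_right)
  have n0: "n \<noteq> 0" using o(1) by auto
  have nn: "n \<bullet> n = 1" using o(1) by (simp add: dot_square_norm)
  have hE: "affine hull E = {y. n \<bullet> y = b}" using nE Ed n0 by (intro facet_affine_hull) auto
  have x'E: "x' \<in> E" using x'(1) rel_interior_subset by blast
  have "closed (\<Union>{K'\<in>M. x' \<notin> K'})" using fin mesh_cell(5)[OF M] by (intro closed_Union) auto
  \<comment> \<open>every cell meeting a small neighbourhood of \<open>x'\<close> contains \<open>x'\<close>\<close>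
  then have "open (interior ?U - \<Union>{K'\<in>M. x' \<notin> K'})" by (intro open_Diff) auto
  moreover have "x' \<in> interior ?U - \<Union>{K'\<in>M. x' \<notin> K'}" using x'(2) by auto
  ultimately obtain e where e: "e > 0" "cball x' e \<subseteq> interior ?U - \<Union>{K'\<in>M. x' \<notin> K'}"
    using open_contains_cball by metis
  define x1 where "x1 = x' + e *\<^sub>R n"
  have "x1 \<in> cball x' e" using e(1) o(1) by (simp add: x1_def dist_norm)
  then have "x1 \<in> interior ?U" "x1 \<notin> \<Union>{K'\<in>M. x' \<notin> K'}" using e(2) by auto
  then obtain K' where K': "K' \<in> M" "x1 \<in> K'" "x' \<in> K'" using interior_subset by blast
  have nx1: "n \<bullet> x1 > b" using e(1) nE[OF x'E] by (simp add: x1_def inner_add_right nn)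
  have "K \<inter> K' face_of K" using M K(1) K'(1) by (auto simp: is_mesh_def)
  then have "E \<subseteq> K \<inter> K'"
    using subset_of_face_of[of "K \<inter> K'" K E] Ed(6) x'(1) x'E K'(3) by blast
  then have E': "E facet_of K'"
    using mesh_facet_shared[OF M K(1) K'(1) K(2), of E] Ed by blast
  note Kd' = mesh_cell[OF M K'(1)]
  define n' where "n' = outn K' E"
  note o' = outn_props[OF Kd'(1) E', folded n'_def]
  have "n' = n \<or> n' = - n" using unit_normal_unique[OF Ed(1,2) o(1) o(3) o'(1) o'(3)] .
  moreover have "n' \<noteq> n" using o'(2)[OF K'(2) x'E] nx1 nE[OF x'E] by (auto simp: inner_diff_right)
  ultimately have n': "n' = - n" by blast
  have nK': "(- n) \<bullet> y \<le> - b" if "y \<in> K'" for y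
    using o'(2)[OF that x'E] nE[OF x'E] by (simp add: n' inner_diff_right)
  obtain k where k: "k \<in> interior K" using Kd(2) by blast
  obtain k' where k': "k' \<in> interior K'" using Kd'(2) by blast
  have "affine hull f = affine hull E"
    using f(1,4,5) Ed(1) by (intro affine_dim_equal) (auto simp: hull_mono)
  then have "rel_interior f \<subseteq> rel_interior E" using f(1) by (intro rel_interior_mono)
  then obtain z where z: "z \<in> rel_interior E" "z \<in> f"
    using f(3,4) rel_interior_eq_empty[of f] rel_interior_subset[of f] by blast
  have "\<forall>\<^sub>F y in nhds z. n \<bullet> y \<le> b \<longrightarrow> y \<in> K"
    using half_neighbourhood[OF Kd(3) _ _ Ed(6) hE z(1), of k] k interior_subset
      interior_inner_less[OF k nK n0] by blast
  moreover have "\<forall>\<^sub>F y in nhds z. (- n) \<bullet> y \<le> - b \<longrightarrow> y \<in> K'"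
  proof (rule half_neighbourhood[OF Kd'(3) _ _ _ _ z(1), of k'])
    show "k' \<in> K'" using k' interior_subset by blast
    show "(- n) \<bullet> k' < - b" using interior_inner_less[OF k' nK'] n0 by auto
    show "E \<subseteq> K'" using E' by (auto simp: facet_of_def dest: face_of_imp_subset)
    show "affine hull E = {x. - n \<bullet> x = - b}" using hE by auto
  qed
  ultimately have "\<forall>\<^sub>F y in nhds z. y \<in> ?U"
    by eventually_elim (use K(1) K'(1) in auto)
  then have "z \<in> interior ?U"
    by (auto simp: eventually_nhds intro: interiorI)
  moreover have "z \<in> frontier ?U" using f(2) z(2) by blast
  ultimately show False by (simp add: frontier_def)
qed

section \<open>Cones over the facets of a cell\<close>

lemma cone_point:
  fixes x0 :: "'a::real_vector"
  assumes "x \<in> convex hull (insert x0 f)" "convex f" "f \<noteq> {}"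
  obtains s y where "y \<in> f" "0 \<le> s" "s \<le> 1" "x = x0 + s *\<^sub>R (y - x0)"
proof -
  have "x \<in> {u *\<^sub>R x0 + v *\<^sub>R y | u v y. 0 \<le> u \<and> 0 \<le> v \<and> u + v = 1 \<and> y \<in> f}"
    using assms by (simp add: convex_hull_insert hull_same) blast
  then obtain u v y where uv: "x = u *\<^sub>R x0 + v *\<^sub>R y" "0 \<le> u" "0 \<le> v" "u + v = 1" "y \<in> f" by blast
  then have "x = x0 + v *\<^sub>R (y - x0)"
    using scaleR_add_left[of u v x0] by (simp add: algebra_simps)
  then show thesis using that[of y v] uv by auto
qed

text \<open>For a facet \<open>g\<close>, scale its outer normal such that the linear functional has increment 1 from \<open>x0\<close> to \<open>g\<close>.
  Among these functionals the one of \<open>f\<close> is largest on the cone over \<open>f\<close>, so two cones meet in a hyperplane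
  only.\<close>

lemma facet_cones_negligible:
  fixes K :: "'a::euclidean_space set"
  assumes K: "polytope K" and fg: "f facet_of K" "g facet_of K" "f \<noteq> g" and x0: "x0 \<in> interior K"
  shows "negligible (convex hull (insert x0 f) \<inter> convex hull (insert x0 g))"
proof -
  have cK: "convex K" using K by (rule polytope_imp_convex)
  obtain yf yg where y: "yf \<in> f" "yg \<in> g" using fg by (auto simp: facet_of_def)
  define nf where "nf = outn K f"
  define ng where "ng = outn K g"
  note ofs = outn_props[OF K fg(1), folded nf_def] and og = outn_props[OF K fg(2), folded ng_def]
  have hf: "nf \<bullet> (yf - x0) > 0"
    using interior_inner_less[OF x0, of nf "nf \<bullet> yf"] ofs(1,2) y by (force simp: inner_diff_right)
  have hg: "ng \<bullet> (yg - x0) > 0"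
    using interior_inner_less[OF x0, of ng "ng \<bullet> yg"] og(1,2) y by (force simp: inner_diff_right)
  define mf where "mf = inverse (nf \<bullet> (yf - x0)) *\<^sub>R nf"
  define mg where "mg = inverse (ng \<bullet> (yg - x0)) *\<^sub>R ng"
  have mf1: "mf \<bullet> (z - x0) = 1" if "z \<in> f" for z
  proof -
    have "nf \<bullet> (z - x0) = nf \<bullet> (yf - x0)" using ofs(3)[OF that y(1)] by (simp add: inner_diff_right)
    then show ?thesis using hf by (simp add: mf_def)
  qed
  have mg1: "mg \<bullet> (z - x0) = 1" if "z \<in> g" for z
  proof -
    have "ng \<bullet> (z - x0) = ng \<bullet> (yg - x0)" using og(3)[OF that y(2)] by (simp add: inner_diff_right)
    then show ?thesis using hg by (simp add: mg_def)
  qed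
  have mfle: "mf \<bullet> (z - x0) \<le> 1" if "z \<in> K" for z
  proof -
    have "nf \<bullet> (z - x0) \<le> nf \<bullet> (yf - x0)" using ofs(2)[OF that y(1)] by (simp add: inner_diff_right)
    then have "inverse (nf \<bullet> (yf - x0)) * (nf \<bullet> (z - x0)) \<le> inverse (nf \<bullet> (yf - x0)) * (nf \<bullet> (yf - x0))"
      using hf by (intro mult_left_mono) auto
    then show ?thesis using hf by (simp add: mf_def)
  qed
  have mgle: "mg \<bullet> (z - x0) \<le> 1" if "z \<in> K" for z
  proof -
    have "ng \<bullet> (z - x0) \<le> ng \<bullet> (yg - x0)" using og(2)[OF that y(2)] by (simp add: inner_diff_right)
    then have "inverse (ng \<bullet> (yg - x0)) * (ng \<bullet> (z - x0)) \<le> inverse (ng \<bullet> (yg - x0)) * (ng \<bullet> (yg - x0))"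
      using hg by (intro mult_left_mono) auto
    then show ?thesis using hg by (simp add: mg_def)
  qed
  have sub: "f \<subseteq> K" "g \<subseteq> K" using fg by (auto simp: facet_of_def dest: face_of_imp_subset)
  have cf: "convex f" "convex g" "f \<noteq> {}" "g \<noteq> {}"
    using fg by (auto simp: facet_of_def intro: face_of_imp_convex)
  have "mf \<noteq> mg"
  proof
    assume eq: "mf = mg"
    define F where "F = K \<inter> {x. mf \<bullet> x = 1 + mf \<bullet> x0}"
    have "F face_of K" unfolding F_def
      using mfle by (intro face_of_Int_supporting_hyperplane_le cK) (simp add: inner_diff_right algebra_simps)
    moreover have "F \<noteq> K"
    proof -
      have "x0 \<in> K" using x0 interior_subset by blast
      then show ?thesis
      proof (intro notI)
        assume "x0 \<in> K" "F = K"
        then have "x0 \<in> F" by simp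
        then show False by (simp add: F_def)
      qed
    qed
    moreover have "f \<subseteq> F" using sub mf1 by (auto simp: F_def inner_diff_right algebra_simps)
    moreover have "g \<subseteq> F" using sub mg1 by (auto simp: F_def eq inner_diff_right algebra_simps)
    ultimately show False using facet_maximal[OF cK fg(1)] facet_maximal[OF cK fg(2)] fg(3) by blast
  qed
  then have "negligible {x. (mf - mg) \<bullet> x = (mf - mg) \<bullet> x0}" by (intro negligible_hyperplane) auto
  moreover have "convex hull (insert x0 f) \<inter> convex hull (insert x0 g) \<subseteq> {x. (mf - mg) \<bullet> x = (mf - mg) \<bullet> x0}"
  proof
    fix x assume "x \<in> convex hull (insert x0 f) \<inter> convex hull (insert x0 g)"
    then have "x \<in> convex hull (insert x0 f)" "x \<in> convex hull (insert x0 g)" by auto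
    then obtain s y r z where s: "y \<in> f" "0 \<le> s" "x = x0 + s *\<^sub>R (y - x0)"
      and r: "z \<in> g" "0 \<le> r" "x = x0 + r *\<^sub>R (z - x0)"
      using cone_point[of x x0 f] cone_point[of x x0 g] cf by metis
    have "mf \<bullet> (x - x0) = s" using mf1[OF s(1)] by (simp add: s(3))
    moreover have "mg \<bullet> (x - x0) \<le> s"
      using mult_left_mono[OF mgle s(2), of y] sub s(1) by (auto simp: s(3))
    moreover have "mg \<bullet> (x - x0) = r" using mg1[OF r(1)] by (simp add: r(3))
    moreover have "mf \<bullet> (x - x0) \<le> r"
      using mult_left_mono[OF mfle r(2), of z] sub r(1) by (auto simp: r(3))
    ultimately have "mf \<bullet> (x - x0) = mg \<bullet> (x - x0)" by linarith
    then show "x \<in> {x. (mf - mg) \<bullet> x = (mf - mg) \<bullet> x0}" by (simp add: inner_diff_right inner_diff_left)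
  qed
  ultimately show ?thesis by (rule negligible_subset)
qed

lemma sum_facet_cones_le:
  fixes K :: "'a::euclidean_space set" and g :: "'a \<Rightarrow> real"
  assumes K: "polytope K" and F: "finite F" "\<And>f. f \<in> F \<Longrightarrow> f facet_of K" and x0: "x0 \<in> interior K"
    and g: "set_integrable lborel K g" "\<And>x. x \<in> K \<Longrightarrow> 0 \<le> g x"
  shows "(\<Sum>f\<in>F. LINT x:convex hull (insert x0 f)|lborel. g x) \<le> (LINT x:K|lborel. g x)"
proof -
  define H where "H = (\<lambda>f. convex hull (insert x0 f))"
  have cH: "compact (H f)" and HK: "H f \<subseteq> K" if "f \<in> F" for f
  proof -
    have "f face_of K" using F(2)[OF that] by (simp add: facet_of_def)
    then have "compact f" using face_of_polytope_polytope[OF K] polytope_imp_compact by blast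
    then show "compact (H f)" unfolding H_def by (intro compact_convex_hull) auto
    have "f \<subseteq> K" using \<open>f face_of K\<close> by (rule face_of_imp_subset)
    then show "H f \<subseteq> K" unfolding H_def
      using x0 interior_subset polytope_imp_convex[OF K] by (intro hull_minimal) auto
  qed
  have int: "set_integrable lborel (H f) g" if "f \<in> F" for f
    by (rule set_integrable_subset[OF g(1)]) (use cH HK that in \<open>auto intro: borel_compact\<close>)
  define N where "N = (\<Union>p\<in>{p\<in>F \<times> F. fst p \<noteq> snd p}. H (fst p) \<inter> H (snd p))"
  have N0: "N \<in> null_sets lborel" unfolding N_def
  proof (rule null_sets.finite_UN)
    show "finite {p\<in>F \<times> F. fst p \<noteq> snd p}" using F(1) by auto
    fix p assume "p \<in> {p\<in>F \<times> F. fst p \<noteq> snd p}"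
    then have p: "fst p \<in> F" "snd p \<in> F" "fst p \<noteq> snd p" by auto
    then have "negligible (H (fst p) \<inter> H (snd p))"
      unfolding H_def using K F(2) x0 by (intro facet_cones_negligible) auto
    moreover have "H (fst p) \<inter> H (snd p) \<in> sets borel" using p cH by (auto intro: borel_compact)
    ultimately show "H (fst p) \<inter> H (snd p) \<in> null_sets lborel"
      by (simp add: negligible_iff_null_sets null_sets_completion_iff)
  qed
  have AE: "AE x in lborel. (\<Sum>f\<in>F. indicator (H f) x *\<^sub>R g x) \<le> indicator K x *\<^sub>R g x"
  proof (rule AE_I'[OF N0], intro subsetI)
    fix x assume "x \<in> {x \<in> space lborel. \<not> (\<Sum>f\<in>F. indicator (H f) x *\<^sub>R g x) \<le> indicator K x *\<^sub>R g x}"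
    then have bad: "\<not> (\<Sum>f\<in>F. indicator (H f) x *\<^sub>R g x) \<le> indicator K x *\<^sub>R g x" by simp
    show "x \<in> N"
    proof (rule ccontr)
      assume N: "x \<notin> N"
      show False
      proof (cases "\<exists>f\<in>F. x \<in> H f")
        case True
        then obtain f where f: "f \<in> F" "x \<in> H f" by blast
        have "indicator (H f') x = (0::real)" if "f' \<in> F - {f}" for f'
          using N f that unfolding N_def by (force simp: indicator_def)
        then have "(\<Sum>f'\<in>F - {f}. indicator (H f') x *\<^sub>R g x) = 0"
          by (intro sum.neutral) auto
        then have "(\<Sum>f\<in>F. indicator (H f) x *\<^sub>R g x) = indicator (H f) x *\<^sub>R g x"
          using sum.remove[OF F(1) f(1), of "\<lambda>f. indicator (H f) x *\<^sub>R g x"] by linarith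
        moreover have "x \<in> K" using f HK by blast
        ultimately show False using bad f by simp
      next
        case False
        then have "(\<Sum>f\<in>F. indicator (H f) x *\<^sub>R g x) = 0" by (intro sum.neutral) auto
        moreover have "0 \<le> indicator K x *\<^sub>R g x" using g(2) by (cases "x \<in> K") auto
        ultimately show False using bad by simp
      qed
    qed
  qed
  have "(\<Sum>f\<in>F. LINT x:H f|lborel. g x) = (LINT x|lborel. (\<Sum>f\<in>F. indicator (H f) x *\<^sub>R g x))"
    unfolding set_lebesgue_integral_def
    using int by (intro Bochner_Integration.integral_sum[symmetric]) (auto simp: set_integrable_def)
  also have "\<dots> \<le> (LINT x:K|lborel. g x)"
    unfolding set_lebesgue_integral_def
    using AE int g(1) by (intro integral_mono_AE Bochner_Integration.integrable_sum) (auto simp: set_integrable_def)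
  finally show ?thesis unfolding H_def .
qed

section \<open>Positive semidefinite forms\<close>

text \<open>A positive semidefinite bilinear form on a linear space of fields.  Definiteness is not required, since
  energies on a neighbourhood vanish for fields supported elsewhere.\<close>

locale psd =
  fixes V :: "'a::real_vector vfield set" and B :: "'a form"
  assumes V_zero: "(\<lambda>\<tau> x. 0) \<in> V"
    and V_add: "u \<in> V \<Longrightarrow> v \<in> V \<Longrightarrow> (\<lambda>\<tau> x. u \<tau> x + c *\<^sub>R v \<tau> x) \<in> V"
    and sym: "u \<in> V \<Longrightarrow> v \<in> V \<Longrightarrow> B u v = B v u"
    and lin: "u \<in> V \<Longrightarrow> v \<in> V \<Longrightarrow> w \<in> V \<Longrightarrow> B (\<lambda>\<tau> x. u \<tau> x + c *\<^sub>R v \<tau> x) w = B u w + c * B v w"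
    and nonneg: "u \<in> V \<Longrightarrow> 0 \<le> B u u"

lemma lincomb_empty: "lincomb c v {} = (\<lambda>\<tau> x. 0)"
  by (simp add: lincomb_def)

lemma lincomb_insert:
  "finite I \<Longrightarrow> i \<notin> I \<Longrightarrow> lincomb c v (insert i I) = (\<lambda>\<tau> x. lincomb c v I \<tau> x + c i *\<^sub>R v i \<tau> x)"
  by (simp add: lincomb_def add.commute)

context psd begin

lemma lin_right:
  "u \<in> V \<Longrightarrow> v \<in> V \<Longrightarrow> w \<in> V \<Longrightarrow> B w (\<lambda>\<tau> x. u \<tau> x + c *\<^sub>R v \<tau> x) = B w u + c * B w v"
  using lin[of u v w c] sym[of w "\<lambda>\<tau> x. u \<tau> x + c *\<^sub>R v \<tau> x"] sym[of w u] sym[of w v] V_add[of u v c]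
  by simp

lemma zero_left: "w \<in> V \<Longrightarrow> B (\<lambda>\<tau> x. 0) w = 0"
  using lin[OF V_zero V_zero, of w 1] by simp

lemma lincomb_in: "finite I \<Longrightarrow> (\<And>i. i \<in> I \<Longrightarrow> v i \<in> V) \<Longrightarrow> lincomb c v I \<in> V"
  by (induction I rule: finite_induct) (auto simp: lincomb_empty lincomb_insert V_zero V_add)

lemma lincomb_left:
  "finite I \<Longrightarrow> (\<And>i. i \<in> I \<Longrightarrow> v i \<in> V) \<Longrightarrow> w \<in> V \<Longrightarrow> B (lincomb c v I) w = (\<Sum>i\<in>I. c i * B (v i) w)"
proof (induction I rule: finite_induct)
  case (insert i I)
  then show ?case by (simp add: lincomb_insert lin lincomb_in)
qed (simp add: lincomb_empty zero_left)

lemma lincomb_right: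
  assumes "finite I" "\<And>i. i \<in> I \<Longrightarrow> v i \<in> V" "w \<in> V"
  shows "B w (lincomb c v I) = (\<Sum>i\<in>I. c i * B w (v i))"
proof -
  have "B w (lincomb c v I) = B (lincomb c v I) w" using assms by (intro sym lincomb_in)
  also have "\<dots> = (\<Sum>i\<in>I. c i * B (v i) w)" using assms by (rule lincomb_left)
  also have "\<dots> = (\<Sum>i\<in>I. c i * B w (v i))" using assms sym by (intro sum.cong) auto
  finally show ?thesis .
qed

lemma square_add:
  assumes "u \<in> V" "v \<in> V"
  shows "B (\<lambda>\<tau> x. u \<tau> x + c *\<^sub>R v \<tau> x) (\<lambda>\<tau> x. u \<tau> x + c *\<^sub>R v \<tau> x) = B u u + 2 * c * B u v + c\<^sup>2 * B v v"
proof -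
  let ?w = "\<lambda>\<tau> x. u \<tau> x + c *\<^sub>R v \<tau> x"
  have "B ?w ?w = B u ?w + c * B v ?w" by (rule lin[OF assms V_add[OF assms]])
  moreover have "B u ?w = B u u + c * B u v" by (rule lin_right[OF assms assms(1)])
  moreover have "B v ?w = B u v + c * B v v" unfolding lin_right[OF assms assms(2)] sym[OF assms] ..
  ultimately show ?thesis by (simp add: power2_eq_square algebra_simps)
qed

lemma null_left:
  assumes "u \<in> V" "w \<in> V" "B u u = 0"
  shows "B u w = 0"
proof (rule ccontr)
  assume ne: "B u w \<noteq> 0"
  have "0 \<le> B w w + 2 * t * B w u + t\<^sup>2 * B u u" for t
    using nonneg[OF V_add[OF assms(2,1), of t]] square_add[OF assms(2,1), of t] by simp
  then have "0 \<le> B w w + 2 * (- (B w w + 1) / (2 * B u w)) * B u w"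
    using assms sym[of u w] by (metis add.right_neutral mult_zero_right)
  also have "2 * (- (B w w + 1) / (2 * B u w)) * B u w = - (B w w + 1)" using ne by simp
  finally show False by simp
qed

lemma lincomb_orthogonal:
  assumes "finite I" "\<And>i. i \<in> I \<Longrightarrow> v i \<in> V" "\<And>i j. i \<in> I \<Longrightarrow> j \<in> I \<Longrightarrow> i \<noteq> j \<Longrightarrow> B (v i) (v j) = 0"
  shows "j \<in> I \<Longrightarrow> B (lincomb c v I) (v j) = c j * B (v j) (v j)"
    and "B (lincomb c v I) (lincomb c v I) = (\<Sum>i\<in>I. (c i)\<^sup>2 * B (v i) (v i))"
proof -
  show *: "B (lincomb c v I) (v j) = c j * B (v j) (v j)" if "j \<in> I" for j
  proof -
    have "B (lincomb c v I) (v j) = (\<Sum>i\<in>I. c i * B (v i) (v j))"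
      using assms that by (intro lincomb_left) auto
    also have "\<dots> = (\<Sum>i\<in>I. if i = j then c j * B (v j) (v j) else 0)"
      using assms(3) that by (intro sum.cong) auto
    also have "\<dots> = c j * B (v j) (v j)" using assms(1) that by simp
    finally show ?thesis .
  qed
  have "B (lincomb c v I) (lincomb c v I) = (\<Sum>i\<in>I. c i * B (lincomb c v I) (v i))"
    using assms by (intro lincomb_right lincomb_in) auto
  also have "\<dots> = (\<Sum>i\<in>I. (c i)\<^sup>2 * B (v i) (v i))"
    using * by (intro sum.cong) (auto simp: power2_eq_square)
  finally show "B (lincomb c v I) (lincomb c v I) = (\<Sum>i\<in>I. (c i)\<^sup>2 * B (v i) (v i))" .
qed

lemma bessel:
  assumes "finite I" "\<And>i. i \<in> I \<Longrightarrow> v i \<in> V" "\<And>i j. i \<in> I \<Longrightarrow> j \<in> I \<Longrightarrow> i \<noteq> j \<Longrightarrow> B (v i) (v j) = 0"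
    and u: "u \<in> V" "\<And>i. i \<in> I \<Longrightarrow> B u (v i) = c i * B (v i) (v i)"
  shows "(\<Sum>i\<in>I. (c i)\<^sup>2 * B (v i) (v i)) \<le> B u u"
proof -
  let ?w = "lincomb c v I"
  have w: "?w \<in> V" using assms by (intro lincomb_in) auto
  have "B u ?w = (\<Sum>i\<in>I. c i * B u (v i))" using assms by (intro lincomb_right) auto
  also have "\<dots> = (\<Sum>i\<in>I. (c i)\<^sup>2 * B (v i) (v i))"
    using u(2) by (intro sum.cong) (auto simp: power2_eq_square)
  finally have uw: "B u ?w = (\<Sum>i\<in>I. (c i)\<^sup>2 * B (v i) (v i))" .
  have "0 \<le> B u u + 2 * (-1) * B u ?w + (-1)\<^sup>2 * B ?w ?w"
    using nonneg[OF V_add[OF u(1) w, of "-1"]] square_add[OF u(1) w, of "-1"] by simp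
  also have "B ?w ?w = B u ?w" unfolding uw using assms by (intro lincomb_orthogonal(2)) auto
  finally show ?thesis by (simp add: uw)
qed

text \<open>Orthogonal projection onto a finite span, also for degenerate forms.\<close>

lemma projection_exists:
  assumes "finite I" "\<And>i. i \<in> I \<Longrightarrow> g i \<in> V" "v \<in> V"
  shows "\<exists>c. \<forall>j\<in>I. B (\<lambda>\<tau> x. v \<tau> x + lincomb c g I \<tau> x) (g j) = 0"
  using assms
proof (induction I arbitrary: v rule: finite_induct)
  case (insert i I)
  have gi: "g i \<in> V" and gI: "\<And>j. j \<in> I \<Longrightarrow> g j \<in> V" using insert.prems by auto
  obtain c where c: "\<And>j. j \<in> I \<Longrightarrow> B (\<lambda>\<tau> x. v \<tau> x + lincomb c g I \<tau> x) (g j) = 0"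
    using insert.IH[of v, OF gI insert.prems(2)] by blast
  obtain d where d: "\<And>j. j \<in> I \<Longrightarrow> B (\<lambda>\<tau> x. g i \<tau> x + lincomb d g I \<tau> x) (g j) = 0"
    using insert.IH[of "g i", OF gI gi] by blast
  define v' where "v' = (\<lambda>\<tau> x. v \<tau> x + lincomb c g I \<tau> x)"
  define g' where "g' = (\<lambda>\<tau> x. g i \<tau> x + lincomb d g I \<tau> x)"
  have inV: "lincomb c g I \<in> V" "lincomb d g I \<in> V" using insert.hyps gI by (auto intro: lincomb_in)
  have V': "v' \<in> V" "g' \<in> V"
    using V_add[OF insert.prems(2) inV(1), of 1] V_add[OF gi inV(2), of 1] by (auto simp: v'_def g'_def)
  define t where "t = - B v' g' / B g' g'"
  have tg: "B v' g' + t * B g' g' = 0"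
    using null_left[OF V'(2,1)] sym[OF V'] by (cases "B g' g' = 0") (auto simp: t_def)
  define e where "e = (\<lambda>j. if j = i then t else c j + t * d j)"
  have eq: "(\<lambda>\<tau> x. v \<tau> x + lincomb e g (insert i I) \<tau> x) = (\<lambda>\<tau> x. v' \<tau> x + t *\<^sub>R g' \<tau> x)" (is "?e = _")
  proof (intro ext)
    fix \<tau> x
    have "lincomb e g I \<tau> x = (\<Sum>j\<in>I. c j *\<^sub>R g j \<tau> x + t *\<^sub>R (d j *\<^sub>R g j \<tau> x))"
      unfolding lincomb_def using insert.hyps by (intro sum.cong) (auto simp: e_def scaleR_add_left)
    also have "\<dots> = lincomb c g I \<tau> x + t *\<^sub>R lincomb d g I \<tau> x"
      by (simp add: lincomb_def sum.distrib scaleR_sum_right)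
    finally show "?e \<tau> x = v' \<tau> x + t *\<^sub>R g' \<tau> x"
      using insert.hyps by (simp add: lincomb_insert v'_def g'_def e_def algebra_simps)
  qed
  have oI: "B (\<lambda>\<tau> x. v' \<tau> x + t *\<^sub>R g' \<tau> x) (g j) = 0" if "j \<in> I" for j
    using lin[OF V' gI[OF that], of t] c[OF that] d[OF that] by (simp add: v'_def g'_def)
  have "B (\<lambda>\<tau> x. v' \<tau> x + t *\<^sub>R g' \<tau> x) g' = 0"
    using lin[OF V' V'(2), of t] tg by simp
  moreover have "B (\<lambda>\<tau> x. v' \<tau> x + t *\<^sub>R g' \<tau> x) g'
     = B (\<lambda>\<tau> x. v' \<tau> x + t *\<^sub>R g' \<tau> x) (g i) + B (\<lambda>\<tau> x. v' \<tau> x + t *\<^sub>R g' \<tau> x) (lincomb d g I)"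
    using lin_right[OF gi inV(2) V_add[OF V', of t], of 1] by (simp add: g'_def)
  moreover have "B (\<lambda>\<tau> x. v' \<tau> x + t *\<^sub>R g' \<tau> x) (lincomb d g I) = 0"
    using lincomb_right[OF insert.hyps(1) gI V_add[OF V', of t]] oI by simp
  ultimately have "B (\<lambda>\<tau> x. v' \<tau> x + t *\<^sub>R g' \<tau> x) (g i) = 0" by simp
  then have "\<forall>j\<in>insert i I. B (\<lambda>\<tau> x. v \<tau> x + lincomb e g (insert i I) \<tau> x) (g j) = 0"
    unfolding eq using oI by auto
  then show ?case by blast
qed simp

text \<open>Hence the form attains its minimum on every affine space spanned by finitely many fields.\<close>

lemma minimiser_exists:
  assumes "finite I" "\<And>i. i \<in> I \<Longrightarrow> g i \<in> V" "v \<in> V"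
  shows "\<exists>c. \<forall>d. B (\<lambda>\<tau> x. v \<tau> x + lincomb c g I \<tau> x) (\<lambda>\<tau> x. v \<tau> x + lincomb c g I \<tau> x)
              \<le> B (\<lambda>\<tau> x. v \<tau> x + lincomb d g I \<tau> x) (\<lambda>\<tau> x. v \<tau> x + lincomb d g I \<tau> x)"
proof -
  obtain c where c: "\<And>j. j \<in> I \<Longrightarrow> B (\<lambda>\<tau> x. v \<tau> x + lincomb c g I \<tau> x) (g j) = 0"
    using projection_exists[of I g v, OF assms] by blast
  let ?u = "\<lambda>\<tau> x. v \<tau> x + lincomb c g I \<tau> x"
  have "lincomb c g I \<in> V" using assms by (intro lincomb_in) auto
  from V_add[OF assms(3) this, of 1] have u: "?u \<in> V" by simp
  have "B ?u ?u \<le> B (\<lambda>\<tau> x. v \<tau> x + lincomb d g I \<tau> x) (\<lambda>\<tau> x. v \<tau> x + lincomb d g I \<tau> x)" for d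
  proof -
    let ?w = "lincomb (\<lambda>j. d j - c j) g I"
    have w: "?w \<in> V" using assms by (intro lincomb_in) auto
    have eq: "(\<lambda>\<tau> x. v \<tau> x + lincomb d g I \<tau> x) = (\<lambda>\<tau> x. ?u \<tau> x + 1 *\<^sub>R ?w \<tau> x)"
      by (intro ext) (simp add: lincomb_def scaleR_diff_left sum_subtractf)
    have "B ?u ?w = 0" using lincomb_right[OF assms(1,2) u] c by simp
    then show ?thesis
      unfolding eq square_add[OF u w, of 1] using nonneg[OF w] by simp
  qed
  then show ?thesis by blast
qed

end

text \<open>The spectral estimate.  The eigenvalue problem is \<open>B (T v) (T w) = \<lambda> S v w\<close>, where \<open>T\<close> need not be
  linear: Bessel's inequality for the fields \<open>T (\<phi> k)\<close> suffices.\<close>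

lemma spectral_tail:
  fixes J l :: nat
  assumes B: "psd V B" and S: "psd V S"
    and \<phi>: "\<And>k. k \<in> {1..J} \<Longrightarrow> \<phi> k \<in> V" and T\<phi>: "\<And>k. k \<in> {1..J} \<Longrightarrow> T (\<phi> k) \<in> V"
    and v: "v = lincomb c \<phi> {1..J}" and Tv: "T v \<in> V"
    and eig: "\<And>k. k \<in> {1..J} \<Longrightarrow> B (T v) (T (\<phi> k)) = lam k * S v (\<phi> k)"
      "\<And>k. k \<in> {1..J} \<Longrightarrow> B (T (\<phi> k)) (T (\<phi> k)) = lam k * S (\<phi> k) (\<phi> k)"
    and orth: "\<And>k m. k \<in> {1..J} \<Longrightarrow> m \<in> {1..J} \<Longrightarrow> k \<noteq> m \<Longrightarrow> B (T (\<phi> k)) (T (\<phi> m)) = 0 \<and> S (\<phi> k) (\<phi> m) = 0"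
    and mono: "mono_on {1..J} lam" and l: "l < J"
  defines "r \<equiv> lincomb c \<phi> {l + 1..J}"
  shows "lam (l + 1) * S r r \<le> B (T v) (T v)"
proof -
  interpret B: psd V B by (rule B)
  interpret S: psd V S by (rule S)
  have S_r: "S r r = (\<Sum>k\<in>{l + 1..J}. (c k)\<^sup>2 * S (\<phi> k) (\<phi> k))"
    unfolding r_def using \<phi> orth by (intro S.lincomb_orthogonal(2)) auto
  have Sv: "S v (\<phi> k) = c k * S (\<phi> k) (\<phi> k)" if "k \<in> {1..J}" for k
    unfolding v using \<phi> orth that by (intro S.lincomb_orthogonal(1)) auto
  have "lam (l + 1) * S r r = (\<Sum>k\<in>{l + 1..J}. (c k)\<^sup>2 * (lam (l + 1) * S (\<phi> k) (\<phi> k)))"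
    unfolding S_r by (simp add: sum_distrib_left mult.left_commute)
  also have "\<dots> \<le> (\<Sum>k\<in>{l + 1..J}. (c k)\<^sup>2 * B (T (\<phi> k)) (T (\<phi> k)))"
  proof (intro sum_mono mult_left_mono)
    fix k assume k: "k \<in> {l + 1..J}"
    then have "lam (l + 1) \<le> lam k" using l by (intro mono_onD[OF mono]) auto
    then show "lam (l + 1) * S (\<phi> k) (\<phi> k) \<le> B (T (\<phi> k)) (T (\<phi> k))"
      using k \<phi> by (subst eig(2)) (auto intro!: mult_right_mono S.nonneg)
  qed auto
  also have "\<dots> \<le> B (T v) (T v)"
    using \<phi> T\<phi> orth Tv by (intro B.bessel) (auto simp: eig Sv)
  finally show ?thesis .
qed

text \<open>On the span of an orthogonal basis every linear functional is bounded by its dual norm.  The orthogonal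
  expansion shows that the supremum defining the dual norm is taken over a bounded set.\<close>

lemma dual_norm_bound:
  assumes S: "psd V S" and \<phi>: "\<And>k. k \<in> {1..J::nat} \<Longrightarrow> \<phi> k \<in> V"
    and orth: "\<And>k m. k \<in> {1..J} \<Longrightarrow> m \<in> {1..J} \<Longrightarrow> k \<noteq> m \<Longrightarrow> S (\<phi> k) (\<phi> m) = 0"
    and pos: "\<And>k. k \<in> {1..J} \<Longrightarrow> S (\<phi> k) (\<phi> k) > 0"
    and R: "\<And>c. R (lincomb c \<phi> {1..J}) = (\<Sum>k\<in>{1..J}. c k * R (\<phi> k))"
    and W: "W = fspan \<phi> {1..J}" and nv: "\<And>v. v \<in> W \<Longrightarrow> nv v = sqrt (h * S v v)" and h: "h > 0"
    and v: "v \<in> W"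
  shows "\<bar>R v\<bar> \<le> dual_norm W nv R * nv v"
proof -
  interpret S: psd V S by (rule S)
  define M where "M = (\<Sum>k\<in>{1..J}. \<bar>R (\<phi> k)\<bar> / sqrt (h * S (\<phi> k) (\<phi> k)))"
  have M: "\<bar>R u\<bar> \<le> nv u * M" if u: "u \<in> W" for u
  proof -
    obtain c where c: "u = lincomb c \<phi> {1..J}" using u by (auto simp: W fspan_def)
    have Su: "S u u = (\<Sum>k\<in>{1..J}. (c k)\<^sup>2 * S (\<phi> k) (\<phi> k))"
      unfolding c using \<phi> orth by (intro S.lincomb_orthogonal(2)) auto
    have "\<bar>R u\<bar> \<le> (\<Sum>k\<in>{1..J}. \<bar>c k\<bar> * \<bar>R (\<phi> k)\<bar>)"
      unfolding c R by (rule order_trans[OF sum_abs]) (simp add: abs_mult)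
    also have "\<dots> \<le> (\<Sum>k\<in>{1..J}. nv u * (\<bar>R (\<phi> k)\<bar> / sqrt (h * S (\<phi> k) (\<phi> k))))"
    proof (rule sum_mono)
      fix k assume k: "k \<in> {1..J}"
      have "(c k)\<^sup>2 * S (\<phi> k) (\<phi> k) \<le> S u u"
        unfolding Su using k \<phi> by (intro member_le_sum) (auto intro!: mult_nonneg_nonneg S.nonneg)
      then have "(c k)\<^sup>2 * (h * S (\<phi> k) (\<phi> k)) \<le> h * S u u"
        using mult_left_mono[of "(c k)\<^sup>2 * S (\<phi> k) (\<phi> k)" "S u u" h] h by (simp add: algebra_simps)
      then have "sqrt ((c k)\<^sup>2 * (h * S (\<phi> k) (\<phi> k))) \<le> nv u"
        unfolding nv[OF u] by (rule real_sqrt_le_mono)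
      then have "\<bar>c k\<bar> * sqrt (h * S (\<phi> k) (\<phi> k)) \<le> nv u"
        by (simp add: real_sqrt_mult)
      moreover have p: "sqrt (h * S (\<phi> k) (\<phi> k)) > 0" using pos[OF k] h by simp
      ultimately have "\<bar>c k\<bar> \<le> nv u / sqrt (h * S (\<phi> k) (\<phi> k))" by (simp add: pos_le_divide_eq)
      from mult_right_mono[OF this, of "\<bar>R (\<phi> k)\<bar>"]
      show "\<bar>c k\<bar> * \<bar>R (\<phi> k)\<bar> \<le> nv u * (\<bar>R (\<phi> k)\<bar> / sqrt (h * S (\<phi> k) (\<phi> k)))" by simp
    qed
    also have "\<dots> = nv u * M" by (simp add: M_def sum_distrib_left)
    finally show ?thesis .
  qed
  have WV: "u \<in> V" if "u \<in> W" for u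
    using that \<phi> by (auto simp: W fspan_def intro!: S.lincomb_in)
  have nv0: "nv u \<ge> 0" if "u \<in> W" for u using nv[OF that] h S.nonneg[OF WV[OF that]] by simp
  have M0: "M \<ge> 0" unfolding M_def using pos h by (intro sum_nonneg divide_nonneg_nonneg) (auto intro: less_imp_le)
  show ?thesis
  proof (cases "nv v = 0")
    case True then show ?thesis using M[OF v] by simp
  next
    case False
    then have nvp: "nv v > 0" using nv0[OF v] by simp
    have v0: "v \<noteq> (\<lambda>\<tau> x. 0)" using False nv[OF v] S.zero_left[OF S.V_zero] by auto
    have "\<bar>R v\<bar> / nv v \<le> dual_norm W nv R"
      unfolding dual_norm_def
    proof (rule cSUP_upper)
      show "v \<in> W - {\<lambda>\<tau> x. 0}" using v v0 by simp
      show "bdd_above ((\<lambda>v. \<bar>R v\<bar> / nv v) ` (W - {\<lambda>\<tau> x. 0}))"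
      proof (rule bdd_aboveI2)
        fix u assume "u \<in> W - {\<lambda>\<tau> x. 0}"
        then have u: "u \<in> W" by simp
        show "\<bar>R u\<bar> / nv u \<le> M"
        proof (cases "nv u = 0")
          case False then show ?thesis using M[OF u] nv0[OF u] by (simp add: divide_le_eq mult.commute)
        qed (simp add: M0)
      qed
    qed
    then show ?thesis using nvp by (simp add: divide_le_eq)
  qed
qed

lemma weighted_cauchy_schwarz:
  fixes x :: real
  assumes "0 \<le> x" "0 \<le> C" "x \<le> (\<Sum>i\<in>I. \<bar>D i\<bar> * m i)" "\<And>i. i \<in> I \<Longrightarrow> 0 \<le> m i"
    "\<And>i. i \<in> I \<Longrightarrow> (m i)\<^sup>2 \<le> g i * A i" "\<And>i. i \<in> I \<Longrightarrow> 0 \<le> g i" "\<And>i. i \<in> I \<Longrightarrow> 0 \<le> A i"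
    "(\<Sum>i\<in>I. A i) \<le> C * x"
  shows "x \<le> C * (\<Sum>i\<in>I. (D i)\<^sup>2 * g i)"
proof (cases "x = 0")
  case True
  have "(\<Sum>i\<in>I. (D i)\<^sup>2 * g i) \<ge> 0" using assms(6) by (intro sum_nonneg) auto
  then show ?thesis using True assms(2) by simp
next
  case False
  then have xp: "x > 0" using assms(1) by simp
  have "m i \<le> sqrt (g i) * sqrt (A i)" if "i \<in> I" for i
    using real_le_rsqrt[OF assms(5)[OF that]] by (simp add: real_sqrt_mult)
  then have "(\<Sum>i\<in>I. \<bar>D i\<bar> * m i) \<le> (\<Sum>i\<in>I. (\<bar>D i\<bar> * sqrt (g i)) * sqrt (A i))"
    by (intro sum_mono) (simp add: mult.assoc mult_left_mono)
  with assms(3) have "x \<le> (\<Sum>i\<in>I. (\<bar>D i\<bar> * sqrt (g i)) * sqrt (A i))" by simp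
  then have "x\<^sup>2 \<le> (\<Sum>i\<in>I. (\<bar>D i\<bar> * sqrt (g i)) * sqrt (A i))\<^sup>2"
    using assms(1) by (intro power_mono)
  also have "\<dots> \<le> (\<Sum>i\<in>I. (\<bar>D i\<bar> * sqrt (g i))\<^sup>2) * (\<Sum>i\<in>I. (sqrt (A i))\<^sup>2)"
    by (rule Cauchy_Schwarz_ineq_sum)
  also have "\<dots> = (\<Sum>i\<in>I. (D i)\<^sup>2 * g i) * (\<Sum>i\<in>I. A i)"
    using assms(6,7) by (simp add: power_mult_distrib cong: sum.cong)
  also have "\<dots> \<le> (\<Sum>i\<in>I. (D i)\<^sup>2 * g i) * (C * x)"
    using assms(6,8) by (intro mult_left_mono sum_nonneg) auto
  finally have "x * x \<le> (C * (\<Sum>i\<in>I. (D i)\<^sup>2 * g i)) * x" by (simp add: power2_eq_square mult_ac)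
  then show ?thesis using xp by simp
qed

section \<open>Integrals of finite element fields\<close>

text \<open>The energy, the divergence form and the face form are finite sums of integrals of integrands that are
  bilinear in the two fields.\<close>

lemma psd_integral_sum:
  assumes V: "(\<lambda>\<tau> x. 0) \<in> V" "\<And>u v c. u \<in> V \<Longrightarrow> v \<in> V \<Longrightarrow> (\<lambda>\<tau> x. u \<tau> x + c *\<^sub>R v \<tau> x) \<in> V"
    and int: "\<And>i u w. i \<in> I \<Longrightarrow> u \<in> V \<Longrightarrow> w \<in> V \<Longrightarrow> set_integrable (M i) (A i) (b i u w)"
    and bsym: "\<And>i u w x. i \<in> I \<Longrightarrow> u \<in> V \<Longrightarrow> w \<in> V \<Longrightarrow> b i u w x = b i w u x"
    and blin: "\<And>i u v w c x. i \<in> I \<Longrightarrow> u \<in> V \<Longrightarrow> v \<in> V \<Longrightarrow> w \<in> V \<Longrightarrow>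
        b i (\<lambda>\<tau> x. u \<tau> x + c *\<^sub>R v \<tau> x) w x = b i u w x + c * b i v w x"
    and bpos: "\<And>i u x. i \<in> I \<Longrightarrow> u \<in> V \<Longrightarrow> x \<in> A i \<Longrightarrow> 0 \<le> b i u u x"
  shows "psd V (\<lambda>u w. \<Sum>i\<in>I. LINT x:A i|M i. (b i u w x :: real))"
proof
  fix u v w :: "'a vfield" and c :: real
  assume uvw: "u \<in> V" "v \<in> V" "w \<in> V"
  have "(LINT x:A i|M i. b i (\<lambda>\<tau> x. u \<tau> x + c *\<^sub>R v \<tau> x) w x)
      = (LINT x:A i|M i. b i u w x) + c * (LINT x:A i|M i. b i v w x)" if i: "i \<in> I" for i
  proof -
    have "(LINT x:A i|M i. b i (\<lambda>\<tau> x. u \<tau> x + c *\<^sub>R v \<tau> x) w x)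
       = (LINT x:A i|M i. b i u w x + c * b i v w x)"
      using blin[OF i uvw] by simp
    also have "\<dots> = (LINT x:A i|M i. b i u w x) + (LINT x:A i|M i. c * b i v w x)"
      using int[OF i] uvw by (intro set_integral_add(2)) auto
    finally show ?thesis by simp
  qed
  then show "(\<Sum>i\<in>I. LINT x:A i|M i. b i (\<lambda>\<tau> x. u \<tau> x + c *\<^sub>R v \<tau> x) w x)
      = (\<Sum>i\<in>I. LINT x:A i|M i. b i u w x) + c * (\<Sum>i\<in>I. LINT x:A i|M i. b i v w x)"
    by (simp add: sum.distrib sum_distrib_left)
next
  fix u v :: "'a vfield" assume uv: "u \<in> V" "v \<in> V"
  then show "(\<Sum>i\<in>I. LINT x:A i|M i. b i u v x) = (\<Sum>i\<in>I. LINT x:A i|M i. b i v u x)"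
    using bsym[OF _ uv] by simp
next
  fix u :: "'a vfield" assume u: "u \<in> V"
  show "0 \<le> (\<Sum>i\<in>I. LINT x:A i|M i. b i u u x)"
    unfolding set_lebesgue_integral_def
    by (intro sum_nonneg integral_nonneg_AE) (auto simp: indicator_def bpos u)
qed (use V in auto)

lemma psd_add:
  assumes "psd V A" "psd V B"
  shows "psd V (\<lambda>u v. A u v + B u v)"
proof -
  interpret A: psd V A by (rule assms(1))
  interpret B: psd V B by (rule assms(2))
  show ?thesis
  proof
    fix u v assume "u \<in> V" "v \<in> V"
    then show "A u v + B u v = A v u + B v u" using A.sym B.sym by metis
  qed (auto simp: A.V_zero A.V_add A.lin B.lin A.nonneg B.nonneg algebra_simps)
qed

lemma psd_divide:
  assumes "psd V A" "h > 0"
  shows "psd V (\<lambda>u v. A u v / h)"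
proof -
  interpret A: psd V A by (rule assms(1))
  show ?thesis
  proof
    fix u v assume "u \<in> V" "v \<in> V"
    then show "A u v / h = A v u / h" using A.sym by metis
  qed (use assms(2) in \<open>auto simp: A.V_zero A.V_add A.lin A.nonneg add_divide_distrib\<close>)
qed

lemma polys_differentiable:
  assumes "q \<in> polys k"
  shows "q differentiable (at x)"
proof -
  have p: "(\<lambda>x. \<Prod>b\<in>B. (x \<bullet> b) ^ m b) differentiable (at x)" if "finite B" for B :: "'a set" and m :: "'a \<Rightarrow> nat"
    using that
  proof (induction B rule: finite_induct)
    case (insert b B)
    have "(\<lambda>x. x \<bullet> b) differentiable (at x)"
      unfolding differentiable_def
      by (intro exI) (rule bounded_linear_imp_has_derivative[OF bounded_linear_inner_left])
    then have "(\<lambda>x. (x \<bullet> b) ^ m b) differentiable (at x)" by (rule differentiable_power)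
    then show ?case using insert by (simp add: differentiable_mult)
  qed simp
  obtain c where q: "q = (\<lambda>x. \<Sum>m\<in>{m \<in> Basis \<rightarrow>\<^sub>E {..k}. sum m Basis \<le> k}. c m * (\<Prod>b\<in>Basis. (x \<bullet> b) ^ m b))"
    using assms by (auto simp: polys_def)
  show ?thesis
    unfolding q by (intro differentiable_sum differentiable_mult differentiable_const p ballI)
      (auto intro: finite_subset[OF _ finite_PiE[of Basis "\<lambda>_. {..k}"]])
qed

lemma polys_continuous:
  assumes "q \<in> polys k"
  shows "continuous_on S q"
  by (intro continuous_at_imp_continuous_on ballI differentiable_imp_continuous_within
      polys_differentiable[OF assms])

lemma set_integrable_bounded:
  assumes "A \<in> sets M" "emeasure M A < \<infinity>" "h \<in> borel_measurable M" "\<And>x. x \<in> A \<Longrightarrow> \<bar>h x\<bar> \<le> B"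
  shows "set_integrable M A (h :: _ \<Rightarrow> real)"
  unfolding set_integrable_def
  using assms by (intro integrableI_bounded_set_indicator[of _ _ _ B]) auto

lemma open_AE_empty:
  fixes U :: "'a::euclidean_space set"
  assumes "open U" "AE x in lborel. x \<notin> U"
  shows "U = {}"
proof -
  have "U \<in> null_sets lborel"
    using assms by (simp add: AE_iff_null_sets)
  then have "negligible U"
    using assms(1) by (simp add: negligible_iff_null_sets null_sets_completion_iff)
  then show ?thesis using open_not_negligible[OF assms(1)] by blast
qed

section \<open>The measure of a face\<close>

lemma sets_hyperplane_measure [simp, measurable_cong]: "sets (hyperplane_measure a n) = sets borel"
  by (simp add: hyperplane_measure_def)

lemma interior_slab:
  fixes n :: "'a::euclidean_space"
  assumes n: "norm n = 1" "f \<subseteq> {x. n \<bullet> x = b}" and x: "x \<in> interior (slab f n S)"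
  shows "x - (n \<bullet> x - b) *\<^sub>R n \<in> rel_interior f"
proof -
  let ?u = "n \<bullet> x - b"
  let ?y = "x - ?u *\<^sub>R n"
  have nn: "n \<bullet> n = 1" using n(1) by (simp add: dot_square_norm)
  obtain e where e: "e > 0" "ball x e \<subseteq> slab f n S" using x by (auto simp: mem_interior)
  have hull: "affine hull f \<subseteq> {x. n \<bullet> x = b}" using n(2) affine_hyperplane by (intro hull_minimal) auto
  have "y' \<in> f" if y': "y' \<in> ball ?y e" "y' \<in> affine hull f" for y'
  proof -
    have "dist x (y' + ?u *\<^sub>R n) = dist ?y y'" by (simp add: dist_norm algebra_simps)
    then have "y' + ?u *\<^sub>R n \<in> slab f n S" using y'(1) e(2) by auto
    moreover have "n \<bullet> (y' + ?u *\<^sub>R n) - b = ?u" using y'(2) hull by (auto simp: inner_add_right nn)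
    ultimately show ?thesis unfolding slab_alt[OF n] by simp
  qed
  moreover have "?y \<in> f" using x interior_subset[of "slab f n S"] unfolding slab_alt[OF n] by blast
  ultimately show ?thesis using e(1) by (auto simp: mem_rel_interior_ball)
qed

lemma convex_slab:
  assumes "convex f" "convex S"
  shows "convex (slab f n S)"
proof -
  have "slab f n S = (\<lambda>p. fst p + snd p *\<^sub>R n) ` (f \<times> S)" by (force simp: slab_def)
  moreover have "linear (\<lambda>p. fst p + snd p *\<^sub>R n)"
    by (auto intro!: linearI simp: scaleR_add_left scaleR_add_right)
  ultimately show ?thesis using assms by (simp add: convex_linear_image convex_Times)
qed

text \<open>The relative boundary of a face is a null set because the prism over it lies in the frontier of a convex
  set.\<close>

lemma rel_frontier_null:
  fixes n :: "'a::euclidean_space"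
  assumes n: "norm n = 1" "f \<subseteq> {x. n \<bullet> x = n \<bullet> a}" and f: "compact f" "convex f"
  shows "AE x in hyperplane_measure a n. x \<in> f \<longrightarrow> x \<in> rel_interior f"
proof -
  let ?N = "rel_frontier f"
  have Nf: "?N \<subseteq> f" using f(1) by (auto simp: rel_frontier_def compact_imp_closed)
  have Nb: "?N \<in> sets borel" by (simp add: borel_closed)
  have "slab ?N n {0..1} \<subseteq> frontier (slab f n {0..1})"
  proof
    fix x assume x: "x \<in> slab ?N n {0..1}"
    then have "x \<in> slab f n {0..1}" using Nf by (auto simp: slab_def)
    moreover have "x \<notin> interior (slab f n {0..1})"
    proof
      assume "x \<in> interior (slab f n {0..1})"
      from interior_slab[OF n this] x Nf n show False
        by (subst (asm) slab_alt) (auto simp: rel_frontier_def)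
    qed
    ultimately show "x \<in> frontier (slab f n {0..1})"
      using closure_subset by (auto simp: frontier_def)
  qed
  moreover have "negligible (frontier (slab f n {0..1}))"
    using f by (intro negligible_convex_frontier convex_slab) auto
  ultimately have "negligible (slab ?N n {0..1})" by (rule negligible_subset[rotated])
  moreover have "slab ?N n {0..1} \<in> sets borel"
    using n Nf Nb by (intro slab_measurable) auto
  ultimately have "emeasure lborel (slab ?N n {0..1}) = 0"
    by (simp add: negligible_iff_null_sets null_sets_completion_iff null_setsD1)
  then have "emeasure (hyperplane_measure a n) ?N = 0"
    using n Nf Nb by (subst emeasure_hyperplane_measure) auto
  then have "?N \<in> null_sets (hyperplane_measure a n)" using Nb by (auto intro: null_setsI)
  then show ?thesis
    by (rule AE_I'[rotated 0]) (use f(1) in \<open>auto simp: rel_frontier_def compact_imp_closed\<close>)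
qed

lemma slab_measure_pos:
  fixes n :: "'a::euclidean_space"
  assumes n: "norm n = 1" "f \<subseteq> {x. n \<bullet> x = b}" and f: "convex f" "f \<noteq> {}" "compact f" "aff_dim f = int DIM('a) - 1"
  shows "area f n > 0"
proof -
  have nn: "n \<bullet> n = 1" using n(1) by (simp add: dot_square_norm)
  have hull: "affine hull f = {x. n \<bullet> x = b}" using n by (intro facet_affine_hull f) auto
  obtain y where y: "y \<in> rel_interior f" using f rel_interior_eq_empty by blast
  obtain e where e: "e > 0" "ball y e \<inter> affine hull f \<subseteq> f" using y by (auto simp: mem_rel_interior_ball)
  have ny: "n \<bullet> y = b" using y rel_interior_subset n(2) by blast
  let ?x = "y + (1/2) *\<^sub>R n"
  have sub: "ball ?x (min e (1/2)) \<subseteq> slab f n {0..1}"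
  proof
    fix x assume x: "x \<in> ball ?x (min e (1/2))"
    define v where "v = x - ?x"
    have v: "norm v < e" "norm v < 1/2" using x by (auto simp: v_def dist_norm norm_minus_commute)
    have xv: "x = y + (1/2) *\<^sub>R n + v" by (simp add: v_def)
    have nx: "n \<bullet> x - b = 1/2 + n \<bullet> v" by (simp add: xv inner_add_right nn ny)
    have "\<bar>n \<bullet> v\<bar> \<le> norm v" using Cauchy_Schwarz_ineq2[of n v] n(1) by simp
    then have 1: "n \<bullet> x - b \<in> {0..1}" using v(2) by (auto simp: nx)
    have 2: "x - (n \<bullet> x - b) *\<^sub>R n = y + (v - (n \<bullet> v) *\<^sub>R n)"
      unfolding nx by (simp add: xv algebra_simps)
    have "(norm (v - (n \<bullet> v) *\<^sub>R n))\<^sup>2 = (norm v)\<^sup>2 - (n \<bullet> v)\<^sup>2"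
      unfolding power2_norm_eq_inner
      by (simp add: inner_diff_left inner_diff_right nn power2_eq_square inner_commute algebra_simps)
    then have "(norm (v - (n \<bullet> v) *\<^sub>R n))\<^sup>2 \<le> (norm v)\<^sup>2" by simp
    then have "norm (v - (n \<bullet> v) *\<^sub>R n) \<le> norm v" by (rule power2_le_imp_le) simp
    then have "y + (v - (n \<bullet> v) *\<^sub>R n) \<in> ball y e" using v(1) by (simp add: dist_norm norm_minus_commute)
    moreover have "y + (v - (n \<bullet> v) *\<^sub>R n) \<in> affine hull f"
      unfolding hull by (simp add: inner_add_right inner_diff_right nn ny)
    ultimately show "x \<in> slab f n {0..1}" using 1 2 e(2) unfolding slab_alt[OF n] by auto
  qed
  have fm: "slab f n {0..1} \<in> fmeasurable lborel"
    using f n by (intro slab_fmeasurable) (auto intro: borel_compact compact_imp_bounded)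
  have "measure lborel (ball ?x (min e (1/2))) \<le> area f n"
    using fm by (intro measure_mono_fmeasurable[OF sub]) auto
  moreover have "measure lborel (ball ?x (min e (1/2))) > 0"
    using content_ball_pos[of "min e (1/2)" ?x] e(1) by simp
  ultimately show ?thesis by linarith
qed

lemma face_int_le:
  fixes n :: "'a::euclidean_space"
  assumes n: "norm n = 1" "\<And>x y. x \<in> f \<Longrightarrow> y \<in> f \<Longrightarrow> n \<bullet> (x - y) = 0"
    and f: "convex f" "f \<noteq> {}" "compact f" "aff_dim f = int DIM('a) - 1"
    and h: "h \<in> borel_measurable borel" "\<And>x. x \<in> f \<Longrightarrow> \<bar>h x\<bar> \<le> B"
  shows "set_integrable (hyperplane_measure (SOME a. a \<in> f) n) f h"
    and "(\<And>x. x \<in> rel_interior f \<Longrightarrow> h x * area f n \<le> K) \<Longrightarrow> face_int f n h \<le> K"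
    and "(\<And>x. x \<in> f \<Longrightarrow> c \<le> h x) \<Longrightarrow> c * area f n \<le> face_int f n h"
proof -
  define a where "a = (SOME a. a \<in> f)"
  define M where "M = hyperplane_measure a n"
  define m where "m = area f n"
  have a: "a \<in> f" unfolding a_def using f(2) by (simp add: some_in_eq)
  have fa: "f \<subseteq> {x. n \<bullet> x = n \<bullet> a}" using n(2)[OF _ a] by (auto simp: inner_diff_right)
  have fb: "f \<in> sets borel" using f by (auto intro: borel_compact)
  have mp: "m > 0" unfolding m_def using n fa f by (intro slab_measure_pos) auto
  have em: "emeasure M f = emeasure lborel (slab f n {0..1})"
    unfolding M_def by (rule emeasure_hyperplane_measure[OF n(1) fa fb])
  have "emeasure lborel (slab f n {0..1}) < \<infinity>"
    using f by (intro emeasure_bounded_finite slab_bounded compact_imp_bounded) auto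
  then have fin: "emeasure M f < \<infinity>" by (simp add: em)
  have mM: "measure M f = m" by (simp add: measure_def em m_def)
  have fM: "f \<in> sets M" using fb by (simp add: M_def)
  show int: "set_integrable (hyperplane_measure (SOME a. a \<in> f) n) f h"
    unfolding a_def[symmetric] M_def[symmetric]
    by (rule set_integrable_bounded[OF fM fin _ h(2)]) (use h(1) in \<open>simp add: M_def measurable_def\<close>)
  have intc: "set_integrable M f (\<lambda>x. c)" for c :: real
    by (rule set_integrable_bounded[OF fM fin, of _ "\<bar>c\<bar>"]) auto
  have c: "(LINT x:f|M. c) = c * m" for c :: real
    using fM fin mM by (simp add: set_lebesgue_integral_def)
  {
    assume le: "\<And>x. x \<in> rel_interior f \<Longrightarrow> h x * area f n \<le> K"
    have "(LINT x:f|M. h x) \<le> (LINT x:f|M. K / m)"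
    proof (rule set_integral_mono_AE)
      show "set_integrable M f h" using int unfolding a_def M_def .
      show "set_integrable M f (\<lambda>x. K / m)" by (rule intc)
      show "AE x\<in>f in M. h x \<le> K / m"
        using rel_frontier_null[OF n(1) fa f(3,1)] unfolding M_def
        by eventually_elim (use le mp in \<open>auto simp: m_def pos_le_divide_eq\<close>)
    qed
    then show "face_int f n h \<le> K" unfolding c using mp by (simp add: face_int_def a_def[symmetric] M_def)
  }
  {
    assume le: "\<And>x. x \<in> f \<Longrightarrow> c \<le> h x"
    have "(LINT x:f|M. c) \<le> (LINT x:f|M. h x)"
      by (rule set_integral_mono[OF intc _ le]) (use int in \<open>simp_all add: a_def M_def\<close>)
    then show "c * area f n \<le> face_int f n h"
      unfolding c by (simp add: face_int_def a_def[symmetric] M_def m_def)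
  }
qed

section \<open>Fields\<close>

text \<open>Discretisation data satisfying the standing assumptions.\<close>

locale gms =
  fixes G :: "'a::euclidean_space gmsfem"
  assumes ok: "gmsfem_ok G"
begin

lemma mesh:
  "is_mesh (coarse_mesh G)" "is_mesh (fine_mesh G)" "\<forall>\<tau>\<in>fine_mesh G. \<exists>K\<in>coarse_mesh G. \<tau> \<subseteq> K"
  "\<forall>E\<in>coarse_faces G. norm (nrm G E) = 1 \<and> (\<forall>x\<in>E. \<forall>y\<in>E. nrm G E \<bullet> (x - y) = 0)"
  using ok unfolding gmsfem_ok_def mesh_ok_def by - (elim conjE, assumption)+

lemmas cmesh = mesh(1) and fmesh = mesh(2)

lemma fin_fine: "finite (fine_mesh G)" and fin_coarse: "finite (coarse_mesh G)"
  using cmesh fmesh by (auto simp: is_mesh_def)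

lemma finite_mesh_faces: "is_mesh M \<Longrightarrow> finite (mesh_faces M)"
proof -
  assume M: "is_mesh M"
  have "mesh_faces M = (\<Union>K\<in>M. {F. F facet_of K})" by (auto simp: mesh_faces_def)
  moreover have "finite {F. F facet_of K}" if "K \<in> M" for K
    using mesh_cell(1)[OF M that] by (simp add: finite_polytope_facets)
  ultimately show ?thesis using M by (auto simp: is_mesh_def)
qed

lemma fin_faces: "finite (coarse_faces G)" and fin_fine_in: "finite (fine_in G E)"
  using finite_mesh_faces[OF cmesh] finite_mesh_faces[OF fmesh] by (auto simp: coarse_faces_def fine_in_def)

lemma fine_cell_in:
  assumes "\<tau> \<in> fine_mesh G"
  obtains K where "K \<in> coarse_mesh G" "\<tau> \<subseteq> K"
  using mesh(3) assms by blast

lemma fine_cdom: "\<tau> \<in> fine_mesh G \<Longrightarrow> \<tau> \<subseteq> cdom G"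
  using fine_cell_in unfolding cdom_def by (metis Sup_upper order_trans)

text \<open>The piecewise polynomial fields of the fine-grid element, without any continuity across fine faces.\<close>

definition fields :: "'a vfield set" where
  "fields = {v. \<forall>\<tau>\<in>fine_mesh G. v \<tau> \<in> Vloc G \<tau>}"

lemma fe:
  assumes "\<tau> \<in> fine_mesh G"
  shows "lin_subspace (Vloc G \<tau>)" "\<And>u b. u \<in> Vloc G \<tau> \<Longrightarrow> b \<in> Basis \<Longrightarrow> (\<lambda>x. u x \<bullet> b) \<in> polys (degr G)"
    "\<And>u. u \<in> Vloc G \<tau> \<Longrightarrow> divg u \<in> polys (degr G)"
proof -
  have *: "lin_subspace (Vloc G \<tau>) \<and> (\<forall>u\<in>Vloc G \<tau>. \<forall>b\<in>Basis. (\<lambda>x. u x \<bullet> b) \<in> polys (degr G)) \<and>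
     lin_subspace (Qloc G \<tau>) \<and> Qloc G \<tau> \<subseteq> polys (degr G) \<and>
     (\<lambda>x. 1) \<in> Qloc G \<tau> \<and> divg ` Vloc G \<tau> = Qloc G \<tau>"
    using ok assms unfolding gmsfem_ok_def fe_ok_def by (elim conjE) (rule bspec)
  show "lin_subspace (Vloc G \<tau>)" using * by (elim conjE)
  show "(\<lambda>x. u x \<bullet> b) \<in> polys (degr G)" if "u \<in> Vloc G \<tau>" "b \<in> Basis" for u b
    using * that by (elim conjE) (drule (1) bspec, drule (1) bspec)
  show "divg u \<in> polys (degr G)" if "u \<in> Vloc G \<tau>" for u
  proof -
    have "divg u \<in> divg ` Vloc G \<tau>" using that by (rule imageI)
    then show ?thesis using * by (elim conjE) (simp only: subset_iff)
  qed
qed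

lemma Vloc_differentiable:
  assumes "\<tau> \<in> fine_mesh G" "u \<in> Vloc G \<tau>"
  shows "u differentiable (at x)"
  by (rule iffD2[OF differentiable_componentwise_within])
    (intro ballI polys_differentiable[OF fe(2)[OF assms]])

lemma Vloc_continuous: "\<tau> \<in> fine_mesh G \<Longrightarrow> u \<in> Vloc G \<tau> \<Longrightarrow> continuous_on S u"
  by (intro continuous_at_imp_continuous_on ballI differentiable_imp_continuous_within
      Vloc_differentiable)

lemma divg_add:
  assumes "\<tau> \<in> fine_mesh G" "u \<in> Vloc G \<tau>" "v \<in> Vloc G \<tau>"
  shows "divg (\<lambda>x. u x + c *\<^sub>R v x) x = divg u x + c * divg v x"
proof -
  have "(u has_derivative frechet_derivative u (at x)) (at x)" "(v has_derivative frechet_derivative v (at x)) (at x)"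
    using Vloc_differentiable assms by (auto simp: frechet_derivative_works[symmetric])
  then have "((\<lambda>x. u x + c *\<^sub>R v x) has_derivative
     (\<lambda>h. frechet_derivative u (at x) h + c *\<^sub>R frechet_derivative v (at x) h)) (at x)"
    by (intro derivative_intros)
  from frechet_derivative_at[OF this, symmetric] show ?thesis
    unfolding divg_def by (simp add: inner_add_left sum.distrib sum_distrib_left)
qed

lemma divg_zero: "divg (\<lambda>x. 0 :: 'a) x = 0"
  by (simp add: divg_def)

lemma fields_zero: "(\<lambda>\<tau> x. 0) \<in> fields"
  using fe(1) unfolding fields_def lin_subspace_def by blast

lemma fields_add:
  assumes "u \<in> fields" "v \<in> fields"
  shows "(\<lambda>\<tau> x. u \<tau> x + c *\<^sub>R v \<tau> x) \<in> fields"
  unfolding fields_def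
proof (intro CollectI ballI)
  fix \<tau> assume t: "\<tau> \<in> fine_mesh G"
  then have "u \<tau> \<in> Vloc G \<tau>" "v \<tau> \<in> Vloc G \<tau>" using assms by (auto simp: fields_def)
  moreover have "\<forall>u\<in>Vloc G \<tau>. \<forall>v\<in>Vloc G \<tau>. \<forall>c. (\<lambda>x. u x + c *\<^sub>R v x) \<in> Vloc G \<tau>"
    using fe(1)[OF t] unfolding lin_subspace_def by (rule conjunct2)
  ultimately show "(\<lambda>x. u \<tau> x + c *\<^sub>R v \<tau> x) \<in> Vloc G \<tau>" by blast
qed

lemma kappa_bounds:
  obtains lo hi where "0 < lo" "\<And>x. x \<in> cdom G \<Longrightarrow> lo \<le> kappa G x" "\<And>x. x \<in> cdom G \<Longrightarrow> kappa G x \<le> hi"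
  using ok unfolding gmsfem_ok_def data_ok_def by blast

lemma kappa_measurable: "kappa G \<in> borel_measurable borel"
  using ok unfolding gmsfem_ok_def data_ok_def by blast

lemma kappa_inverse_times_bounded:
  assumes "A \<subseteq> cdom G" "compact A" "continuous_on UNIV q"
  obtains B where "\<And>x. x \<in> A \<Longrightarrow> \<bar>inverse (kappa G x) * q x\<bar> \<le> B"
    "(\<lambda>x. inverse (kappa G x) * q x) \<in> borel_measurable borel"
proof -
  obtain lo hi where k: "0 < lo" "\<And>x. x \<in> cdom G \<Longrightarrow> lo \<le> kappa G x" using kappa_bounds by metis
  have "bounded (q ` A)"
    using assms by (intro compact_imp_bounded compact_continuous_image) (auto intro: continuous_on_subset)
  then obtain b where b: "\<And>x. x \<in> A \<Longrightarrow> \<bar>q x\<bar> \<le> b" by (auto simp: bounded_real)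
  have "\<bar>inverse (kappa G x) * q x\<bar> \<le> inverse lo * b" if "x \<in> A" for x
  proof -
    have kx: "lo \<le> kappa G x" using that assms k by auto
    then have "inverse (kappa G x) \<le> inverse lo" "inverse (kappa G x) > 0" using k(1) by (auto intro: le_imp_inverse_le)
    then show ?thesis unfolding abs_mult using b[OF that] k(1) by (intro mult_mono) auto
  qed
  moreover have "(\<lambda>x. inverse (kappa G x) * q x) \<in> borel_measurable borel"
    using kappa_measurable borel_measurable_continuous_onI[OF assms(3)] by measurable
  ultimately show thesis using that by blast
qed

lemma kappa_inverse_integrable:
  assumes "\<tau> \<in> fine_mesh G" "continuous_on UNIV q"
  shows "set_integrable lborel \<tau> (\<lambda>x. inverse (kappa G x) * q x)"
proof -
  note t = mesh_cell[OF fmesh assms(1)]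
  obtain B where "\<And>x. x \<in> \<tau> \<Longrightarrow> \<bar>inverse (kappa G x) * q x\<bar> \<le> B"
    "(\<lambda>x. inverse (kappa G x) * q x) \<in> borel_measurable borel"
    using kappa_inverse_times_bounded[OF fine_cdom[OF assms(1)] t(4) assms(2)] by blast
  then show ?thesis
    using t(4) emeasure_bounded_finite[OF compact_imp_bounded[OF t(4)]]
    by (intro set_integrable_bounded) (auto intro: borel_compact)
qed

lemma psd_kip: "psd fields (kip G \<Omega>)"
proof -
  have "psd fields (\<lambda>u w. \<Sum>\<tau>\<in>{\<tau> \<in> fine_mesh G. \<tau> \<subseteq> \<Omega>}. LINT x:\<tau>|lborel. inverse (kappa G x) * (u \<tau> x \<bullet> w \<tau> x))"
  proof (rule psd_integral_sum[where A = "\<lambda>\<tau>. \<tau>" and M = "\<lambda>_. lborel"])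
    fix \<tau> u w assume t: "\<tau> \<in> {\<tau> \<in> fine_mesh G. \<tau> \<subseteq> \<Omega>}" and u: "u \<in> fields" "w \<in> fields"
    then have "continuous_on UNIV (u \<tau>)" "continuous_on UNIV (w \<tau>)"
      by (auto simp: fields_def intro!: Vloc_continuous)
    then show "set_integrable lborel \<tau> (\<lambda>x. inverse (kappa G x) * (u \<tau> x \<bullet> w \<tau> x))"
      using t by (intro kappa_inverse_integrable continuous_intros) auto
  next
    fix \<tau> u x assume t: "\<tau> \<in> {\<tau> \<in> fine_mesh G. \<tau> \<subseteq> \<Omega>}" and x: "x \<in> \<tau>"
    obtain lo hi where k: "0 < lo" "\<And>x. x \<in> cdom G \<Longrightarrow> lo \<le> kappa G x" using kappa_bounds by metis
    have "x \<in> cdom G" using fine_cdom t x by blast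
    then show "0 \<le> inverse (kappa G x) * (u \<tau> x \<bullet> u \<tau> x)" using k by (fastforce intro!: mult_nonneg_nonneg)
  qed (auto simp: fields_zero fields_add inner_commute inner_add_left algebra_simps)
  then show ?thesis unfolding kip_def[abs_def] cell_int_def .
qed

lemma psd_divip: "psd fields (divip G \<Omega>)"
proof -
  have "psd fields (\<lambda>u w. \<Sum>\<tau>\<in>{\<tau> \<in> fine_mesh G. \<tau> \<subseteq> \<Omega>}. LINT x:\<tau>|lborel. divg (u \<tau>) x * divg (w \<tau>) x)"
  proof (rule psd_integral_sum[where A = "\<lambda>\<tau>. \<tau>" and M = "\<lambda>_. lborel"])
    fix \<tau> u w assume t: "\<tau> \<in> {\<tau> \<in> fine_mesh G. \<tau> \<subseteq> \<Omega>}" and u: "u \<in> fields" "w \<in> fields"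
    then have "continuous_on \<tau> (divg (u \<tau>))" "continuous_on \<tau> (divg (w \<tau>))"
      by (auto simp: fields_def intro!: polys_continuous fe(3))
    then show "set_integrable lborel \<tau> (\<lambda>x. divg (u \<tau>) x * divg (w \<tau>) x)"
      unfolding set_integrable_def
      using mesh_cell(4)[OF fmesh] t by (intro borel_integrable_compact continuous_intros) auto
  next
    fix \<tau> u v w c x assume t: "\<tau> \<in> {\<tau> \<in> fine_mesh G. \<tau> \<subseteq> \<Omega>}" and u: "u \<in> fields" "v \<in> fields" "w \<in> fields"
    then show "divg (\<lambda>x. u \<tau> x + c *\<^sub>R v \<tau> x) x * divg (w \<tau>) x = divg (u \<tau>) x * divg (w \<tau>) x + c * (divg (v \<tau>) x * divg (w \<tau>) x)"
      by (subst divg_add[of \<tau>]) (auto simp: fields_def algebra_simps)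
  qed (auto simp: fields_zero fields_add)
  then show ?thesis unfolding divip_def[abs_def] cell_int_def .
qed

text \<open>A field of zero energy on a region vanishes at every point of the fine cells in it, by continuity.\<close>

lemma kip_zero_imp:
  assumes v: "v \<in> fields" "kip G \<Omega> v v = 0" and t: "\<tau> \<in> fine_mesh G" "\<tau> \<subseteq> \<Omega>" and x: "x \<in> \<tau>"
  shows "v \<tau> x = 0"
proof -
  note tc = mesh_cell[OF fmesh t(1)]
  obtain lo hi where k: "0 < lo" "\<And>x. x \<in> cdom G \<Longrightarrow> lo \<le> kappa G x" using kappa_bounds by metis
  have kpos: "inverse (kappa G y) > 0" if "y \<in> \<tau>'" "\<tau>' \<in> fine_mesh G" for y \<tau>'
    using k(1) k(2)[of y] that fine_cdom[OF that(2)] by fastforce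
  have cont: "continuous_on UNIV (v \<tau>)" using v t by (auto simp: fields_def intro!: Vloc_continuous)
  let ?I = "\<lambda>\<tau>. LINT x:\<tau>|lborel. inverse (kappa G x) * (v \<tau> x \<bullet> v \<tau> x)"
  have nn: "0 \<le> ?I \<tau>'" if "\<tau>' \<in> fine_mesh G" for \<tau>'
    unfolding set_lebesgue_integral_def
  proof (intro integral_nonneg_AE AE_I2)
    fix x show "0 \<le> indicator \<tau>' x *\<^sub>R (inverse (kappa G x) * (v \<tau>' x \<bullet> v \<tau>' x))"
      using kpos[OF _ that, of x] by (cases "x \<in> \<tau>'") (auto intro!: mult_nonneg_nonneg less_imp_le)
  qed
  have "(\<Sum>\<tau>\<in>{\<tau> \<in> fine_mesh G. \<tau> \<subseteq> \<Omega>}. ?I \<tau>) = 0"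
    using v(2) by (simp add: kip_def cell_int_def)
  then have "\<forall>\<tau>\<in>{\<tau> \<in> fine_mesh G. \<tau> \<subseteq> \<Omega>}. ?I \<tau> = 0"
    using nn fin_fine by (subst (asm) sum_nonneg_eq_0_iff) auto
  then have I0: "?I \<tau> = 0" using t by blast
  have "set_integrable lborel \<tau> (\<lambda>x. inverse (kappa G x) * (v \<tau> x \<bullet> v \<tau> x))"
    by (intro kappa_inverse_integrable[OF t(1)] continuous_intros cont)
  then have "AE x in lborel. indicator \<tau> x *\<^sub>R (inverse (kappa G x) * (v \<tau> x \<bullet> v \<tau> x)) = 0"
  proof (subst integral_nonneg_eq_0_iff_AE[symmetric])
    show "AE x in lborel. 0 \<le> indicator \<tau> x *\<^sub>R (inverse (kappa G x) * (v \<tau> x \<bullet> v \<tau> x))"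
    proof (intro AE_I2)
      fix x show "0 \<le> indicator \<tau> x *\<^sub>R (inverse (kappa G x) * (v \<tau> x \<bullet> v \<tau> x))"
        using kpos[OF _ t(1), of x] by (cases "x \<in> \<tau>") (auto intro!: mult_nonneg_nonneg less_imp_le)
    qed
  qed (use I0 in \<open>auto simp: set_integrable_def set_lebesgue_integral_def\<close>)
  then have "AE y in lborel. y \<notin> {y \<in> interior \<tau>. v \<tau> y \<noteq> 0}"
  proof eventually_elim
    case (elim y)
    show ?case
    proof
      assume "y \<in> {y \<in> interior \<tau>. v \<tau> y \<noteq> 0}"
      then have "y \<in> \<tau>" "v \<tau> y \<noteq> 0" using interior_subset by auto
      then show False using elim kpos[OF _ t(1), of y] by auto
    qed
  qed
  moreover have "open {y \<in> interior \<tau>. v \<tau> y \<noteq> 0}"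
  proof -
    have "open (v \<tau> -` (- {0}))" using cont by (intro open_vimage) auto
    then have "open (interior \<tau> \<inter> v \<tau> -` (- {0}))" by auto
    then show ?thesis by (simp add: Int_def vimage_def)
  qed
  ultimately have "{y \<in> interior \<tau>. v \<tau> y \<noteq> 0} = {}" by (intro open_AE_empty)
  then have z: "\<And>y. y \<in> interior \<tau> \<Longrightarrow> v \<tau> y = 0" by blast
  have "x \<in> closure (interior \<tau>)" using x tc by (simp add: convex_closure_interior)
  then show ?thesis
    using continuous_constant_on_closure[of "interior \<tau>" "v \<tau>" 0 x] z continuous_on_subset[OF cont]
    by blast
qed

end

section \<open>Normal traces of snapshot functions\<close>

context gms begin

lemma nrm:
  assumes "E \<in> coarse_faces G"
  shows "norm (nrm G E) = 1" "\<And>x y. x \<in> E \<Longrightarrow> y \<in> E \<Longrightarrow> nrm G E \<bullet> (x - y) = 0"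
  using mesh(4) assms by blast+

lemma fine_face:
  assumes "f \<in> mesh_faces (fine_mesh G)"
  shows "convex f" "f \<noteq> {}" "compact f" "aff_dim f = int DIM('a) - 1"
proof -
  obtain \<tau> where "\<tau> \<in> fine_mesh G" "f facet_of \<tau>" using assms by (auto simp: mesh_faces_def)
  note facet_dim[OF fmesh this]
  then show "convex f" "f \<noteq> {}" "compact f" "aff_dim f = int DIM('a) - 1" by blast+
qed

lemma fine_in_face:
  assumes "f \<in> fine_in G E"
  shows "f \<in> mesh_faces (fine_mesh G)" "f \<subseteq> E"
  using assms by (auto simp: fine_in_def)

lemma face_cell:
  assumes "f \<in> mesh_faces (fine_mesh G)"
  shows "face_cell G f \<in> fine_mesh G" "f facet_of face_cell G f"
proof -
  have "\<exists>\<tau>. \<tau> \<in> fine_mesh G \<and> f facet_of \<tau>" using assms by (auto simp: mesh_faces_def)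
  then have "face_cell G f \<in> fine_mesh G \<and> f facet_of face_cell G f"
    unfolding face_cell_def by (rule someI_ex)
  then show "face_cell G f \<in> fine_mesh G" "f facet_of face_cell G f" by auto
qed

lemma nbr_iff:
  "E \<in> coarse_faces G \<Longrightarrow> K \<in> nbr G E \<longleftrightarrow> K \<in> coarse_mesh G \<and> E facet_of K"
  using mesh_faces_nbr[OF cmesh, of E K] unfolding nbr_def coarse_faces_def by blast

lemma fine_subset_omega:
  assumes E: "E \<in> coarse_faces G" and t: "\<tau> \<in> fine_mesh G" and K: "K \<in> coarse_mesh G" "\<tau> \<subseteq> K"
  shows "\<tau> \<subseteq> omega G E \<longleftrightarrow> K \<in> nbr G E"
proof
  assume sub: "\<tau> \<subseteq> omega G E"
  obtain x where x: "x \<in> interior \<tau>" using mesh_cell(2)[OF fmesh t] by blast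
  then obtain K' where K': "K' \<in> nbr G E" "x \<in> K'" using sub interior_subset by (force simp: omega_def)
  have "x \<in> interior K" using x interior_mono[OF K(2)] by blast
  then have "K = K'" using K' K(1) by (intro mesh_cell_unique[OF cmesh]) (auto simp: nbr_def)
  then show "K \<in> nbr G E" using K' by simp
qed (use K in \<open>auto simp: omega_def\<close>)

lemma facet_in_nbr:
  assumes E: "E \<in> coarse_faces G" "f \<in> fine_in G E" and t: "\<tau> \<in> fine_mesh G" "f facet_of \<tau>"
    and K: "K \<in> coarse_mesh G" "\<tau> \<subseteq> K"
  shows "K \<in> nbr G E"
proof -
  obtain K1 where K1: "K1 \<in> coarse_mesh G" "E facet_of K1" using E(1) by (auto simp: coarse_faces_def mesh_faces_def)
  have "f \<subseteq> K" using t(2) K(2) by (auto simp: facet_of_def dest: face_of_imp_subset)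
  then have "E facet_of K"
    using mesh_facet_shared[OF cmesh K1(1) K(1) K1(2)] fine_in_face[OF E(2)] fine_face by blast
  then show ?thesis using E(1) K(1) by (simp add: nbr_iff)
qed

lemma facet_in_omega:
  assumes E: "E \<in> coarse_faces G" "f \<in> fine_in G E" and t: "\<tau> \<in> fine_mesh G" "f facet_of \<tau>"
  shows "\<tau> \<subseteq> omega G E"
proof -
  obtain K where K: "K \<in> coarse_mesh G" "\<tau> \<subseteq> K" using fine_cell_in[OF t(1)] .
  then show ?thesis using facet_in_nbr[OF E t K] fine_subset_omega[OF E(1) t(1) K] by simp
qed

lemma snapshot:
  assumes "E \<in> coarse_faces G" "e \<in> fine_in G E"
  shows "is_snapshot G E e (snap G E e)"
proof -
  have "\<forall>E\<in>coarse_faces G. \<forall>e\<in>fine_in G E. is_snapshot G E e (snap G E e)"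
    using ok unfolding gmsfem_ok_def by (elim conjE)
  then show ?thesis using assms by blast
qed

lemma snap_outside:
  assumes "E \<in> coarse_faces G" "e \<in> fine_in G E" "\<not> (\<tau> \<in> fine_mesh G \<and> \<tau> \<subseteq> omega G E)"
  shows "snap G E e \<tau> = (\<lambda>x. 0)"
  using snapshot[OF assms(1,2)] assms(3) unfolding is_snapshot_def by blast

lemma snap_inside:
  assumes E: "E \<in> coarse_faces G" "e \<in> fine_in G E" and t: "\<tau> \<in> fine_mesh G" "\<tau> \<subseteq> K" and K: "K \<in> nbr G E"
  shows "snap G E e \<tau> \<in> Vloc G \<tau>"
    and "\<And>f x. f facet_of \<tau> \<Longrightarrow> f \<subseteq> E \<Longrightarrow> x \<in> f \<Longrightarrow> snap G E e \<tau> x \<bullet> nrm G E = (if f = e then 1 else 0)"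
    and "\<And>f x. f facet_of \<tau> \<Longrightarrow> f \<subseteq> frontier K \<Longrightarrow> \<not> f \<subseteq> E \<Longrightarrow> x \<in> f \<Longrightarrow> snap G E e \<tau> x \<bullet> outn \<tau> f = 0"
proof -
  have s: "snapshot_on G E e K (snap G E e)" using snapshot[OF E] K unfolding is_snapshot_def by blast
  then have "snap G E e \<in> fineV G K" unfolding snapshot_on_def by (rule conjunct1)
  then show "snap G E e \<tau> \<in> Vloc G \<tau>" using t unfolding fineV_def by blast
  have tr: "\<forall>\<tau>\<in>fine_mesh G. \<forall>f. \<tau> \<subseteq> K \<longrightarrow> f facet_of \<tau> \<longrightarrow>
        (f \<subseteq> E \<longrightarrow> (\<forall>x\<in>f. snap G E e \<tau> x \<bullet> nrm G E = (if f = e then 1 else 0))) \<and>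
        (f \<subseteq> frontier K \<longrightarrow> \<not> f \<subseteq> E \<longrightarrow> (\<forall>x\<in>f. snap G E e \<tau> x \<bullet> outn \<tau> f = 0))"
    using s unfolding snapshot_on_def by (elim conjE)
  show "snap G E e \<tau> x \<bullet> nrm G E = (if f = e then 1 else 0)" if "f facet_of \<tau>" "f \<subseteq> E" "x \<in> f" for f x
    using bspec[OF tr t(1), rule_format, OF t(2) that(1)] that by blast
  show "snap G E e \<tau> x \<bullet> outn \<tau> f = 0" if "f facet_of \<tau>" "f \<subseteq> frontier K" "\<not> f \<subseteq> E" "x \<in> f" for f x
    using bspec[OF tr t(1), rule_format, OF t(2) that(1)] that by blast
qed

lemma snap_fields:
  assumes E: "E \<in> coarse_faces G" "e \<in> fine_in G E"
  shows "snap G E e \<in> fields"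
  unfolding fields_def
proof (intro CollectI ballI)
  fix \<tau> assume t: "\<tau> \<in> fine_mesh G"
  show "snap G E e \<tau> \<in> Vloc G \<tau>"
  proof (cases "\<tau> \<subseteq> omega G E")
    case True
    obtain K where K: "K \<in> coarse_mesh G" "\<tau> \<subseteq> K" using fine_cell_in[OF t] .
    then show ?thesis using fine_subset_omega[OF E(1) t K] True snap_inside(1)[OF E t] by blast
  next
    case False
    then have "snap G E e \<tau> = (\<lambda>x. 0)" using snap_outside[OF E] by blast
    then show ?thesis using fields_zero t by (simp add: fields_def)
  qed
qed

lemma nrm_outn:
  assumes E: "E \<in> coarse_faces G" "f \<in> fine_in G E" and t: "\<tau> \<in> fine_mesh G" "f facet_of \<tau>"
  shows "nrm G E = outn \<tau> f \<or> nrm G E = - outn \<tau> f"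
proof (rule unit_normal_unique)
  note F = fine_in_face[OF E(2)]
  show "aff_dim f = int DIM('a) - 1" "f \<noteq> {}" using fine_face[OF F(1)] by auto
  show "outn \<tau> f \<bullet> (x - y) = 0" if "x \<in> f" "y \<in> f" for x y
    using outn_props[OF mesh_cell(1)[OF fmesh t(1)] t(2)] that by auto
  show "norm (outn \<tau> f) = 1" using outn_props[OF mesh_cell(1)[OF fmesh t(1)] t(2)] by auto
  show "nrm G E \<bullet> (x - y) = 0" if "x \<in> f" "y \<in> f" for x y
    using nrm[OF E(1)] F(2) that by auto
  show "norm (nrm G E) = 1" using nrm[OF E(1)] by auto
qed

text \<open>Normal traces of the snapshot functions on the coarse skeleton are Kronecker deltas, whichever of the
  adjacent fine cells is used to evaluate them.\<close>

lemma snap_trace: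
  assumes E: "E \<in> coarse_faces G" "f \<in> fine_in G E" and E': "E' \<in> coarse_faces G" "e \<in> fine_in G E'"
    and t: "\<tau> \<in> fine_mesh G" "f facet_of \<tau>" and x: "x \<in> f"
  shows "snap G E' e \<tau> x \<bullet> nrm G E = (if E' = E \<and> e = f then 1 else 0)"
proof -
  note F = fine_in_face[OF E(2)]
  obtain K where K: "K \<in> coarse_mesh G" "\<tau> \<subseteq> K" using fine_cell_in[OF t(1)] .
  have KE: "K \<in> nbr G E" by (rule facet_in_nbr[OF E t K])
  show ?thesis
  proof (cases "E' = E")
    case True
    then show ?thesis using snap_inside(2)[OF E' t(1) K(2), of f x] KE t(2) F x by auto
  next
    case False
    have "snap G E' e \<tau> x \<bullet> nrm G E = 0"
    proof (cases "K \<in> nbr G E'")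
      case True
      have "f \<subseteq> frontier K" using KE F(2) by (auto simp: nbr_def)
      moreover have "\<not> f \<subseteq> E'"
        using mesh_faces_unique[OF cmesh, of E E' f] E(1) E'(1) False F fine_face[OF F(1)]
        by (auto simp: coarse_faces_def)
      ultimately have "snap G E' e \<tau> x \<bullet> outn \<tau> f = 0" using snap_inside(3)[OF E' t(1) K(2) True t(2)] x by blast
      then show ?thesis using nrm_outn[OF E t] by auto
    next
      case outside: False
      then have "\<not> \<tau> \<subseteq> omega G E'" using fine_subset_omega[OF E'(1) t(1) K] by simp
      then show ?thesis using snap_outside[OF E'] by simp
    qed
    then show ?thesis using False by simp
  qed
qed

text \<open>Elements of the snapshot spaces in coordinates: \<open>c E f\<close> is the coefficient of the snapshot function of
  the fine face \<open>f\<close> in the coarse face \<open>E\<close>.  The field \<open>comb c E\<close>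
  belongs to \<open>E\<close> alone, \<open>gcomb c A\<close> is the sum over the coarse faces in \<open>A\<close>.  The coefficients are
  recovered as normal traces.\<close>

definition comb :: "('a set \<Rightarrow> 'a set \<Rightarrow> real) \<Rightarrow> 'a set \<Rightarrow> 'a vfield" where
  "comb c E = lincomb (c E) (snap G E) (fine_in G E)"

definition gcomb :: "('a set \<Rightarrow> 'a set \<Rightarrow> real) \<Rightarrow> 'a set set \<Rightarrow> 'a vfield" where
  "gcomb c A = lincomb (\<lambda>_. 1) (comb c) A"

lemma comb_fields: "E \<in> coarse_faces G \<Longrightarrow> comb c E \<in> fields"
  unfolding comb_def by (rule psd.lincomb_in[OF psd_kip fin_fine_in snap_fields])

lemma gcomb_fields: "A \<subseteq> coarse_faces G \<Longrightarrow> gcomb c A \<in> fields"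
  unfolding gcomb_def by (rule psd.lincomb_in[OF psd_kip finite_subset[OF _ fin_faces] comb_fields]) auto

lemma gcomb_alt: "gcomb c A = (\<lambda>\<tau> x. \<Sum>E\<in>A. comb c E \<tau> x)"
  by (simp add: gcomb_def lincomb_def)

lemma comb_trace:
  assumes E: "E \<in> coarse_faces G" "f \<in> fine_in G E" and E': "E' \<in> coarse_faces G"
    and t: "\<tau> \<in> fine_mesh G" "f facet_of \<tau>" and x: "x \<in> f"
  shows "comb c E' \<tau> x \<bullet> nrm G E = (if E' = E then c E f else 0)"
proof -
  have "comb c E' \<tau> x \<bullet> nrm G E = (\<Sum>e\<in>fine_in G E'. c E' e * (if E' = E \<and> e = f then 1 else 0))"
    unfolding comb_def lincomb_def inner_sum_left inner_scaleR_left
    by (intro sum.cong refl arg_cong2[where f = "(*)"] snap_trace[OF E E' _ t x])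
  also have "\<dots> = (if E' = E then c E f else 0)"
    using E(2) fin_fine_in by (cases "E' = E") (auto simp: if_distrib[of "\<lambda>r. _ * r"] cong: if_cong)
  finally show ?thesis .
qed

lemma gcomb_trace:
  assumes E: "E \<in> coarse_faces G" "f \<in> fine_in G E" and A: "A \<subseteq> coarse_faces G"
    and t: "\<tau> \<in> fine_mesh G" "f facet_of \<tau>" and x: "x \<in> f"
  shows "gcomb c A \<tau> x \<bullet> nrm G E = (if E \<in> A then c E f else 0)"
proof -
  have "gcomb c A \<tau> x \<bullet> nrm G E = (\<Sum>E'\<in>A. if E' = E then c E f else 0)"
    unfolding gcomb_alt inner_sum_left using A by (intro sum.cong refl comb_trace[OF E _ t x]) auto
  also have "\<dots> = (if E \<in> A then c E f else 0)" using finite_subset[OF A fin_faces] by simp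
  finally show ?thesis .
qed

lemma gcomb_ntrace:
  assumes E: "E \<in> coarse_faces G" "f \<in> fine_in G E" and A: "A \<subseteq> coarse_faces G" and x: "x \<in> f"
  shows "ntrace G (nrm G E) (gcomb c A) f x = (if E \<in> A then c E f else 0)"
  unfolding ntrace_def using gcomb_trace[OF E A face_cell[OF fine_in_face(1)[OF E(2)]] x] .

lemma Vsnap_loc_iff: "v \<in> Vsnap_loc G E \<longleftrightarrow> (\<exists>c. v = comb c E)"
proof
  assume "v \<in> Vsnap_loc G E"
  then obtain c where "v = lincomb c (snap G E) (fine_in G E)" by (auto simp: Vsnap_loc_def fspan_def)
  then have "v = comb (\<lambda>_. c) E" by (simp add: comb_def)
  then show "\<exists>c. v = comb c E" by blast
qed (auto simp: Vsnap_loc_def fspan_def comb_def)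

lemma gcomb_single: "gcomb c {E} = comb c E"
  by (simp add: gcomb_alt)

lemma Vsnap_loc_fields: "E \<in> coarse_faces G \<Longrightarrow> v \<in> Vsnap_loc G E \<Longrightarrow> v \<in> fields"
  by (metis comb_fields Vsnap_loc_iff)

lemma space_sum_iff: "u \<in> space_sum (Vsnap_loc G) A \<longleftrightarrow> (\<exists>c. u = gcomb c A)"
proof
  assume "u \<in> space_sum (Vsnap_loc G) A"
  then obtain w where w: "u = (\<lambda>\<tau> x. \<Sum>E\<in>A. w E \<tau> x)" "\<forall>E\<in>A. w E \<in> Vsnap_loc G E"
    by (auto simp: space_sum_def)
  then have "\<forall>E\<in>A. \<exists>b. w E = lincomb b (snap G E) (fine_in G E)" by (auto simp: Vsnap_loc_def fspan_def)
  then obtain c where "\<forall>E\<in>A. w E = lincomb (c E) (snap G E) (fine_in G E)" by metis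
  then have "u = gcomb c A" unfolding gcomb_alt w(1) comb_def by simp
  then show "\<exists>c. u = gcomb c A" by blast
next
  assume "\<exists>c. u = gcomb c A"
  then show "u \<in> space_sum (Vsnap_loc G) A"
    using Vsnap_loc_iff unfolding space_sum_def gcomb_alt by blast
qed

lemma comb_diff: "(\<lambda>\<tau> x. comb c E \<tau> x - comb d E \<tau> x) = comb (\<lambda>E f. c E f - d E f) E"
  by (intro ext) (simp add: comb_def lincomb_def scaleR_diff_left sum_subtractf)

lemma gcomb_diff: "(\<lambda>\<tau> x. gcomb c A \<tau> x - gcomb d A \<tau> x) = gcomb (\<lambda>E f. c E f - d E f) A"
  unfolding gcomb_alt comb_diff[symmetric] by (simp add: sum_subtractf)

lemma comb_zero: "(\<And>f. f \<in> fine_in G E \<Longrightarrow> c E f = 0) \<Longrightarrow> comb c E = (\<lambda>\<tau> x. 0)"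
  unfolding comb_def lincomb_def by (intro ext sum.neutral) simp

text \<open>A field of zero energy on the neighbourhood of \<open>E\<close> has zero normal trace on \<open>E\<close>.\<close>

lemma kip_omega_zero:
  assumes E: "E \<in> coarse_faces G" "f \<in> fine_in G E" and A: "A \<subseteq> coarse_faces G" "E \<in> A"
    and z: "kip G (omega G E) (gcomb c A) (gcomb c A) = 0"
  shows "c E f = 0"
proof -
  note F = fine_in_face[OF E(2)]
  note t = face_cell[OF F(1)]
  obtain x where x: "x \<in> f" using fine_face(2)[OF F(1)] by blast
  have "x \<in> face_cell G f" using t(2) x by (auto simp: facet_of_def dest: face_of_imp_subset)
  then have "gcomb c A (face_cell G f) x = 0"
    using kip_zero_imp[OF gcomb_fields[OF A(1)] z t(1) facet_in_omega[OF E t]] by blast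
  then show ?thesis using gcomb_trace[OF E A(1) t x, of c] A(2) by simp
qed

lemma kip_omega_pos:
  assumes E: "E \<in> coarse_faces G" and v: "v \<in> Vsnap_loc G E" "v \<noteq> (\<lambda>\<tau> x. 0)"
  shows "kip G (omega G E) v v > 0"
proof -
  obtain c where c: "v = comb c E" using v(1) Vsnap_loc_iff by blast
  have "kip G (omega G E) v v \<noteq> 0"
  proof
    assume z: "kip G (omega G E) v v = 0"
    have "c E f = 0" if "f \<in> fine_in G E" for f
      by (rule kip_omega_zero[OF E that, of "{E}"]) (use E z in \<open>simp_all add: gcomb_single c\<close>)
    then have "v = (\<lambda>\<tau> x. 0)" unfolding c by (rule comb_zero)
    then show False using v(2) by simp
  qed
  then show ?thesis using psd.nonneg[OF psd_kip Vsnap_loc_fields[OF E v(1)], of "omega G E"] by simp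
qed

section \<open>Localisation of integrals\<close>

lemma comb_outside:
  assumes "E \<in> coarse_faces G" "\<not> (\<tau> \<in> fine_mesh G \<and> \<tau> \<subseteq> omega G E)"
  shows "comb c E \<tau> = (\<lambda>x. 0)"
  unfolding comb_def lincomb_def
  by (intro ext sum.neutral ballI) (simp add: snap_outside[OF assms(1) _ assms(2)])

lemma omega_cdom: "omega G E \<subseteq> cdom G"
  by (auto simp: omega_def nbr_def cdom_def)

lemma kip_local:
  assumes E: "E \<in> coarse_faces G" "v \<in> Vsnap_loc G E"
  shows "kip G (cdom G) w v = kip G (omega G E) w v"
proof -
  obtain c where c: "v = comb c E" using E Vsnap_loc_iff by blast
  show ?thesis
    unfolding kip_def cell_int_def
  proof (rule sum.mono_neutral_right)
    show "\<forall>\<tau>\<in>{\<tau> \<in> fine_mesh G. \<tau> \<subseteq> cdom G} - {\<tau> \<in> fine_mesh G. \<tau> \<subseteq> omega G E}.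
       (LINT x:\<tau>|lborel. inverse (kappa G x) * (w \<tau> x \<bullet> v \<tau> x)) = 0"
      using comb_outside[OF E(1)] by (auto simp: c set_lebesgue_integral_def)
  qed (use fin_fine omega_cdom in auto)
qed

lemma divQ_local:
  assumes E: "E \<in> coarse_faces G" "v \<in> Vsnap_loc G E"
  shows "divQ G (cdom G) v q = divQ G (omega G E) v q"
proof -
  obtain c where c: "v = comb c E" using E Vsnap_loc_iff by blast
  show ?thesis
    unfolding divQ_def
  proof (rule sum.mono_neutral_right)
    show "\<forall>K\<in>{K \<in> coarse_mesh G. K \<subseteq> cdom G} - {K \<in> coarse_mesh G. K \<subseteq> omega G E}.
       cell_int G K (\<lambda>\<tau> x. divg (v \<tau>) x * q K) = 0"
      unfolding cell_int_def
    proof (intro ballI sum.neutral)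
      fix K \<tau> assume K: "K \<in> {K \<in> coarse_mesh G. K \<subseteq> cdom G} - {K \<in> coarse_mesh G. K \<subseteq> omega G E}"
        and t: "\<tau> \<in> {\<tau> \<in> fine_mesh G. \<tau> \<subseteq> K}"
      have "K \<notin> nbr G E" using K by (auto simp: omega_def)
      then have "\<not> \<tau> \<subseteq> omega G E" using fine_subset_omega[OF E(1), of \<tau> K] K t by auto
      then have "v \<tau> = (\<lambda>x. 0)" using comb_outside[OF E(1)] by (auto simp: c)
      then show "(LINT x:\<tau>|lborel. divg (v \<tau>) x * q K) = 0"
        by (simp add: divg_zero set_lebesgue_integral_def)
    qed
  qed (use fin_coarse omega_cdom in auto)
qed

lemma divQ_add:
  assumes u: "u \<in> fields" "v \<in> fields"
  shows "divQ G \<Omega> (\<lambda>\<tau> x. u \<tau> x + c *\<^sub>R v \<tau> x) q = divQ G \<Omega> u q + c * divQ G \<Omega> v q"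
proof -
  have "(LINT x:\<tau>|lborel. divg (\<lambda>x. u \<tau> x + c *\<^sub>R v \<tau> x) x * q K)
     = (LINT x:\<tau>|lborel. divg (u \<tau>) x * q K) + c * (LINT x:\<tau>|lborel. divg (v \<tau>) x * q K)"
    if t: "\<tau> \<in> fine_mesh G" for \<tau> K
  proof -
    have uv: "u \<tau> \<in> Vloc G \<tau>" "v \<tau> \<in> Vloc G \<tau>" using u t by (auto simp: fields_def)
    have i: "set_integrable lborel \<tau> (\<lambda>x. divg w x * q K)" if "w \<in> Vloc G \<tau>" for w
    proof -
      have "continuous_on \<tau> (divg w)" using fe(3)[OF t that] by (rule polys_continuous)
      then show ?thesis unfolding set_integrable_def
        using mesh_cell(4)[OF fmesh t] by (intro borel_integrable_compact continuous_intros)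
    qed
    have "(LINT x:\<tau>|lborel. divg (\<lambda>x. u \<tau> x + c *\<^sub>R v \<tau> x) x * q K)
       = (LINT x:\<tau>|lborel. divg (u \<tau>) x * q K + c * (divg (v \<tau>) x * q K))"
      by (simp add: divg_add[OF t uv] algebra_simps)
    also have "\<dots> = (LINT x:\<tau>|lborel. divg (u \<tau>) x * q K) + (LINT x:\<tau>|lborel. c * (divg (v \<tau>) x * q K))"
      using i[OF uv(1)] i[OF uv(2)] by (intro set_integral_add(2)) auto
    finally show ?thesis by simp
  qed
  then show ?thesis
    unfolding divQ_def cell_int_def by (simp add: sum.distrib sum_distrib_left)
qed

lemma residual_add:
  assumes "w \<in> fields" "u \<in> fields" "v \<in> fields"
  shows "residual G w q E (\<lambda>\<tau> x. u \<tau> x + c *\<^sub>R v \<tau> x) = residual G w q E u + c * residual G w q E v"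
  unfolding residual_def divQ_add[OF assms(2,3)] psd.lin_right[OF psd_kip assms(2,3,1)]
  by (simp add: algebra_simps)

end

lemma linear_lincomb:
  assumes V: "psd V B" and R: "\<And>u v c. u \<in> V \<Longrightarrow> v \<in> V \<Longrightarrow> R (\<lambda>\<tau> x. u \<tau> x + c *\<^sub>R v \<tau> x) = R u + c * R v"
    and I: "finite I" "\<And>i. i \<in> I \<Longrightarrow> v i \<in> V"
  shows "R (lincomb c v I) = (\<Sum>i\<in>I. c i * (R (v i) :: real))"
proof -
  interpret psd V B by (rule V)
  have R0: "R (\<lambda>\<tau> x. 0) = 0" using R[OF V_zero V_zero, of 1] by simp
  show ?thesis using I
  proof (induction I rule: finite_induct)
    case (insert i I)
    have "R (lincomb c v (insert i I)) = R (lincomb c v I) + c i * R (v i)"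
      unfolding lincomb_insert[OF insert.hyps(1,2)] using insert by (intro R lincomb_in) auto
    then show ?case using insert by simp
  qed (simp add: lincomb_empty R0)
qed

section \<open>The error estimate for an abstract spectral problem\<close>

context gms begin

text \<open>Local fields of a face that is not on the boundary have no flux through the boundary, hence are admissible
  test fields.\<close>

lemma boundary_trace_zero:
  assumes E: "E \<in> coarse_faces G" "\<not> E \<subseteq> frontier (cdom G)"
    and f: "f \<in> fine_in G (frontier (cdom G))" and x: "x \<in> f" and v: "v \<in> Vsnap_loc G E"
  shows "ntrace G (bdry_normal G f) v f x = 0"
proof -
  note F = fine_in_face[OF f]
  note t = face_cell[OF F(1)]
  have "snap G E e (face_cell G f) x \<bullet> outn (face_cell G f) f = 0" if e: "e \<in> fine_in G E" for e
  proof (cases "face_cell G f \<subseteq> omega G E")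
    case True
    obtain K where K: "K \<in> coarse_mesh G" "face_cell G f \<subseteq> K" using fine_cell_in[OF t(1)] .
    have "f \<subseteq> K" using t(2) K(2) by (auto simp: facet_of_def dest: face_of_imp_subset)
    moreover have "interior K \<subseteq> interior (cdom G)" using K(1) by (intro interior_mono) (auto simp: cdom_def)
    ultimately have "f \<subseteq> frontier K"
      using F(2) mesh_cell(5)[OF cmesh K(1)] by (auto simp: frontier_def)
    moreover have "\<not> f \<subseteq> E"
      using mesh_face_boundary[OF cmesh, of E f] E F(2) fine_face[OF F(1)] by (auto simp: coarse_faces_def cdom_def)
    ultimately show ?thesis
      using snap_inside(3)[OF E(1) e t(1) K(2) _ t(2)] True fine_subset_omega[OF E(1) t(1) K] x by blast
  qed (simp add: snap_outside[OF E(1) e])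
  moreover obtain c where "v = lincomb c (snap G E) (fine_in G E)"
    using v by (auto simp: Vsnap_loc_def fspan_def)
  ultimately show ?thesis by (simp add: ntrace_def bdry_normal_def lincomb_def inner_sum_left)
qed

lemma boundary_coefficients_zero:
  assumes E: "E \<in> coarse_faces G" "E \<subseteq> frontier (cdom G)"
    and tr: "\<forall>f\<in>fine_in G (frontier (cdom G)). \<forall>x\<in>f. ntrace G (bdry_normal G f) (gcomb c (coarse_faces G)) f x = 0"
  shows "comb c E = (\<lambda>\<tau> x. 0)"
proof (rule comb_zero)
  fix f assume f: "f \<in> fine_in G E"
  note F = fine_in_face[OF f]
  note t = face_cell[OF F(1)]
  have fb: "f \<in> fine_in G (frontier (cdom G))" using F E(2) by (auto simp: fine_in_def)
  obtain x where x: "x \<in> f" using fine_face(2)[OF F(1)] by blast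
  have "gcomb c (coarse_faces G) (face_cell G f) x \<bullet> outn (face_cell G f) f = 0"
    using tr fb x by (auto simp: ntrace_def bdry_normal_def)
  then have "gcomb c (coarse_faces G) (face_cell G f) x \<bullet> nrm G E = 0"
    using nrm_outn[OF E(1) f t] by auto
  then show "c E f = 0" using gcomb_trace[OF E(1) f order_refl t x, of c] E(1) by simp
qed

lemma fspan_truncate:
  assumes "l \<le> J"
  shows "lincomb b \<phi> {1..l} \<in> fspan \<phi> {1..J}" and "lincomb b \<phi> {l + 1..J} \<in> fspan \<phi> {1..J::nat}"
    and "lincomb b \<phi> {1..J} = (\<lambda>\<tau> x. lincomb b \<phi> {1..l} \<tau> x + 1 *\<^sub>R lincomb b \<phi> {l + 1..J} \<tau> x)"
proof -
  have *: "lincomb b \<phi> I = lincomb (\<lambda>k. if k \<in> I then b k else 0) \<phi> {1..J}" if "I \<subseteq> {1..J}" for I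
    unfolding lincomb_def
    by (intro ext sum.mono_neutral_cong_left) (use that in auto)
  show "lincomb b \<phi> {1..l} \<in> fspan \<phi> {1..J}" using *[of "{1..l}"] assms unfolding fspan_def by fastforce
  show "lincomb b \<phi> {l + 1..J} \<in> fspan \<phi> {1..J}" using *[of "{l + 1..J}"] unfolding fspan_def by fastforce
  have "{1..J} = {1..l} \<union> {l + 1..J}" using assms by auto
  then show "lincomb b \<phi> {1..J} = (\<lambda>\<tau> x. lincomb b \<phi> {1..l} \<tau> x + 1 *\<^sub>R lincomb b \<phi> {l + 1..J} \<tau> x)"
    unfolding lincomb_def by (intro ext) (simp add: sum.union_disjoint)
qed

text \<open>The error bound for forms \<open>a\<close> given as \<open>a v w = B (T v) (T w)\<close>.  The norm in which the residual is measured
  is the one of \<open>h S\<close>; the last assumption is the only one that relates \<open>a\<close> to the energy on the whole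
  domain.\<close>

lemma error_estimate:
  fixes lam :: "'a set \<Rightarrow> nat \<Rightarrow> real"
  assumes l: "\<forall>E\<in>coarse_faces G. l E \<le> card (fine_in G E)"
    and sol_s: "is_solution G (Vsnap G) vs ps" and sol_m: "is_solution G (Vms G \<phi> l) vm pm"
    and psdB: "\<And>E. E \<in> coarse_faces G \<Longrightarrow> psd fields (B E)" and psdS: "\<And>E. E \<in> coarse_faces G \<Longrightarrow> psd fields (S E)"
    and T: "\<And>E v. E \<in> coarse_faces G \<Longrightarrow> v \<in> Vsnap_loc G E \<Longrightarrow> T E v \<in> fields"
    and aB: "\<And>E v w. E \<in> coarse_faces G \<Longrightarrow> a E v w = B E (T E v) (T E w)"
    and eig: "\<forall>E\<in>coarse_faces G. eigensystem G E (a E) (S E) (lam E) (\<phi> E)"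
    and S_pos: "\<And>E v. E \<in> coarse_faces G \<Longrightarrow> v \<in> Vsnap_loc G E \<Longrightarrow> v \<noteq> (\<lambda>\<tau> x. 0) \<Longrightarrow> S E v v > 0"
    and a_pos: "\<And>E v. E \<in> coarse_faces G \<Longrightarrow> v \<in> Vsnap_loc G E \<Longrightarrow> v \<noteq> (\<lambda>\<tau> x. 0) \<Longrightarrow> a E v v > 0"
    and nv: "\<And>E v. E \<in> coarse_faces G \<Longrightarrow> v \<in> Vsnap_loc G E \<Longrightarrow> nv E v = sqrt (h * S E v v)" and h: "h > 0"
    and C: "C \<ge> 0"
    and total: "\<And>c. (\<Sum>E\<in>coarse_faces G. h * a E (comb c E) (comb c E))
        \<le> C * kip G (cdom G) (gcomb c (coarse_faces G)) (gcomb c (coarse_faces G))"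
  shows "(L2_knorm G (cdom G) (\<lambda>\<tau> x. vs \<tau> x - vm \<tau> x))\<^sup>2
     \<le> C * (\<Sum>E\<in>coarse_faces G. (dual_norm (Vsnap_loc G E) (nv E) (residual G vm pm E))\<^sup>2 * inv_next_eigenvalue G lam l E)"
proof -
  let ?F = "coarse_faces G" and ?D = "cdom G"
  define J where "J = (\<lambda>E. card (fine_in G E))"
  have lJ: "l E \<le> J E" if "E \<in> ?F" for E using l that by (simp add: J_def)
  have eigE: "\<And>k. k \<in> {1..J E} \<Longrightarrow> \<phi> E k \<in> Vsnap_loc G E"
    "\<And>k w. k \<in> {1..J E} \<Longrightarrow> w \<in> Vsnap_loc G E \<Longrightarrow> a E (\<phi> E k) w = lam E k * S E (\<phi> E k) w"
    "mono_on {1..J E} (lam E)"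
    "\<And>k m. k \<in> {1..J E} \<Longrightarrow> m \<in> {1..J E} \<Longrightarrow> k \<noteq> m \<Longrightarrow> a E (\<phi> E k) (\<phi> E m) = 0 \<and> S E (\<phi> E k) (\<phi> E m) = 0"
    "fspan (\<phi> E) {1..J E} = Vsnap_loc G E"
    "\<And>c. lincomb c (\<phi> E) {1..J E} = (\<lambda>\<tau> x. 0) \<Longrightarrow> \<forall>k\<in>{1..J E}. c k = 0" if "E \<in> ?F" for E
    using bspec[OF eig that] unfolding eigensystem_def Let_def J_def by blast+
  have \<phi>_ne: "\<phi> E k \<noteq> (\<lambda>\<tau> x. 0)" if "E \<in> ?F" "k \<in> {1..J E}" for E k
  proof
    assume z: "\<phi> E k = (\<lambda>\<tau> x. 0)"
    have "lincomb (\<lambda>m. if m = k then 1 else 0) (\<phi> E) {1..J E} = (\<lambda>\<tau> x. 0)"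
      unfolding lincomb_def by (intro ext sum.neutral) (auto simp: z)
    from bspec[OF eigE(6)[OF that(1) this] that(2)] show False by simp
  qed
  have trunc_in: "lincomb b (\<phi> E) {1..l E} \<in> Vsnap_loc G E" "lincomb b (\<phi> E) {l E + 1..J E} \<in> Vsnap_loc G E"
    if "E \<in> ?F" for E b
    using fspan_truncate[OF lJ[OF that], of b "\<phi> E"] eigE(5)[OF that] by auto

  obtain cs where cs: "vs = gcomb cs ?F"
    using sol_s space_sum_iff by (auto simp: is_solution_def Vsnap_def)
  obtain u where u: "vm = (\<lambda>\<tau> x. \<Sum>E\<in>?F. u E \<tau> x)" "\<And>E. E \<in> ?F \<Longrightarrow> u E \<in> fspan (\<phi> E) {1..l E}"
    using sol_m by (auto simp: is_solution_def Vms_def space_sum_def)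
  have "u E \<in> Vsnap_loc G E" if E: "E \<in> ?F" for E
  proof -
    obtain c where "u E = lincomb c (\<phi> E) {1..l E}" using u(2)[OF E] unfolding fspan_def by blast
    then show ?thesis using trunc_in(1)[OF E, of c] by simp
  qed
  then have "vm \<in> space_sum (Vsnap_loc G) ?F" unfolding u(1) space_sum_def by blast
  then obtain cm where cm: "vm = gcomb cm ?F" using space_sum_iff by blast
  define d where "d = (\<lambda>E f. cs E f - cm E f)"
  define e where "e = gcomb d ?F"
  have e: "e = (\<lambda>\<tau> x. vs \<tau> x - vm \<tau> x)" unfolding e_def d_def cs cm gcomb_diff ..
  have fl: "vs \<in> fields" "vm \<in> fields" "e \<in> fields" unfolding cs cm e_def by (rule gcomb_fields[OF order_refl])+
  have e': "e = (\<lambda>\<tau> x. vs \<tau> x + (-1) *\<^sub>R vm \<tau> x)" unfolding e by simp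
  interpret K: psd fields "kip G ?D" by (rule psd_kip)

  have tr_e: "\<forall>f\<in>fine_in G (frontier ?D). \<forall>x\<in>f. ntrace G (bdry_normal G f) e f x = 0"
    using sol_s sol_m by (auto simp: is_solution_def ntrace_def e inner_diff_left)
  have divQ0: "divQ G ?D e q = 0" for q
  proof -
    have "divQ G ?D vs q = divQ G ?D vm q" using sol_s sol_m by (simp add: is_solution_def)
    then show ?thesis unfolding e' divQ_add[OF fl(1,2)] by simp
  qed
  have "e \<in> Vsnap G" unfolding Vsnap_def using space_sum_iff e_def by blast
  then have vse: "kip G ?D vs e = 0"
    using sol_s tr_e divQ0 unfolding is_solution_def by auto
  define R where "R = residual G vm pm"
  have R_add: "R E (\<lambda>\<tau> x. v \<tau> x + c *\<^sub>R w \<tau> x) = R E v + c * R E w" if "v \<in> fields" "w \<in> fields" for E v w c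
    unfolding R_def using residual_add[OF fl(2) that] .
  define RD where "RD = (\<lambda>v. kip G ?D vm v - divQ G ?D v pm)"
  have RD_add: "RD (\<lambda>\<tau> x. v \<tau> x + c *\<^sub>R w \<tau> x) = RD v + c * RD w" if "v \<in> fields" "w \<in> fields" for v w c
    unfolding RD_def divQ_add[OF that] K.lin_right[OF that fl(2)] by (simp add: algebra_simps)
  have RD_loc: "RD v = R E v" if "E \<in> ?F" "v \<in> Vsnap_loc G E" for E v
    unfolding RD_def R_def residual_def using kip_local[OF that] divQ_local[OF that] by simp
  have "kip G ?D e e = kip G ?D vs e + (-1) * kip G ?D vm e"
    using K.lin[OF fl(1,2,3), of "-1"] e' by simp
  then have kee: "kip G ?D e e = - RD e" using vse divQ0 by (simp add: RD_def)
  also have "RD e = (\<Sum>E\<in>?F. 1 * RD (comb d E))"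
    unfolding e_def gcomb_def by (rule linear_lincomb[OF psd_kip RD_add fin_faces comb_fields])
  also have "\<dots> = (\<Sum>E\<in>?F. R E (comb d E))"
    using RD_loc Vsnap_loc_iff by (intro sum.cong) (simp, metis mult_1)
  finally have kR: "kip G ?D e e = - (\<Sum>E\<in>?F. R E (comb d E))" .

  \<comment> \<open>only the discarded eigenfunctions contribute to the residual\<close>
  have "\<exists>b. comb d E = lincomb b (\<phi> E) {1..J E}" if "E \<in> ?F" for E
    using eigE(5)[OF that] Vsnap_loc_iff[of "comb d E" E] by (auto simp: fspan_def)
  then obtain b where b: "\<And>E. E \<in> ?F \<Longrightarrow> comb d E = lincomb (b E) (\<phi> E) {1..J E}" by metis
  define r where "r = (\<lambda>E. lincomb (b E) (\<phi> E) {l E + 1..J E})"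
  define m where "m = (\<lambda>E. lincomb (b E) (\<phi> E) {1..l E})"
  have rm: "r E \<in> Vsnap_loc G E" "m E \<in> Vsnap_loc G E" if "E \<in> ?F" for E
    using trunc_in[OF that] by (auto simp: r_def m_def)
  have Rm: "R E (m E) = 0" if E: "E \<in> ?F" for E
  proof (cases "E \<subseteq> frontier ?D")
    case True
    have "comb d E = (\<lambda>\<tau> x. 0)" using boundary_coefficients_zero[OF E True] tr_e e_def by blast
    then have "\<forall>k\<in>{1..J E}. b E k = 0" using eigE(6)[OF E] b[OF E] by simp
    then have "m E = (\<lambda>\<tau> x. 0)" unfolding m_def lincomb_def using lJ[OF E] by (intro ext sum.neutral) auto
    then show ?thesis using R_add[OF fields_zero fields_zero, of E 1] by simp
  next
    case False
    have "m E \<in> Vms G \<phi> l"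
      unfolding Vms_def space_sum_def
    proof (intro CollectI exI conjI ballI)
      let ?u = "\<lambda>E'. if E' = E then m E else (\<lambda>\<tau> x. 0)"
      show "m E = (\<lambda>\<tau> x. \<Sum>E'\<in>?F. ?u E' \<tau> x)"
        using fin_faces E by (intro ext) (simp add: if_distrib[of "\<lambda>v. v _ _"] cong: if_cong)
      fix E' assume "E' \<in> ?F"
      have "(\<lambda>\<tau> x. 0) \<in> fspan (\<phi> E') {1..l E'}"
        unfolding fspan_def lincomb_def by (intro CollectI exI[of _ "\<lambda>_. 0"]) simp
      moreover have "m E \<in> fspan (\<phi> E) {1..l E}" unfolding fspan_def m_def by blast
      ultimately show "?u E' \<in> fspan (\<phi> E') {1..l E'}" by simp
    qed
    moreover have "\<forall>f\<in>fine_in G (frontier ?D). \<forall>x\<in>f. ntrace G (bdry_normal G f) (m E) f x = 0"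
      using boundary_trace_zero[OF E False] rm(2)[OF E] by blast
    ultimately have "RD (m E) = 0" using sol_m unfolding is_solution_def RD_def by blast
    then show ?thesis using RD_loc[OF E rm(2)[OF E]] by simp
  qed
  have Re: "R E (comb d E) = R E (r E)" if E: "E \<in> ?F" for E
  proof -
    have "comb d E = (\<lambda>\<tau> x. m E \<tau> x + 1 *\<^sub>R r E \<tau> x)"
      unfolding b[OF E] r_def m_def by (rule fspan_truncate(3)[OF lJ[OF E]])
    then show ?thesis using R_add[of "m E" "r E" E 1] Rm[OF E] Vsnap_loc_fields[OF E] rm[OF E] by simp
  qed

  let ?g = "inv_next_eigenvalue G lam l" and ?N = "\<lambda>E. dual_norm (Vsnap_loc G E) (nv E) (R E)"
  have lam_pos: "lam E k > 0" if E: "E \<in> ?F" and k: "k \<in> {1..J E}" for E k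
  proof -
    have "lam E k * S E (\<phi> E k) (\<phi> E k) > 0"
      using a_pos[OF E eigE(1)[OF E k] \<phi>_ne[OF E k]] eigE(2)[OF E k eigE(1)[OF E k]] by simp
    moreover have "S E (\<phi> E k) (\<phi> E k) > 0" using S_pos[OF E eigE(1)[OF E k] \<phi>_ne[OF E k]] .
    ultimately show ?thesis by (simp add: zero_less_mult_iff)
  qed
  have g: "?g E \<ge> 0" if E: "E \<in> ?F" for E
    using lam_pos[OF E, of "l E + 1"] lJ[OF E] by (auto simp: inv_next_eigenvalue_def J_def less_imp_le)
  have nv0: "nv E v \<ge> 0" "(nv E v)\<^sup>2 = h * S E v v" if E: "E \<in> ?F" and v: "v \<in> Vsnap_loc G E" for E v
  proof -
    have "S E v v \<ge> 0" using psd.nonneg[OF psdS[OF E] Vsnap_loc_fields[OF E v]] .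
    then show "nv E v \<ge> 0" "(nv E v)\<^sup>2 = h * S E v v" using nv[OF E v] h by auto
  qed
  have dual: "\<bar>R E (r E)\<bar> \<le> \<bar>?N E\<bar> * nv E (r E)" if E: "E \<in> ?F" for E
  proof -
    have "\<bar>R E (r E)\<bar> \<le> ?N E * nv E (r E)"
    proof (rule dual_norm_bound[OF psdS[OF E], where J = "J E" and \<phi> = "\<phi> E" and h = h])
      show "R E (lincomb c (\<phi> E) {1..J E}) = (\<Sum>k\<in>{1..J E}. c k * R E (\<phi> E k))" for c
        by (rule linear_lincomb[OF psd_kip R_add _ Vsnap_loc_fields[OF E eigE(1)[OF E]]]) simp_all
      show "\<phi> E k \<in> fields" "S E (\<phi> E k) (\<phi> E k) > 0" if k: "k \<in> {1..J E}" for k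
        using Vsnap_loc_fields[OF E eigE(1)[OF E k]] S_pos[OF E eigE(1)[OF E k] \<phi>_ne[OF E k]] by blast+
      show "S E (\<phi> E k) (\<phi> E k') = 0" if "k \<in> {1..J E}" "k' \<in> {1..J E}" "k \<noteq> k'" for k k'
        using eigE(4)[OF E that] by simp
      show "nv E v = sqrt (h * S E v v)" if "v \<in> Vsnap_loc G E" for v by (rule nv[OF E that])
    qed (use eigE(5)[OF E] h rm(1)[OF E] in simp_all)
    also have "\<dots> \<le> \<bar>?N E\<bar> * nv E (r E)" using nv0(1)[OF E rm(1)[OF E]] by (intro mult_right_mono) auto
    finally show ?thesis .
  qed
  have tail: "(nv E (r E))\<^sup>2 \<le> ?g E * (h * a E (comb d E) (comb d E))" if E: "E \<in> ?F" for E
  proof (cases "l E = J E")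
    case True
    then have "r E = (\<lambda>\<tau> x. 0)" by (simp add: r_def lincomb_def)
    then have "(nv E (r E))\<^sup>2 = 0"
      using nv0(2)[OF E rm(1)[OF E]] psd.zero_left[OF psdS[OF E] fields_zero] by simp
    then show ?thesis using True by (simp add: inv_next_eigenvalue_def J_def)
  next
    case False
    then have lE: "l E < J E" using lJ[OF E] by simp
    have vE: "comb d E \<in> Vsnap_loc G E" using Vsnap_loc_iff by blast
    have lp: "lam E (l E + 1) > 0" using lam_pos[OF E, of "l E + 1"] lE by auto
    have "lam E (l E + 1) * S E (r E) (r E) \<le> B E (T E (comb d E)) (T E (comb d E))"
      unfolding r_def
    proof (rule spectral_tail[OF psdB[OF E] psdS[OF E], where T = "T E" and J = "J E"])
      fix k assume k: "k \<in> {1..J E}"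
      note \<phi>k = eigE(1)[OF E k]
      show "\<phi> E k \<in> fields" "T E (\<phi> E k) \<in> fields" using Vsnap_loc_fields[OF E \<phi>k] T[OF E \<phi>k] by auto
      have "B E (T E (comb d E)) (T E (\<phi> E k)) = a E (\<phi> E k) (comb d E)"
        unfolding aB[OF E] using psd.sym[OF psdB[OF E] T[OF E vE] T[OF E \<phi>k]] .
      also have "\<dots> = lam E k * S E (comb d E) (\<phi> E k)"
        using eigE(2)[OF E k vE] psd.sym[OF psdS[OF E] Vsnap_loc_fields[OF E \<phi>k] Vsnap_loc_fields[OF E vE]] by simp
      finally show "B E (T E (comb d E)) (T E (\<phi> E k)) = lam E k * S E (comb d E) (\<phi> E k)" .
      show "B E (T E (\<phi> E k)) (T E (\<phi> E k)) = lam E k * S E (\<phi> E k) (\<phi> E k)"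
        using eigE(2)[OF E k \<phi>k] aB[OF E] by simp
      fix k' assume k': "k' \<in> {1..J E}" "k \<noteq> k'"
      show "B E (T E (\<phi> E k)) (T E (\<phi> E k')) = 0 \<and> S E (\<phi> E k) (\<phi> E k') = 0"
        using eigE(4)[OF E k k'] aB[OF E] by simp
    qed (use b[OF E] T[OF E vE] eigE(3)[OF E] lE in auto)
    then have "S E (r E) (r E) \<le> inverse (lam E (l E + 1)) * a E (comb d E) (comb d E)"
      using lp by (simp add: aB[OF E] field_simps)
    then have "h * S E (r E) (r E) \<le> h * (inverse (lam E (l E + 1)) * a E (comb d E) (comb d E))"
      using h by (intro mult_left_mono) auto
    then show ?thesis
      using nv0(2)[OF E rm(1)[OF E]] False by (simp add: inv_next_eigenvalue_def J_def algebra_simps)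
  qed
  have "kip G ?D e e \<le> C * (\<Sum>E\<in>?F. (?N E)\<^sup>2 * ?g E)"
  proof (rule weighted_cauchy_schwarz)
    show "0 \<le> kip G ?D e e" by (rule K.nonneg[OF fl(3)])
    have "kip G ?D e e \<le> (\<Sum>E\<in>?F. \<bar>R E (r E)\<bar>)"
    proof -
      have "(\<Sum>E\<in>?F. R E (comb d E)) = (\<Sum>E\<in>?F. R E (r E))" by (intro sum.cong refl Re)
      then show ?thesis using kR sum_abs[of "\<lambda>E. R E (r E)" ?F] by linarith
    qed
    also have "\<dots> \<le> (\<Sum>E\<in>?F. \<bar>?N E\<bar> * nv E (r E))" by (intro sum_mono dual)
    finally show "kip G ?D e e \<le> (\<Sum>E\<in>?F. \<bar>?N E\<bar> * nv E (r E))" .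
    show "0 \<le> nv E (r E)" if "E \<in> ?F" for E using nv0(1)[OF that rm(1)[OF that]] .
    show "0 \<le> h * a E (comb d E) (comb d E)" if "E \<in> ?F" for E
    proof -
      have "comb d E \<in> Vsnap_loc G E" using Vsnap_loc_iff by blast
      then show ?thesis using h psd.nonneg[OF psdB[OF that] T[OF that]] aB[OF that] by simp
    qed
    show "(\<Sum>E\<in>?F. h * a E (comb d E) (comb d E)) \<le> C * kip G ?D e e"
      unfolding e_def by (rule total)
  qed (use C tail g in auto)
  moreover have "(L2_knorm G ?D (\<lambda>\<tau> x. vs \<tau> x - vm \<tau> x))\<^sup>2 = kip G ?D e e"
    unfolding L2_knorm_def e[symmetric] using K.nonneg[OF fl(3)] by simp
  ultimately show ?thesis unfolding R_def by simp
qed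

end

section \<open>The spectral problem with minimal extensions\<close>

context gms begin

lemma kappa_pos:
  assumes "x \<in> cdom G"
  shows "kappa G x > 0"
  using kappa_bounds assms by (metis less_le_trans)

lemma nrm_fine:
  assumes "E \<in> coarse_faces G" "f \<in> fine_in G E"
  shows "norm (nrm G E) = 1" "\<And>x y. x \<in> f \<Longrightarrow> y \<in> f \<Longrightarrow> nrm G E \<bullet> (x - y) = 0"
  using nrm[OF assms(1)] fine_in_face(2)[OF assms(2)] by blast+

text \<open>A fine cell lies in the neighbourhoods of exactly the faces of its coarse block.\<close>

lemma kip_sum_omega_le:
  assumes e: "e \<in> fields"
  shows "(\<Sum>E\<in>coarse_faces G. kip G (omega G E) e e) \<le> real (NT G) * kip G (cdom G) e e"
proof -
  let ?F = "coarse_faces G"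
  define I where "I = (\<lambda>\<tau>. LINT x:\<tau>|lborel. inverse (kappa G x) * (e \<tau> x \<bullet> e \<tau> x))"
  have k: "kip G \<Omega> e e = (\<Sum>\<tau>\<in>{\<tau> \<in> fine_mesh G. \<tau> \<subseteq> \<Omega>}. I \<tau>)" for \<Omega>
    by (simp add: kip_def cell_int_def I_def)
  have I0: "0 \<le> I \<tau>" if t: "\<tau> \<in> fine_mesh G" for \<tau>
  proof -
    have "0 \<le> inverse (kappa G x)" if "x \<in> \<tau>" for x
      using kappa_pos[of x] fine_cdom[OF t] that by (auto intro: less_imp_le)
    then show ?thesis unfolding I_def set_lebesgue_integral_def
      by (intro integral_nonneg_AE AE_I2) (simp add: indicator_def)
  qed
  have count: "real (card {E \<in> ?F. \<tau> \<subseteq> omega G E}) \<le> real (NT G)" if t: "\<tau> \<in> fine_mesh G" for \<tau>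
  proof -
    obtain K where K: "K \<in> coarse_mesh G" "\<tau> \<subseteq> K" using fine_cell_in[OF t] .
    have "{E \<in> ?F. \<tau> \<subseteq> omega G E} \<subseteq> {E. E facet_of K}"
      using fine_subset_omega[OF _ t K] nbr_iff by auto
    then have "card {E \<in> ?F. \<tau> \<subseteq> omega G E} \<le> card {E. E facet_of K}"
      using finite_polytope_facets[OF mesh_cell(1)[OF cmesh K(1)]] by (intro card_mono)
    also have "\<dots> \<le> NT G" unfolding NT_def using fin_coarse K(1) by (intro Max_ge) auto
    finally show ?thesis by simp
  qed
  have "(\<Sum>E\<in>?F. kip G (omega G E) e e) = (\<Sum>E\<in>?F. \<Sum>\<tau>\<in>fine_mesh G. if \<tau> \<subseteq> omega G E then I \<tau> else 0)"
    unfolding k using fin_fine by (intro sum.cong[OF refl, of _ "\<lambda>E. sum I {\<tau> \<in> fine_mesh G. \<tau> \<subseteq> omega G E}"]) (simp add: sum.inter_filter)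
  also have "\<dots> = (\<Sum>\<tau>\<in>fine_mesh G. \<Sum>E\<in>?F. if \<tau> \<subseteq> omega G E then I \<tau> else 0)"
    by (rule sum.swap)
  also have "\<dots> = (\<Sum>\<tau>\<in>fine_mesh G. real (card {E \<in> ?F. \<tau> \<subseteq> omega G E}) * I \<tau>)"
    using fin_faces by (intro sum.cong[OF refl, where A = "fine_mesh G"]) (simp add: sum.inter_filter[symmetric])
  also have "\<dots> \<le> (\<Sum>\<tau>\<in>fine_mesh G. real (NT G) * I \<tau>)"
    by (intro sum_mono mult_right_mono count I0)
  also have "\<dots> = real (NT G) * kip G (cdom G) e e"
  proof -
    have "{\<tau> \<in> fine_mesh G. \<tau> \<subseteq> cdom G} = fine_mesh G" using fine_cdom by auto
    then show ?thesis by (simp add: k sum_distrib_left)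
  qed
  finally show ?thesis .
qed

text \<open>The coarse faces whose local spaces take part in the minimal extension from \<open>E\<close>.\<close>

abbreviation touching :: "'a set \<Rightarrow> 'a set set" where
  "touching E \<equiv> {E' \<in> coarse_faces G. omega G E' \<inter> omega G E \<noteq> {}}"

lemma self_touching:
  assumes E: "E \<in> coarse_faces G"
  shows "E \<in> touching E"
proof -
  obtain K where K: "K \<in> coarse_mesh G" "E facet_of K" using E by (auto simp: coarse_faces_def mesh_faces_def)
  then have "K \<in> nbr G E" using E nbr_iff by blast
  then have "K \<subseteq> omega G E" by (auto simp: omega_def)
  then show ?thesis using E mesh_cell(7)[OF cmesh K(1)] by auto
qed

lemma gcomb_touching:
  assumes t: "\<tau> \<in> fine_mesh G" "\<tau> \<subseteq> omega G E"
  shows "gcomb c (touching E) \<tau> = gcomb c (coarse_faces G) \<tau>"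
proof
  fix x
  show "gcomb c (touching E) \<tau> x = gcomb c (coarse_faces G) \<tau> x"
    unfolding gcomb_alt
  proof (rule sum.mono_neutral_left)
    show "\<forall>E'\<in>coarse_faces G - touching E. comb c E' \<tau> x = 0"
    proof
      fix E' assume E': "E' \<in> coarse_faces G - touching E"
      then have "\<not> \<tau> \<subseteq> omega G E'" using t mesh_cell(7)[OF fmesh t(1)] by auto
      then show "comb c E' \<tau> x = 0" using comb_outside[of E' \<tau> c] E' by auto
    qed
  qed (auto simp: fin_faces)
qed

text \<open>Extensions of a local field are the fields with the same coefficients on \<open>E\<close>.\<close>

lemma ext_candidates_iff:
  assumes E: "E \<in> coarse_faces G"
  shows "u \<in> ext_candidates G E (comb c E) \<longleftrightarrow>
     (\<exists>d. u = gcomb d (touching E) \<and> (\<forall>f\<in>fine_in G E. d E f = c E f))"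
proof -
  have tr: "ntrace G (nrm G E) (comb c E) f x = c E f" if "f \<in> fine_in G E" "x \<in> f" for f x
    using gcomb_ntrace[OF E that(1) _ that(2), of "{E}" c] E by (simp add: gcomb_single)
  have tr': "ntrace G (nrm G E) (gcomb d (touching E)) f x = d E f" if "f \<in> fine_in G E" "x \<in> f" for f x d
    using gcomb_ntrace[OF E that(1) _ that(2), of "touching E" d] self_touching[OF E] by auto
  show ?thesis
  proof
    assume u: "u \<in> ext_candidates G E (comb c E)"
    then obtain d where d: "u = gcomb d (touching E)" by (auto simp: ext_candidates_def space_sum_iff)
    have "d E f = c E f" if f: "f \<in> fine_in G E" for f
    proof -
      obtain x where "x \<in> f" using fine_face(2)[OF fine_in_face(1)[OF f]] by blast
      then show ?thesis using u tr[OF f] tr'[OF f, of x d] f unfolding ext_candidates_def d by auto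
    qed
    then show "\<exists>d. u = gcomb d (touching E) \<and> (\<forall>f\<in>fine_in G E. d E f = c E f)" using d by blast
  next
    assume "\<exists>d. u = gcomb d (touching E) \<and> (\<forall>f\<in>fine_in G E. d E f = c E f)"
    then show "u \<in> ext_candidates G E (comb c E)"
      unfolding ext_candidates_def space_sum_iff using tr tr' by auto
  qed
qed

lemma min_ext_spec:
  assumes E: "E \<in> coarse_faces G"
  shows "min_ext G E (comb c E) \<in> ext_candidates G E (comb c E) \<and>
     (\<forall>u'\<in>ext_candidates G E (comb c E). L2_knorm G (omega G E) (min_ext G E (comb c E)) \<le> L2_knorm G (omega G E) u')"
proof -
  interpret K: psd fields "kip G (omega G E)" by (rule psd_kip)
  define P where "P = (SIGMA E':touching E - {E}. fine_in G E')"
  define g where "g = (\<lambda>p. snap G (fst p) (snd p))"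
  have finP: "finite P" unfolding P_def using fin_faces fin_fine_in by auto
  have gV: "g p \<in> fields" if "p \<in> P" for p using that by (auto simp: P_def g_def intro: snap_fields)
  have vV: "comb c E \<in> fields" by (rule comb_fields[OF E])
  have split: "gcomb d (touching E) = (\<lambda>\<tau> x. comb d E \<tau> x + lincomb (\<lambda>p. d (fst p) (snd p)) g P \<tau> x)" for d
  proof (intro ext)
    fix \<tau> x
    have "gcomb d (touching E) \<tau> x = comb d E \<tau> x + (\<Sum>E'\<in>touching E - {E}. comb d E' \<tau> x)"
      unfolding gcomb_alt using fin_faces self_touching[OF E] by (intro sum.remove) auto
    also have "(\<Sum>E'\<in>touching E - {E}. comb d E' \<tau> x) = lincomb (\<lambda>p. d (fst p) (snd p)) g P \<tau> x"
      unfolding comb_def lincomb_def P_def g_def using fin_faces fin_fine_in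
      by (subst sum.Sigma) (auto simp: case_prod_beta)
    finally show "gcomb d (touching E) \<tau> x = comb d E \<tau> x + lincomb (\<lambda>p. d (fst p) (snd p)) g P \<tau> x" .
  qed
  have cE: "comb d E = comb c E" if "\<forall>f\<in>fine_in G E. d E f = c E f" for d
    unfolding comb_def lincomb_def using that by (intro ext sum.cong) auto
  obtain b where b: "\<And>d. kip G (omega G E) (\<lambda>\<tau> x. comb c E \<tau> x + lincomb b g P \<tau> x) (\<lambda>\<tau> x. comb c E \<tau> x + lincomb b g P \<tau> x)
      \<le> kip G (omega G E) (\<lambda>\<tau> x. comb c E \<tau> x + lincomb d g P \<tau> x) (\<lambda>\<tau> x. comb c E \<tau> x + lincomb d g P \<tau> x)"
    using K.minimiser_exists[of P g "comb c E", OF finP gV vV] by blast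
  define u where "u = (\<lambda>\<tau> x. comb c E \<tau> x + lincomb b g P \<tau> x)"
  have "u \<in> ext_candidates G E (comb c E)"
  proof -
    define d where "d = (\<lambda>E' f. if E' = E then c E f else b (E', f))"
    have "comb d E = comb c E" by (rule cE) (simp add: d_def)
    moreover have "lincomb (\<lambda>p. d (fst p) (snd p)) g P = lincomb b g P"
      unfolding lincomb_def by (intro ext sum.cong refl) (auto simp: P_def d_def)
    ultimately have "u = gcomb d (touching E)" unfolding split u_def by simp
    moreover have "\<forall>f\<in>fine_in G E. d E f = c E f" by (simp add: d_def)
    ultimately show ?thesis unfolding ext_candidates_iff[OF E] by blast
  qed
  moreover have "L2_knorm G (omega G E) u \<le> L2_knorm G (omega G E) u'" if u': "u' \<in> ext_candidates G E (comb c E)" for u'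
  proof -
    obtain d where d: "u' = gcomb d (touching E)" "\<forall>f\<in>fine_in G E. d E f = c E f"
      using u' ext_candidates_iff[OF E] by blast
    show ?thesis unfolding L2_knorm_def u_def d(1) split cE[of d, OF d(2)] by (intro real_sqrt_le_mono b)
  qed
  ultimately have "u \<in> ext_candidates G E (comb c E) \<and>
     (\<forall>u'\<in>ext_candidates G E (comb c E). L2_knorm G (omega G E) u \<le> L2_knorm G (omega G E) u')" by blast
  then show ?thesis
    unfolding min_ext_def
    by (rule someI[where P = "\<lambda>u. u \<in> ext_candidates G E (comb c E) \<and>
      (\<forall>u'\<in>ext_candidates G E (comb c E). L2_knorm G (omega G E) u \<le> L2_knorm G (omega G E) u')"])
qed

lemma min_ext_fields:
  assumes E: "E \<in> coarse_faces G" and v: "v \<in> Vsnap_loc G E"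
  shows "min_ext G E v \<in> fields"
proof -
  obtain c where c: "v = comb c E" using v Vsnap_loc_iff by blast
  obtain d where "min_ext G E v = gcomb d (touching E)"
    using min_ext_spec[OF E, of c] ext_candidates_iff[OF E] unfolding c by blast
  then show ?thesis by (auto intro: gcomb_fields)
qed

lemma a2_pos:
  assumes E: "E \<in> coarse_faces G" and v: "v \<in> Vsnap_loc G E" "v \<noteq> (\<lambda>\<tau> x. 0)"
  shows "a2 G E v v > 0"
proof -
  obtain c where c: "v = comb c E" using v Vsnap_loc_iff by blast
  obtain d where d: "min_ext G E v = gcomb d (touching E)" "\<forall>f\<in>fine_in G E. d E f = c E f"
    using min_ext_spec[OF E, of c] ext_candidates_iff[OF E] unfolding c by blast
  have "a2 G E v v \<noteq> 0"
  proof
    assume z: "a2 G E v v = 0"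
    have "c E f = 0" if f: "f \<in> fine_in G E" for f
    proof -
      have "d E f = 0"
        by (rule kip_omega_zero[OF E f, of "touching E"]) (use z d(1) self_touching[OF E] in \<open>auto simp: a2_def\<close>)
      then show ?thesis using d(2) f by simp
    qed
    then have "v = (\<lambda>\<tau> x. 0)" unfolding c by (rule comb_zero)
    then show False using v(2) by simp
  qed
  then show ?thesis
    using psd.nonneg[OF psd_kip min_ext_fields[OF E v(1)], of "omega G E"] by (simp add: a2_def)
qed

text \<open>The restriction of a global snapshot field to the touching faces extends its component on \<open>E\<close>.\<close>

lemma a2_le:
  assumes E: "E \<in> coarse_faces G"
  shows "a2 G E (comb c E) (comb c E) \<le> kip G (omega G E) (gcomb c (coarse_faces G)) (gcomb c (coarse_faces G))"
proof -
  have cand: "gcomb c (touching E) \<in> ext_candidates G E (comb c E)"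
    unfolding ext_candidates_iff[OF E] by blast
  have "L2_knorm G (omega G E) (min_ext G E (comb c E)) \<le> L2_knorm G (omega G E) (gcomb c (touching E))"
    using min_ext_spec[OF E] cand by blast
  then have "a2 G E (comb c E) (comb c E) \<le> kip G (omega G E) (gcomb c (touching E)) (gcomb c (touching E))"
    by (simp add: L2_knorm_def a2_def)
  also have "\<dots> = kip G (omega G E) (gcomb c (coarse_faces G)) (gcomb c (coarse_faces G))"
    unfolding kip_def cell_int_def by (intro sum.cong refl) (simp add: gcomb_touching)
  finally show ?thesis .
qed

theorem error_estimate_2:
  assumes "\<forall>E\<in>coarse_faces G. l E \<le> card (fine_in G E)"
    and "is_solution G (Vsnap G) vs ps" "is_solution G (Vms G \<phi> l) vm pm"
    and "\<forall>E\<in>coarse_faces G. eigensystem G E (a2 G E) (s2 G E) (lam E) (\<phi> E)"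
  shows "(L2_knorm G (cdom G) (\<lambda>\<tau> x. vs \<tau> x - vm \<tau> x))\<^sup>2 \<le> real (NT G) *
     (\<Sum>E\<in>coarse_faces G. (dual_norm (Vsnap_loc G E) (L2_knorm G (omega G E)) (residual G vm pm E))\<^sup>2
        * inv_next_eigenvalue G lam l E)"
proof (rule error_estimate[OF assms(1-3), where B = "\<lambda>E. kip G (omega G E)" and S = "s2 G" and a = "a2 G" and
      T = "min_ext G" and h = 1 and lam = lam and nv = "\<lambda>E. L2_knorm G (omega G E)"])
  show "psd fields (s2 G E)" for E using psd_kip[of "omega G E"] by (simp add: s2_def[abs_def])
  show "\<forall>E\<in>coarse_faces G. eigensystem G E (a2 G E) (s2 G E) (lam E) (\<phi> E)" by (rule assms(4))
  fix c
  have "(\<Sum>E\<in>coarse_faces G. 1 * a2 G E (comb c E) (comb c E))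
     \<le> (\<Sum>E\<in>coarse_faces G. kip G (omega G E) (gcomb c (coarse_faces G)) (gcomb c (coarse_faces G)))"
    using a2_le by (intro sum_mono) simp
  also have "\<dots> \<le> real (NT G) * kip G (cdom G) (gcomb c (coarse_faces G)) (gcomb c (coarse_faces G))"
    by (rule kip_sum_omega_le[OF gcomb_fields[OF order_refl]])
  finally show "(\<Sum>E\<in>coarse_faces G. 1 * a2 G E (comb c E) (comb c E))
     \<le> real (NT G) * kip G (cdom G) (gcomb c (coarse_faces G)) (gcomb c (coarse_faces G))" .
qed (auto simp: psd_kip min_ext_fields a2_def[symmetric] s2_def kip_omega_pos a2_pos L2_knorm_def)

section \<open>The spectral problem with face integrals\<close>

lemma face_int_cong: "(\<And>x. x \<in> f \<Longrightarrow> u x = v x) \<Longrightarrow> face_int f n u = face_int f n v"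
  unfolding face_int_def set_lebesgue_integral_def
  by (rule arg_cong[where f = "integral\<^sup>L _"]) (auto simp: indicator_def)

lemma coarse_face_cdom: "E \<in> coarse_faces G \<Longrightarrow> E \<subseteq> cdom G"
  using facet_dim(6)[OF cmesh] by (fastforce simp: coarse_faces_def mesh_faces_def cdom_def)

lemma face_int_kappa:
  assumes E: "E \<in> coarse_faces G" "f \<in> fine_in G E" and q: "continuous_on UNIV q"
  defines "h \<equiv> \<lambda>x. inverse (kappa G x) * q x"
  shows "set_integrable (hyperplane_measure (SOME a. a \<in> f) (nrm G E)) f h"
    and "(\<And>x. x \<in> rel_interior f \<Longrightarrow> h x * area f (nrm G E) \<le> K) \<Longrightarrow>
       face_int f (nrm G E) h \<le> K"
    and "(\<And>x. x \<in> f \<Longrightarrow> c \<le> h x) \<Longrightarrow>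
       c * area f (nrm G E) \<le> face_int f (nrm G E) h"
proof -
  note F = fine_in_face[OF E(2)]
  note ff = fine_face[OF F(1)]
  note n = nrm_fine[OF E]
  have fD: "f \<subseteq> cdom G" using F(2) coarse_face_cdom[OF E(1)] by blast
  obtain B where B: "\<And>x. x \<in> f \<Longrightarrow> \<bar>h x\<bar> \<le> B" "h \<in> borel_measurable borel"
    using kappa_inverse_times_bounded[OF fD ff(3) q] unfolding h_def by blast
  note * = face_int_le[OF n ff B(2,1)]
  show "set_integrable (hyperplane_measure (SOME a. a \<in> f) (nrm G E)) f h" by (rule *(1))
  show "face_int f (nrm G E) h \<le> K"
    if "\<And>x. x \<in> rel_interior f \<Longrightarrow> h x * area f (nrm G E) \<le> K"
    by (rule *(2)[OF _ _ _ that])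
  show "c * area f (nrm G E) \<le> face_int f (nrm G E) h"
    if "\<And>x. x \<in> f \<Longrightarrow> c \<le> h x" by (rule *(3)[OF _ _ _ that])
qed

lemma psd_a1:
  assumes E: "E \<in> coarse_faces G"
  shows "psd fields (a1 G E)"
proof -
  let ?n = "nrm G E"
  have "psd fields (\<lambda>u w. \<Sum>f\<in>fine_in G E. LINT x:f|hyperplane_measure (SOME a. a \<in> f) ?n.
      inverse (kappa G x) * (ntrace G ?n u f x * ntrace G ?n w f x))"
  proof (rule psd_integral_sum[where A = "\<lambda>f. f"])
    fix f u w assume f: "f \<in> fine_in G E" and u: "u \<in> fields" "w \<in> fields"
    have t: "face_cell G f \<in> fine_mesh G" using face_cell(1)[OF fine_in_face(1)[OF f]] .
    have "continuous_on UNIV (u (face_cell G f))" "continuous_on UNIV (w (face_cell G f))"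
      using u t by (auto simp: fields_def intro!: Vloc_continuous)
    then show "set_integrable (hyperplane_measure (SOME a. a \<in> f) ?n) f
       (\<lambda>x. inverse (kappa G x) * (ntrace G ?n u f x * ntrace G ?n w f x))"
      unfolding ntrace_def by (intro face_int_kappa(1)[OF E f] continuous_intros)
  next
    fix f u x assume f: "f \<in> fine_in G E" and x: "x \<in> f"
    have "x \<in> cdom G" using fine_in_face(2)[OF f] x coarse_face_cdom[OF E] by blast
    then have "0 \<le> inverse (kappa G x)" using kappa_pos by (simp add: less_imp_le)
    then show "0 \<le> inverse (kappa G x) * (ntrace G ?n u f x * ntrace G ?n u f x)"
      by (intro mult_nonneg_nonneg[OF _ zero_le_square])
  qed (auto simp: fields_zero fields_add ntrace_def inner_add_left algebra_simps)
  then show ?thesis unfolding a1_def[abs_def] face_int_def .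
qed

lemma a1_comb:
  assumes E: "E \<in> coarse_faces G"
  shows "a1 G E (comb c E) (comb c E)
     = (\<Sum>f\<in>fine_in G E. face_int f (nrm G E) (\<lambda>x. inverse (kappa G x) * (c E f)\<^sup>2))"
  unfolding a1_def
proof (intro sum.cong refl face_int_cong)
  fix f x assume fx: "f \<in> fine_in G E" "x \<in> f"
  have "ntrace G (nrm G E) (comb c E) f x = c E f"
    using gcomb_ntrace[OF E fx(1) _ fx(2), of "{E}" c] E by (simp add: gcomb_single)
  then show "inverse (kappa G x) * (ntrace G (nrm G E) (comb c E) f x * ntrace G (nrm G E) (comb c E) f x)
     = inverse (kappa G x) * (c E f)\<^sup>2" by (simp add: power2_eq_square)
qed

lemma a1_pos:
  assumes E: "E \<in> coarse_faces G" and v: "v \<in> Vsnap_loc G E" "v \<noteq> (\<lambda>\<tau> x. 0)"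
  shows "a1 G E v v > 0"
proof -
  obtain c where c: "v = comb c E" using v Vsnap_loc_iff by blast
  obtain f where f: "f \<in> fine_in G E" "c E f \<noteq> 0" using comb_zero[of E c] v(2) c by blast
  obtain lo hi where k: "0 < lo" "\<And>x. x \<in> cdom G \<Longrightarrow> lo \<le> kappa G x" "\<And>x. x \<in> cdom G \<Longrightarrow> kappa G x \<le> hi"
    using kappa_bounds by metis
  have ge: "(inverse hi * (c E f')\<^sup>2) * area f' (nrm G E)
      \<le> face_int f' (nrm G E) (\<lambda>x. inverse (kappa G x) * (c E f')\<^sup>2)"
    if f': "f' \<in> fine_in G E" for f'
  proof (rule face_int_kappa(3)[OF E f' continuous_on_const])
    fix x assume "x \<in> f'"
    then have "x \<in> cdom G" using fine_in_face(2)[OF f'] coarse_face_cdom[OF E] by blast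
    then have "inverse hi \<le> inverse (kappa G x)" using k by (intro le_imp_inverse_le) (auto intro: less_le_trans)
    then show "inverse hi * (c E f')\<^sup>2 \<le> inverse (kappa G x) * (c E f')\<^sup>2" by (intro mult_right_mono) auto
  qed
  obtain y where y: "y \<in> f" using fine_face(2)[OF fine_in_face(1)[OF f(1)]] by blast
  have "y \<in> cdom G" using y fine_in_face(2)[OF f(1)] coarse_face_cdom[OF E] by blast
  then have hi: "hi > 0" using k by (meson less_le_trans)
  have slab_pos: "area f (nrm G E) > 0"
  proof (rule slab_measure_pos)
    show "f \<subseteq> {x. nrm G E \<bullet> x = nrm G E \<bullet> y}"
      using nrm(2)[OF E] fine_in_face(2)[OF f(1)] y by (auto simp: inner_diff_right)
  qed (use nrm(1)[OF E] fine_face[OF fine_in_face(1)[OF f(1)]] in auto)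
  have "0 < (inverse hi * (c E f)\<^sup>2) * area f (nrm G E)"
    using hi slab_pos f(2) by simp
  also have "\<dots> \<le> face_int f (nrm G E) (\<lambda>x. inverse (kappa G x) * (c E f)\<^sup>2)" by (rule ge[OF f(1)])
  also have "\<dots> \<le> (\<Sum>f\<in>fine_in G E. face_int f (nrm G E) (\<lambda>x. inverse (kappa G x) * (c E f)\<^sup>2))"
  proof (rule member_le_sum[OF f(1) _ fin_fine_in])
    fix f' assume f': "f' \<in> fine_in G E - {f}"
    have "0 \<le> (inverse hi * (c E f')\<^sup>2) * area f' (nrm G E)"
      using hi by simp
    also have "\<dots> \<le> face_int f' (nrm G E) (\<lambda>x. inverse (kappa G x) * (c E f')\<^sup>2)" using f' by (intro ge) auto
    finally show "0 \<le> face_int f' (nrm G E) (\<lambda>x. inverse (kappa G x) * (c E f')\<^sup>2)" .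
  qed
  also have "\<dots> = a1 G E v v" unfolding c a1_comb[OF E] ..
  finally show ?thesis .
qed

end

lemma mesh_size_pos:
  fixes M :: "'a::euclidean_space set set"
  assumes M: "is_mesh M"
  shows "mesh_size M > 0"
proof -
  obtain K where K: "K \<in> M" using M by (auto simp: is_mesh_def)
  note Kd = mesh_cell[OF M K]
  obtain x e where e: "e > 0" "cball x e \<subseteq> K" using Kd(2) mem_interior_cball by (metis ex_in_conv)
  have "diameter (cball x e) \<le> diameter K"
    using e(2) compact_imp_bounded[OF Kd(4)] by (rule diameter_subset)
  then have "0 < diameter K" using e(1) by (simp add: diameter_cball)
  also have "\<dots> \<le> mesh_size M" unfolding mesh_size_def using M K by (intro Max_ge) (auto simp: is_mesh_def)
  finally show ?thesis .
qed

context gms begin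

lemma cell_component_line_poly:
  assumes t: "\<tau> \<in> fine_mesh G" and e: "e \<in> fields"
  shows "line_poly (degr G) (\<lambda>x. e \<tau> x \<bullet> n)" "continuous_on UNIV (e \<tau>)"
proof -
  have et: "e \<tau> \<in> Vloc G \<tau>" using t e by (simp add: fields_def)
  show "continuous_on UNIV (e \<tau>)" by (rule Vloc_continuous[OF t et])
  have eq: "(\<lambda>x. e \<tau> x \<bullet> n) = (\<lambda>x. \<Sum>b\<in>Basis. (n \<bullet> b) * (e \<tau> x \<bullet> b))"
    by (intro ext) (subst euclidean_inner, simp add: mult.commute)
  show "line_poly (degr G) (\<lambda>x. e \<tau> x \<bullet> n)"
    unfolding eq by (intro line_poly_sum line_poly_polys fe(2)[OF t et]) auto
qed

text \<open>At a point \<open>x\<close> of \<open>f\<close> the weight is compared with the weight in the adjacent cell that resolves it.  Which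
  cell this is may depend on \<open>x\<close>, hence the sum over the cells having \<open>f\<close> as facet.  The absolute value of
  \<open>\<theta>\<close> makes the constant nonnegative without discussing the sign.\<close>

lemma face_flux_le:
  fixes c :: "'a set \<Rightarrow> 'a set \<Rightarrow> real"
  assumes E: "E \<in> coarse_faces G" "f \<in> fine_in G E" and C: "cone_trace_bound TYPE('a) (degr G) C"
    and kr: "kappa_resolved G \<theta>" and rho: "\<rho> > 0" "\<And>\<tau>. \<tau> \<in> fine_mesh G \<Longrightarrow> cball (x0 \<tau>) \<rho> \<subseteq> \<tau>"
  defines "e \<equiv> gcomb c (coarse_faces G)"
  shows "face_int f (nrm G E) (\<lambda>x. inverse (kappa G x) * (c E f)\<^sup>2)
    \<le> C * \<bar>\<theta>\<bar> / \<rho> * (\<Sum>\<tau>\<in>{\<tau> \<in> fine_mesh G. f facet_of \<tau>}.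
         LINT x:convex hull (insert (x0 \<tau>) f)|lborel. inverse (kappa G x) * (e \<tau> x \<bullet> e \<tau> x))"
proof -
  let ?n = "nrm G E"
  let ?I = "\<lambda>\<tau>. LINT x:convex hull (insert (x0 \<tau>) f)|lborel. inverse (kappa G x) * (e \<tau> x \<bullet> e \<tau> x)"
  note F = fine_in_face[OF E(2)]
  note ff = fine_face[OF F(1)]
  note n = nrm_fine[OF E]
  obtain y where y: "y \<in> f" using ff(2) by blast
  have fn: "f \<subseteq> {x. ?n \<bullet> x = ?n \<bullet> y}" using n(2)[OF _ y] by (auto simp: inner_diff_right)
  have ef: "e \<in> fields" unfolding e_def by (rule gcomb_fields[OF order_refl])
  have C0: "C \<ge> 0" using C by (simp add: cone_trace_bound_def)
  have kp: "kappa G x > 0" if "x \<in> \<tau>" "\<tau> \<in> fine_mesh G" for x \<tau>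
    using kappa_pos[of x] fine_cdom[OF that(2)] that(1) by blast
  have sub: "convex hull (insert (x0 \<tau>) f) \<subseteq> \<tau>" if t: "\<tau> \<in> fine_mesh G" "f facet_of \<tau>" for \<tau>
  proof (rule hull_minimal)
    have "x0 \<tau> \<in> \<tau>" using rho(2)[OF t(1)] rho(1) by auto
    then show "insert (x0 \<tau>) f \<subseteq> \<tau>" using t(2) by (auto simp: facet_of_def dest: face_of_imp_subset)
  qed (rule mesh_cell(3)[OF fmesh t(1)])
  have cpt: "compact (convex hull (insert (x0 \<tau>) f))" for \<tau> using ff(3) by (intro compact_convex_hull) auto
  have I0: "0 \<le> ?I \<tau>" if t: "\<tau> \<in> fine_mesh G" "f facet_of \<tau>" for \<tau>
    unfolding set_lebesgue_integral_def
  proof (intro integral_nonneg_AE AE_I2)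
    fix x show "0 \<le> indicator (convex hull (insert (x0 \<tau>) f)) x *\<^sub>R (inverse (kappa G x) * (e \<tau> x \<bullet> e \<tau> x))"
    proof (cases "x \<in> convex hull (insert (x0 \<tau>) f)")
      case True
      then have "0 \<le> inverse (kappa G x)" using kp[of x \<tau>] sub[OF t] t(1) by (auto intro: less_imp_le)
      then have "0 \<le> inverse (kappa G x) * (e \<tau> x \<bullet> e \<tau> x)" by (intro mult_nonneg_nonneg) auto
      then show ?thesis using True by simp
    qed simp
  qed
  show ?thesis
  proof (rule face_int_kappa(2)[OF E continuous_on_const])
    fix x assume x: "x \<in> rel_interior f"
    obtain \<tau> where t: "\<tau> \<in> fine_mesh G" "f facet_of \<tau>" and kt: "\<And>z. z \<in> interior \<tau> \<Longrightarrow> kappa G z \<le> \<theta> * kappa G x"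
      using kr E x unfolding kappa_resolved_def by blast
    let ?H = "convex hull (insert (x0 \<tau>) f)" and ?m = "area f ?n"
    note td = mesh_cell[OF fmesh t(1)]
    have xf: "x \<in> f" using x rel_interior_subset by blast
    have xt: "x \<in> \<tau>" using xf t(2) by (auto simp: facet_of_def dest: face_of_imp_subset)
    have kx: "kappa G x > 0" by (rule kp[OF xt t(1)])
    have dist: "\<rho> \<le> \<bar>?n \<bullet> x0 \<tau> - ?n \<bullet> y\<bar>"
      using rho by (intro facet_distance_ge[OF td(1,2) t(2) n _ _ y] rho(2)[OF t(1)]) auto
    note lp = cell_component_line_poly[OF t(1) ef]
    have "\<forall>z\<in>f. e \<tau> z \<bullet> ?n = c E f" unfolding e_def using gcomb_trace[OF E order_refl t] E(1) by simp
    moreover have "continuous_on UNIV (\<lambda>z. e \<tau> z \<bullet> ?n)" using lp(2) by (intro continuous_intros)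
    ultimately have "\<bar>?n \<bullet> x0 \<tau> - ?n \<bullet> y\<bar> * ((c E f)\<^sup>2 * ?m) \<le> C * (LINT z:?H|lborel. (e \<tau> z \<bullet> ?n)\<^sup>2)"
      using C n(1) fn ff dist rho(1) lp(1)[of ?n] unfolding cone_trace_bound_def by auto
    moreover have "\<rho> * ((c E f)\<^sup>2 * ?m) \<le> \<bar>?n \<bullet> x0 \<tau> - ?n \<bullet> y\<bar> * ((c E f)\<^sup>2 * ?m)"
      using dist by (intro mult_right_mono) auto
    ultimately have 1: "\<rho> * ((c E f)\<^sup>2 * ?m) \<le> C * (LINT z:?H|lborel. (e \<tau> z \<bullet> ?n)\<^sup>2)" by linarith
    have "(LINT z:?H|lborel. (e \<tau> z \<bullet> ?n)\<^sup>2) \<le> (LINT z:?H|lborel. (\<bar>\<theta>\<bar> * kappa G x) * (inverse (kappa G z) * (e \<tau> z \<bullet> e \<tau> z)))"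
    proof (rule set_integral_mono_AE)
      show "set_integrable lborel ?H (\<lambda>z. (e \<tau> z \<bullet> ?n)\<^sup>2)"
        unfolding set_integrable_def using cpt lp(2)
        by (intro borel_integrable_compact continuous_intros) (auto intro: continuous_on_subset)
      have "set_integrable lborel ?H (\<lambda>z. inverse (kappa G z) * (e \<tau> z \<bullet> e \<tau> z))"
        by (rule set_integrable_subset[OF kappa_inverse_integrable[OF t(1)]])
          (use lp(2) sub[OF t] cpt in \<open>auto intro!: continuous_intros borel_compact\<close>)
      then show "set_integrable lborel ?H (\<lambda>z. (\<bar>\<theta>\<bar> * kappa G x) * (inverse (kappa G z) * (e \<tau> z \<bullet> e \<tau> z)))"
        by (intro set_integrable_mult_right) 
      have "negligible (frontier \<tau>)" by (rule negligible_convex_frontier[OF td(3)])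
      then have N: "frontier \<tau> \<in> null_sets lborel"
        by (simp add: negligible_iff_null_sets null_sets_completion_iff borel_closed)
      show "AE z\<in>?H in lborel. (e \<tau> z \<bullet> ?n)\<^sup>2 \<le> (\<bar>\<theta>\<bar> * kappa G x) * (inverse (kappa G z) * (e \<tau> z \<bullet> e \<tau> z))"
        using AE_not_in[OF N]
      proof eventually_elim
        case (elim z)
        show ?case
        proof
          assume "z \<in> ?H"
          then have zt: "z \<in> \<tau>" using sub[OF t] by blast
          then have zi: "z \<in> interior \<tau>" using elim td(5) by (auto simp: frontier_def)
          have kz: "kappa G z > 0" by (rule kp[OF zt t(1)])
          have "kappa G z \<le> \<bar>\<theta>\<bar> * kappa G x"
            using kt[OF zi] mult_right_mono[OF abs_ge_self[of \<theta>], of "kappa G x"] kx by linarith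
          then have ge1: "1 \<le> (\<bar>\<theta>\<bar> * kappa G x) * inverse (kappa G z)" using kz by (simp add: field_simps)
          have "\<bar>e \<tau> z \<bullet> ?n\<bar> \<le> norm (e \<tau> z)" using Cauchy_Schwarz_ineq2[of "e \<tau> z" ?n] n(1) by simp
          then have "(e \<tau> z \<bullet> ?n)\<^sup>2 \<le> 1 * (e \<tau> z \<bullet> e \<tau> z)"
            by (simp add: dot_square_norm abs_le_square_iff[symmetric])
          also have "\<dots> \<le> ((\<bar>\<theta>\<bar> * kappa G x) * inverse (kappa G z)) * (e \<tau> z \<bullet> e \<tau> z)"
            by (intro mult_right_mono ge1) auto
          finally show "(e \<tau> z \<bullet> ?n)\<^sup>2 \<le> (\<bar>\<theta>\<bar> * kappa G x) * (inverse (kappa G z) * (e \<tau> z \<bullet> e \<tau> z))"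
            by (simp add: mult.assoc)
        qed
      qed
    qed
    also have "\<dots> = (\<bar>\<theta>\<bar> * kappa G x) * ?I \<tau>" by simp
    finally have "\<rho> * ((c E f)\<^sup>2 * ?m) \<le> C * ((\<bar>\<theta>\<bar> * kappa G x) * ?I \<tau>)"
      using 1 mult_left_mono[OF _ C0] by (meson order_trans)
    then have "inverse (kappa G x) * (c E f)\<^sup>2 * ?m \<le> C * \<bar>\<theta>\<bar> / \<rho> * ?I \<tau>"
      using kx rho(1) by (simp add: field_simps)
    also have "\<dots> \<le> C * \<bar>\<theta>\<bar> / \<rho> * (\<Sum>\<tau>\<in>{\<tau> \<in> fine_mesh G. f facet_of \<tau>}. ?I \<tau>)"
      using C0 rho(1) t I0 fin_fine by (intro mult_left_mono member_le_sum) auto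
    finally show "inverse (kappa G x) * (c E f)\<^sup>2 * ?m \<le> C * \<bar>\<theta>\<bar> / \<rho> * (\<Sum>\<tau>\<in>{\<tau> \<in> fine_mesh G. f facet_of \<tau>}. ?I \<tau>)" .
  qed
qed

text \<open>Exchanging the sums over faces and cells, the integrals over the cones in a fixed cell add up to at most
  the integral over the cell.\<close>

lemma a1_sum_le:
  fixes c :: "'a set \<Rightarrow> 'a set \<Rightarrow> real"
  assumes C: "cone_trace_bound TYPE('a) (degr G) C" and kr: "kappa_resolved G \<theta>" and qu: "quasi_uniform G \<sigma>"
  defines "e \<equiv> gcomb c (coarse_faces G)"
  shows "(\<Sum>E\<in>coarse_faces G. a1 G E (comb c E) (comb c E))
    \<le> C * \<bar>\<theta>\<bar> / (\<sigma> * mesh_size (fine_mesh G)) * kip G (cdom G) e e"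
proof -
  let ?F = "coarse_faces G" and ?M = "fine_mesh G"
  define \<rho> where "\<rho> = \<sigma> * mesh_size ?M"
  have rho: "\<rho> > 0" using qu mesh_size_pos[OF fmesh] by (simp add: \<rho>_def quasi_uniform_def)
  have "\<forall>\<tau>\<in>?M. \<exists>x. cball x \<rho> \<subseteq> \<tau>" using qu by (simp add: quasi_uniform_def \<rho>_def)
  then obtain x0 where x0: "\<And>\<tau>. \<tau> \<in> ?M \<Longrightarrow> cball (x0 \<tau>) \<rho> \<subseteq> \<tau>" by metis
  have ef: "e \<in> fields" unfolding e_def by (rule gcomb_fields[OF order_refl])
  define g where "g = (\<lambda>\<tau> x. inverse (kappa G x) * (e \<tau> x \<bullet> e \<tau> x))"
  define I where "I = (\<lambda>\<tau> f. LINT x:convex hull (insert (x0 \<tau>) f)|lborel. g \<tau> x)"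
  have C0: "C * \<bar>\<theta>\<bar> / \<rho> \<ge> 0" using C rho by (simp add: cone_trace_bound_def)
  define P where "P = (\<Union>E\<in>?F. fine_in G E)"
  have finP: "finite P" unfolding P_def using fin_faces fin_fine_in by auto
  have "(\<Sum>E\<in>?F. a1 G E (comb c E) (comb c E))
     \<le> (\<Sum>E\<in>?F. \<Sum>f\<in>fine_in G E. C * \<bar>\<theta>\<bar> / \<rho> * (\<Sum>\<tau>\<in>{\<tau> \<in> ?M. f facet_of \<tau>}. I \<tau> f))"
    unfolding I_def g_def e_def
    by (intro sum_mono) (simp only: a1_comb, intro sum_mono face_flux_le[OF _ _ C kr rho x0])
  also have "\<dots> = C * \<bar>\<theta>\<bar> / \<rho> * (\<Sum>E\<in>?F. \<Sum>f\<in>fine_in G E. \<Sum>\<tau>\<in>{\<tau> \<in> ?M. f facet_of \<tau>}. I \<tau> f)"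
    by (simp add: sum_distrib_left)
  finally have flux: "(\<Sum>E\<in>?F. a1 G E (comb c E) (comb c E))
     \<le> C * \<bar>\<theta>\<bar> / \<rho> * (\<Sum>E\<in>?F. \<Sum>f\<in>fine_in G E. \<Sum>\<tau>\<in>{\<tau> \<in> ?M. f facet_of \<tau>}. I \<tau> f)" .
  have "(\<Sum>E\<in>?F. \<Sum>f\<in>fine_in G E. \<Sum>\<tau>\<in>{\<tau> \<in> ?M. f facet_of \<tau>}. I \<tau> f)
     = (\<Sum>f\<in>P. \<Sum>\<tau>\<in>{\<tau> \<in> ?M. f facet_of \<tau>}. I \<tau> f)"
    unfolding P_def
  proof (rule sum.UNION_disjoint[symmetric])
    show "\<forall>E\<in>?F. \<forall>E'\<in>?F. E \<noteq> E' \<longrightarrow> fine_in G E \<inter> fine_in G E' = {}"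
    proof (intro ballI impI equals0I)
      fix E E' f assume EE: "E \<in> ?F" "E' \<in> ?F" "E \<noteq> E'" "f \<in> fine_in G E \<inter> fine_in G E'"
      then have f: "f \<in> fine_in G E" "f \<in> fine_in G E'" by auto
      show False
        using mesh_faces_unique[OF cmesh, of E E' f] EE(1-3) fine_in_face[OF f(1)] fine_in_face[OF f(2)] fine_face
        by (auto simp: coarse_faces_def)
    qed
  qed (auto simp: fin_faces fin_fine_in)
  also have "\<dots> = (\<Sum>f\<in>P. \<Sum>\<tau>\<in>?M. if f facet_of \<tau> then I \<tau> f else 0)"
    using fin_fine by (simp add: sum.inter_filter)
  also have "\<dots> = (\<Sum>\<tau>\<in>?M. \<Sum>f\<in>P. if f facet_of \<tau> then I \<tau> f else 0)" by (rule sum.swap)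
  also have "\<dots> = (\<Sum>\<tau>\<in>?M. \<Sum>f\<in>{f \<in> P. f facet_of \<tau>}. I \<tau> f)"
    using finP by (simp add: sum.inter_filter)
  also have "\<dots> \<le> (\<Sum>\<tau>\<in>?M. LINT x:\<tau>|lborel. g \<tau> x)"
  proof (rule sum_mono)
    fix \<tau> assume t: "\<tau> \<in> ?M"
    show "(\<Sum>f\<in>{f \<in> P. f facet_of \<tau>}. I \<tau> f) \<le> (LINT x:\<tau>|lborel. g \<tau> x)"
      unfolding I_def
    proof (rule sum_facet_cones_le[OF mesh_cell(1)[OF fmesh t]])
      show "x0 \<tau> \<in> interior \<tau>" using x0[OF t] rho mem_interior_cball by blast
      show "set_integrable lborel \<tau> (g \<tau>)"
        unfolding g_def using cell_component_line_poly(2)[OF t ef]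
        by (intro kappa_inverse_integrable[OF t] continuous_intros)
      show "0 \<le> g \<tau> x" if "x \<in> \<tau>" for x
      proof -
        have "0 \<le> inverse (kappa G x)" using kappa_pos[of x] fine_cdom[OF t] that by (auto intro: less_imp_le)
        then show ?thesis unfolding g_def by (intro mult_nonneg_nonneg) auto
      qed
    qed (use finP in auto)
  qed
  also have "\<dots> = kip G (cdom G) e e"
  proof -
    have "{\<tau> \<in> ?M. \<tau> \<subseteq> cdom G} = ?M" using fine_cdom by auto
    then show ?thesis by (simp add: kip_def cell_int_def g_def)
  qed
  finally have "C * \<bar>\<theta>\<bar> / \<rho> * (\<Sum>E\<in>?F. \<Sum>f\<in>fine_in G E. \<Sum>\<tau>\<in>{\<tau> \<in> ?M. f facet_of \<tau>}. I \<tau> f)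
     \<le> C * \<bar>\<theta>\<bar> / \<rho> * kip G (cdom G) e e"
    using C0 by (rule mult_left_mono)
  with flux show ?thesis unfolding \<rho>_def by linarith
qed

theorem error_estimate_1:
  assumes "\<forall>E\<in>coarse_faces G. l E \<le> card (fine_in G E)"
    and "is_solution G (Vsnap G) vs ps" "is_solution G (Vms G \<phi> l) vm pm"
    and "\<forall>E\<in>coarse_faces G. eigensystem G E (a1 G E) (s1 G E) (lam E) (\<phi> E)"
    and C: "cone_trace_bound TYPE('a) (degr G) C" and kr: "kappa_resolved G \<theta>" and qu: "quasi_uniform G \<sigma>"
  shows "(L2_knorm G (cdom G) (\<lambda>\<tau> x. vs \<tau> x - vm \<tau> x))\<^sup>2
     \<le> (C * \<bar>\<theta>\<bar> / \<sigma>) * mesh_size (coarse_mesh G) / mesh_size (fine_mesh G) *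
     (\<Sum>E\<in>coarse_faces G. (dual_norm (Vsnap_loc G E) (Hdiv_knorm G (omega G E)) (residual G vm pm E))\<^sup>2
        * inv_next_eigenvalue G lam l E)"
proof -
  let ?H = "mesh_size (coarse_mesh G)" and ?h = "mesh_size (fine_mesh G)"
  have H: "?H > 0" "?h > 0" using mesh_size_pos cmesh fmesh by auto
  have ps: "psd fields (s1 G E)" for E
    unfolding s1_def[abs_def] by (rule psd_divide[OF psd_add[OF psd_kip psd_divip] H(1)])
  have pos: "0 < s1 G E v v" if "E \<in> coarse_faces G" "v \<in> Vsnap_loc G E" "v \<noteq> (\<lambda>\<tau> x. 0)" for E v
    using kip_omega_pos[OF that] psd.nonneg[OF psd_divip Vsnap_loc_fields[OF that(1,2)], of "omega G E"] H(1)
    by (simp add: s1_def)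
  show ?thesis
  proof (rule error_estimate[OF assms(1-3), where B = "a1 G" and S = "s1 G" and a = "a1 G" and
      T = "\<lambda>E v. v" and h = ?H and lam = lam and nv = "\<lambda>E. Hdiv_knorm G (omega G E)"])
    show "\<forall>E\<in>coarse_faces G. eigensystem G E (a1 G E) (s1 G E) (lam E) (\<phi> E)" by (rule assms(4))
    show "0 \<le> C * \<bar>\<theta>\<bar> / \<sigma> * ?H / ?h"
      using C qu H by (simp add: cone_trace_bound_def quasi_uniform_def)
    fix c
    have "?H * (\<Sum>E\<in>coarse_faces G. a1 G E (comb c E) (comb c E))
      \<le> ?H * (C * \<bar>\<theta>\<bar> / (\<sigma> * ?h) * kip G (cdom G) (gcomb c (coarse_faces G)) (gcomb c (coarse_faces G)))"
      using H(1) by (intro mult_left_mono a1_sum_le[OF C kr qu]) auto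
    then show "(\<Sum>E\<in>coarse_faces G. ?H * a1 G E (comb c E) (comb c E))
      \<le> C * \<bar>\<theta>\<bar> / \<sigma> * ?H / ?h * kip G (cdom G) (gcomb c (coarse_faces G)) (gcomb c (coarse_faces G))"
      by (simp add: sum_distrib_left[symmetric] mult_ac)
    show "Hdiv_knorm G (omega G E) v = sqrt (?H * s1 G E v v)" for E v
      using H(1) by (simp add: Hdiv_knorm_def s1_def)
  qed (use H(1) in \<open>simp_all add: psd_a1 ps pos a1_pos Vsnap_loc_fields\<close>)
qed

end

section \<open>The two error bounds\<close>

theorem lemma1:
  "\<exists>C\<^sub>V :: nat \<Rightarrow> real \<Rightarrow> real \<Rightarrow> real.
     \<forall>(G :: 'a::euclidean_space gmsfem) lam \<phi> l v\<^sub>s p\<^sub>s v\<^sub>m p\<^sub>m.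
       gmsfem_ok G \<longrightarrow>
       (\<forall>E\<in>coarse_faces G. l E \<le> card (fine_in G E)) \<longrightarrow>
       is_solution G (Vsnap G) v\<^sub>s p\<^sub>s \<longrightarrow>
       is_solution G (Vms G \<phi> l) v\<^sub>m p\<^sub>m \<longrightarrow>
       (\<forall>\<sigma> \<theta>. quasi_uniform G \<sigma> \<longrightarrow> kappa_resolved G \<theta> \<longrightarrow>
          (\<forall>E\<in>coarse_faces G. eigensystem G E (a1 G E) (s1 G E) (lam E) (\<phi> E)) \<longrightarrow>
          (L2_knorm G (cdom G) (\<lambda>\<tau> x. v\<^sub>s \<tau> x - v\<^sub>m \<tau> x))\<^sup>2
            \<le> C\<^sub>V (degr G) \<sigma> \<theta> * mesh_size (coarse_mesh G) / mesh_size (fine_mesh G) *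
              (\<Sum>E\<in>coarse_faces G.
                 (dual_norm (Vsnap_loc G E) (Hdiv_knorm G (omega G E)) (residual G v\<^sub>m p\<^sub>m E))\<^sup>2
                   * inv_next_eigenvalue G lam l E)) \<and>
       ((\<forall>E\<in>coarse_faces G. eigensystem G E (a2 G E) (s2 G E) (lam E) (\<phi> E)) \<longrightarrow>
          (L2_knorm G (cdom G) (\<lambda>\<tau> x. v\<^sub>s \<tau> x - v\<^sub>m \<tau> x))\<^sup>2
            \<le> real (NT G) *
              (\<Sum>E\<in>coarse_faces G.
                 (dual_norm (Vsnap_loc G E) (L2_knorm G (omega G E)) (residual G v\<^sub>m p\<^sub>m E))\<^sup>2
                   * inv_next_eigenvalue G lam l E))"
proof -
  obtain C where C: "\<And>k. cone_trace_bound TYPE('a) k (C k)"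
    using face_cone_trace[where 'a = 'a] by metis
  show ?thesis
  proof (intro exI[of _ "\<lambda>k \<sigma> \<theta>. C k * \<bar>\<theta>\<bar> / \<sigma>"] allI impI conjI)
    fix G :: "'a gmsfem" and lam \<phi> l v\<^sub>s p\<^sub>s v\<^sub>m p\<^sub>m
    assume ok: "gmsfem_ok G" and a: "\<forall>E\<in>coarse_faces G. l E \<le> card (fine_in G E)"
      "is_solution G (Vsnap G) v\<^sub>s p\<^sub>s" "is_solution G (Vms G \<phi> l) v\<^sub>m p\<^sub>m"
    interpret gms G using ok by unfold_locales
    fix \<sigma> \<theta>
    assume qu: "quasi_uniform G \<sigma>" and kr: "kappa_resolved G \<theta>"
      and eig: "\<forall>E\<in>coarse_faces G. eigensystem G E (a1 G E) (s1 G E) (lam E) (\<phi> E)"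
    show "(L2_knorm G (cdom G) (\<lambda>\<tau> x. v\<^sub>s \<tau> x - v\<^sub>m \<tau> x))\<^sup>2
            \<le> C (degr G) * \<bar>\<theta>\<bar> / \<sigma> * mesh_size (coarse_mesh G) / mesh_size (fine_mesh G) *
              (\<Sum>E\<in>coarse_faces G.
                 (dual_norm (Vsnap_loc G E) (Hdiv_knorm G (omega G E)) (residual G v\<^sub>m p\<^sub>m E))\<^sup>2
                   * inv_next_eigenvalue G lam l E)"
      by (rule error_estimate_1[OF a eig C kr qu])
  next
    fix G :: "'a gmsfem" and lam \<phi> l v\<^sub>s p\<^sub>s v\<^sub>m p\<^sub>m
    assume ok: "gmsfem_ok G" and a: "\<forall>E\<in>coarse_faces G. l E \<le> card (fine_in G E)"
      "is_solution G (Vsnap G) v\<^sub>s p\<^sub>s" "is_solution G (Vms G \<phi> l) v\<^sub>m p\<^sub>m"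
    interpret gms G using ok by unfold_locales
    assume eig: "\<forall>E\<in>coarse_faces G. eigensystem G E (a2 G E) (s2 G E) (lam E) (\<phi> E)"
    show "(L2_knorm G (cdom G) (\<lambda>\<tau> x. v\<^sub>s \<tau> x - v\<^sub>m \<tau> x))\<^sup>2
            \<le> real (NT G) *
              (\<Sum>E\<in>coarse_faces G.
                 (dual_norm (Vsnap_loc G E) (L2_knorm G (omega G E)) (residual G v\<^sub>m p\<^sub>m E))\<^sup>2
                   * inv_next_eigenvalue G lam l E)"
      by (rule error_estimate_2[OF a eig])
  qed
qed

end
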